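(* Let $\mathcal G$ be a compact metric graph with edge set $\mathcal E$, $p>2$, $m^*$ a positive integer, and let $W\in L^\infty(\mathcal G)$ and $\rho\in L^\infty(\mathcal G)\setminus\{0\}$ be such that there exists $a>0$ for which, for every $e\in\mathcal E$, either $\rho\ge a$ on $e$ or $\rho\equiv0$ on $e$. Let $$\Lambda_{m^*}:=\inf\bigl\{\lambda\in\mathbb R\bigm|\exists u\in H^1(\mathcal G)\setminus\{0\},\ (\lambda,u)\text{ solves }(E),\ \mathrm m(u)\le m^*\bigr\},$$ where $(E)$ is the problem $$(E)\quad\begin{cases}-u''+W(x)u+\lambda u=\rho(x)|u|^{p-2}u&\text{on every edge } e\in\mathcal E,\\ u\text{ is continuous on }\mathcal G,\\ \sum_{e\succ v}\frac{du_e}{dx}(v)=0&\text{at every vertex }v\end{cases}$$ and $\mathrm m(u)$ is the Morse index of $u$. Then $$\Lambda_{m^*}\ge-\lambda_{m^*+1}\bigl(-v''+W(x)v\bigr),$$ where $\lambda_{j}(-v''+W(x)v)$ denotes the $j$-th eigenvalue of the operator $v\mapsto-v''+W(x)v$ on $\mathcal G$ with Kirchhoff conditions. Moreover, if $m^*=1$ and $\inf_{\mathcal G}\rho>0$, one has $$\Lambda_1=-\lambda_1\bigl(-v''+W(x)v\bigr)$$ and the infimum defining $\Lambda_1$ is not attained.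
   Context: Metric graphs: $\mathcal G=(\mathcal E,\mathcal V)$ with edges $\mathcal E$ and vertices $\mathcal V$. A compact metric graph is a connected metric graph with finitely many edges, all of finite positive length; each edge $e$ is identified with $[0,\ell_e]$. $u_e$ is the restriction of $u$ to $e$. $H^1(\mathcal G)$ is the space of continuous $u:\mathcal G\to\mathbb R$ with $u_e\in H^1(0,\ell_e)$ for every edge. The notation $e\succ v$ means that $e$ is incident to $v$, and $\frac{du_e}{dx}(v)$ is the derivative along $e$ at $v$ directed away from $v$. The Kirchhoff conditions for a function are: continuity on $\mathcal G$ and vanishing, at each vertex, of the sum of the derivatives directed away from the vertex along the incident edges. Solutions of $(E)$ are weak solutions: $\int_{\mathcal G}(u'\varphi'+(W+\lambda)u\varphi)\,dx=\int_{\mathcal G}\rho|u|^{p-2}u\varphi\,dx$ for all $\varphi\in H^1(\mathcal G)$. Eigenvalues are listed in nondecreasing order $\lambda_1\le\lambda_2\le\cdots$, counted with multiplicity. The convention is $\inf\emptyset=+\infty$. Infima of functions defined a.e. are essential infima. The Morse index $\mathrm m(u)$ of a solution $(\lambda,u)$ is the maximal dimension (or $+\infty$) of a subspace $X\subset H^1(\mathcal G)$ such that $\int_{\mathcal G}(|\varphi'|^2+(W+\lambda)\varphi^2-(p-1)\rho|u|^{p-2}\varphi^2)\,dx<0$ for all $\varphi\in X\setminus\{0\}$. *)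

theory Defs
  imports
    "HOL-Analysis.Analysis"
    "HOL-Library.Extended_Nat"
    "HOL-Library.Function_Algebras"
    "Graph_Theory.Digraph_Component"
begin

section \<open>Function spaces as real vector spaces\<close>

instantiation "fun" :: (type, real_vector) real_vector
begin

definition scaleR_fun :: "real \<Rightarrow> ('a \<Rightarrow> 'b) \<Rightarrow> 'a \<Rightarrow> 'b" where
  "scaleR_fun c f = (\<lambda>x. c *\<^sub>R f x)"

instance
  by standard (auto simp: scaleR_fun_def fun_eq_iff scaleR_add_right scaleR_add_left)

end

text \<open>The library constant \<^const>\<open>dim\<close> is \<open>0\<close> on infinite-dimensional spaces; here the
  dimension is \<open>\<infinity>\<close> in that case.\<close>

definition edim :: "'a::real_vector set \<Rightarrow> enat" where
  "edim X = Sup {enat (card B) | B. finite B \<and> independent B \<and> B \<subseteq> X}"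

section \<open>Compact metric graphs\<close>

text \<open>
  The combinatorial graph is a digraph in which loops and parallel edges are allowed; the direction
  of an arc \<open>e\<close> only records the identification of the edge with \<open>[0, len e]\<close>, with \<open>0\<close> at
  \<open>tail G e\<close> and \<open>len e\<close> at \<open>head G e\<close>. Connectedness is that of the underlying undirected graph
  (and includes that there is at least one vertex).
\<close>

locale compact_metric_graph = fin_digraph G
  for G :: "('v, 'e) pre_digraph" +
  fixes len :: "'e \<Rightarrow> real"
  assumes connected: "Digraph_Component.connected G"
    and len_pos: "e \<in> arcs G \<Longrightarrow> 0 < len e"

text \<open>A function on the graph is given edgewise: \<open>u e\<close> is the restriction of \<open>u\<close> to \<open>e\<close>, of which
  only the values on \<open>[0, len e]\<close> are relevant.\<close>

type_synonym 'e graph_fun = "'e \<Rightarrow> real \<Rightarrow> real"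

abbreviation edge_measure :: "real \<Rightarrow> real measure" where
  "edge_measure l \<equiv> lebesgue_on {0..l}"

definition graph_integral :: "('v, 'e) pre_digraph \<Rightarrow> ('e \<Rightarrow> real) \<Rightarrow> 'e graph_fun \<Rightarrow> real" where
  "graph_integral G len f = (\<Sum>e\<in>arcs G. \<integral>x. f e x \<partial>edge_measure (len e))"

definition graph_Linfty :: "('v, 'e) pre_digraph \<Rightarrow> ('e \<Rightarrow> real) \<Rightarrow> 'e graph_fun set" where
  "graph_Linfty G len = {f. \<forall>e\<in>arcs G. f e \<in> borel_measurable (edge_measure (len e)) \<and>
     (\<exists>C. AE x in edge_measure (len e). \<bar>f e x\<bar> \<le> C)}"

definition graph_AE_zero :: "('v, 'e) pre_digraph \<Rightarrow> ('e \<Rightarrow> real) \<Rightarrow> 'e graph_fun \<Rightarrow> bool" where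
  "graph_AE_zero G len f \<longleftrightarrow> (\<forall>e\<in>arcs G. AE x in edge_measure (len e). f e x = 0)"

definition graph_essinf :: "('v, 'e) pre_digraph \<Rightarrow> ('e \<Rightarrow> real) \<Rightarrow> 'e graph_fun \<Rightarrow> ereal" where
  "graph_essinf G len f =
     Sup {c. \<forall>e\<in>arcs G. AE x in edge_measure (len e). c \<le> ereal (f e x)}"

section \<open>Sobolev spaces\<close>

definition L2_interval :: "real \<Rightarrow> (real \<Rightarrow> real) set" where
  "L2_interval l = {f. f \<in> borel_measurable (edge_measure l) \<and>
     integrable (edge_measure l) (\<lambda>x. (f x)\<^sup>2)}"

text \<open>Continuously differentiable functions with compact support in \<open>(0, l)\<close>.\<close>

definition test_funs :: "real \<Rightarrow> (real \<Rightarrow> real) set" where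
  "test_funs l = {\<phi>. (\<forall>x. \<phi> differentiable (at x)) \<and> continuous_on UNIV (deriv \<phi>) \<and>
     (\<exists>K. compact K \<and> K \<subseteq> {0<..<l} \<and> (\<forall>x. x \<notin> K \<longrightarrow> \<phi> x = 0))}"

definition is_weak_deriv :: "real \<Rightarrow> (real \<Rightarrow> real) \<Rightarrow> (real \<Rightarrow> real) \<Rightarrow> bool" where
  "is_weak_deriv l u g \<longleftrightarrow> (\<forall>\<phi>\<in>test_funs l.
     (\<integral>x. u x * deriv \<phi> x \<partial>edge_measure l) = - (\<integral>x. g x * \<phi> x \<partial>edge_measure l))"

definition H1_interval :: "real \<Rightarrow> (real \<Rightarrow> real) set" where
  "H1_interval l = {u \<in> L2_interval l. \<exists>g\<in>L2_interval l. is_weak_deriv l u g}"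

text \<open>Only determined up to equality almost everywhere.\<close>

definition weak_deriv :: "real \<Rightarrow> (real \<Rightarrow> real) \<Rightarrow> real \<Rightarrow> real" where
  "weak_deriv l u = (SOME g. g \<in> L2_interval l \<and> is_weak_deriv l u g)"

definition H2_interval :: "real \<Rightarrow> (real \<Rightarrow> real) set" where
  "H2_interval l = {u \<in> H1_interval l. weak_deriv l u \<in> H1_interval l}"

definition graph_continuous :: "('v, 'e) pre_digraph \<Rightarrow> ('e \<Rightarrow> real) \<Rightarrow> 'e graph_fun \<Rightarrow> bool" where
  "graph_continuous G len u \<longleftrightarrow>
     (\<forall>e\<in>arcs G. continuous_on {0..len e} (u e)) \<and>
     (\<exists>c. \<forall>e\<in>arcs G. u e 0 = c (tail G e) \<and> u e (len e) = c (head G e))"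

text \<open>Elements of \<open>H\<^sup>1\<close> of the graph are normalised to vanish at irrelevant arguments, so that
  distinct elements are distinct functions on the graph.\<close>

definition graph_H1 :: "('v, 'e) pre_digraph \<Rightarrow> ('e \<Rightarrow> real) \<Rightarrow> 'e graph_fun set" where
  "graph_H1 G len = {u. graph_continuous G len u \<and> (\<forall>e\<in>arcs G. u e \<in> H1_interval (len e)) \<and>
     (\<forall>e x. \<not> (e \<in> arcs G \<and> x \<in> {0..len e}) \<longrightarrow> u e x = 0)}"

definition graph_deriv :: "('e \<Rightarrow> real) \<Rightarrow> 'e graph_fun \<Rightarrow> 'e graph_fun" where
  "graph_deriv len u = (\<lambda>e. weak_deriv (len e) (u e))"

section \<open>The nonlinear problem\<close>

text \<open>Weak solutions of \<open>-u'' + W u + lam u = \<rho> |u|\<^bsup>p-2\<^esup> u\<close> with Kirchhoff conditions.\<close>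

definition solves_E :: "('v, 'e) pre_digraph \<Rightarrow> ('e \<Rightarrow> real) \<Rightarrow> real \<Rightarrow> 'e graph_fun \<Rightarrow> 'e graph_fun
    \<Rightarrow> real \<Rightarrow> 'e graph_fun \<Rightarrow> bool" where
  "solves_E G len p W \<rho> lam u \<longleftrightarrow> u \<in> graph_H1 G len \<and>
     (\<forall>\<phi>\<in>graph_H1 G len.
        graph_integral G len (\<lambda>e x. graph_deriv len u e x * graph_deriv len \<phi> e x
          + (W e x + lam) * u e x * \<phi> e x)
      = graph_integral G len (\<lambda>e x. \<rho> e x * \<bar>u e x\<bar> powr (p - 2) * u e x * \<phi> e x))"

definition second_variation :: "('v, 'e) pre_digraph \<Rightarrow> ('e \<Rightarrow> real) \<Rightarrow> real \<Rightarrow> 'e graph_fun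
    \<Rightarrow> 'e graph_fun \<Rightarrow> real \<Rightarrow> 'e graph_fun \<Rightarrow> 'e graph_fun \<Rightarrow> real" where
  "second_variation G len p W \<rho> lam u \<phi> = graph_integral G len (\<lambda>e x.
     (graph_deriv len \<phi> e x)\<^sup>2 + (W e x + lam) * (\<phi> e x)\<^sup>2
       - (p - 1) * \<rho> e x * \<bar>u e x\<bar> powr (p - 2) * (\<phi> e x)\<^sup>2)"

definition morse_index :: "('v, 'e) pre_digraph \<Rightarrow> ('e \<Rightarrow> real) \<Rightarrow> real \<Rightarrow> 'e graph_fun
    \<Rightarrow> 'e graph_fun \<Rightarrow> real \<Rightarrow> 'e graph_fun \<Rightarrow> enat" where
  "morse_index G len p W \<rho> lam u = Sup {edim X | X. subspace X \<and> X \<subseteq> graph_H1 G len \<and>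
     (\<forall>\<phi>\<in>X - {0}. second_variation G len p W \<rho> lam u \<phi> < 0)}"

definition admissible_lambdas :: "('v, 'e) pre_digraph \<Rightarrow> ('e \<Rightarrow> real) \<Rightarrow> real \<Rightarrow> 'e graph_fun
    \<Rightarrow> 'e graph_fun \<Rightarrow> nat \<Rightarrow> real set" where
  "admissible_lambdas G len p W \<rho> m = {lam. \<exists>u\<in>graph_H1 G len - {0}.
     solves_E G len p W \<rho> lam u \<and> morse_index G len p W \<rho> lam u \<le> enat m}"

definition Lambda_inf :: "('v, 'e) pre_digraph \<Rightarrow> ('e \<Rightarrow> real) \<Rightarrow> real \<Rightarrow> 'e graph_fun
    \<Rightarrow> 'e graph_fun \<Rightarrow> nat \<Rightarrow> ereal" where
  "Lambda_inf G len p W \<rho> m = Inf (ereal ` admissible_lambdas G len p W \<rho> m)"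

section \<open>Eigenvalues of the Kirchhoff operator\<close>

text \<open>Sum over the edges incident to \<open>v\<close> of the derivatives directed away from \<open>v\<close>. A loop at
  \<open>v\<close> contributes at both of its ends.\<close>

definition kirchhoff_sum :: "('v, 'e) pre_digraph \<Rightarrow> ('e \<Rightarrow> real) \<Rightarrow> 'e graph_fun \<Rightarrow> 'v \<Rightarrow> real"
  where
  "kirchhoff_sum G len u v =
     (\<Sum>e\<in>out_arcs G v. vector_derivative (u e) (at 0 within {0..len e}))
     + (\<Sum>e\<in>in_arcs G v. - vector_derivative (u e) (at (len e) within {0..len e}))"

definition kirchhoff_domain :: "('v, 'e) pre_digraph \<Rightarrow> ('e \<Rightarrow> real) \<Rightarrow> 'e graph_fun set" where
  "kirchhoff_domain G len = {u \<in> graph_H1 G len. (\<forall>e\<in>arcs G. u e \<in> H2_interval (len e)) \<and>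
     (\<forall>v\<in>verts G. kirchhoff_sum G len u v = 0)}"

definition schroedinger_op :: "('e \<Rightarrow> real) \<Rightarrow> 'e graph_fun \<Rightarrow> 'e graph_fun \<Rightarrow> 'e graph_fun" where
  "schroedinger_op len W v =
     (\<lambda>e x. - graph_deriv len (graph_deriv len v) e x + W e x * v e x)"

definition eigenspace :: "('v, 'e) pre_digraph \<Rightarrow> ('e \<Rightarrow> real) \<Rightarrow> 'e graph_fun \<Rightarrow> real
    \<Rightarrow> 'e graph_fun set" where
  "eigenspace G len W \<mu> = {v \<in> kirchhoff_domain G len.
     \<forall>e\<in>arcs G. AE x in edge_measure (len e). schroedinger_op len W v e x = \<mu> * v e x}"

text \<open>\<open>s\<close> lists the eigenvalues in nondecreasing order, each as often as its multiplicity.\<close>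

definition eigenvalue_listing :: "('v, 'e) pre_digraph \<Rightarrow> ('e \<Rightarrow> real) \<Rightarrow> 'e graph_fun
    \<Rightarrow> (nat \<Rightarrow> real) \<Rightarrow> bool" where
  "eigenvalue_listing G len W s \<longleftrightarrow> mono s \<and>
     (\<forall>\<mu>. finite {k. s k = \<mu>} \<and> enat (card {k. s k = \<mu>}) = edim (eigenspace G len W \<mu>))"

text \<open>The eigenvalues are numbered from \<open>1\<close>, whereas the listing starts at index \<open>0\<close>.\<close>

definition eigenvalue :: "('v, 'e) pre_digraph \<Rightarrow> ('e \<Rightarrow> real) \<Rightarrow> 'e graph_fun \<Rightarrow> nat \<Rightarrow> real" where
  "eigenvalue G len W j = (THE s. eigenvalue_listing G len W s) (j - 1)"

end

theory Submission
  imports Defs "HOL-Complex_Analysis.Great_Picard"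
begin

text \<open>
  Let \<open>\<lambda>\<^sub>1 \<le> \<lambda>\<^sub>2 \<le> \<dots>\<close> be the eigenvalues, with eigenfunctions obtained by successive minimisation of
  the quadratic form on the unit sphere of \<open>L\<^sup>2\<close>. If \<open>lam < -\<lambda>\<^bsub>m+1\<^esub>\<close>, the second variation at any
  function is negative on the span of the first \<open>m + 1\<close> eigenfunctions, because \<open>\<rho> \<ge> 0\<close>; so no solution has
  Morse index at most \<open>m\<close>.

  Let now \<open>\<rho> > 0\<close> and let \<open>u \<noteq> 0\<close> solve the problem for some \<open>lam \<le> -\<lambda>\<^sub>1\<close>. There is a positive ground state
  \<open>\<phi>\<close>, and at \<open>w = s u + t \<phi>\<close> the second variation equals
  \<open>-(p-2) \<integral> \<rho> |u|\<^bsup>p-2\<^esup> w\<^sup>2 - t\<^sup>2 \<integral> \<rho> |u|\<^bsup>p-2\<^esup> \<phi>\<^sup>2 + t\<^sup>2 (\<lambda>\<^sub>1 + lam) \<integral> \<phi>\<^sup>2\<close>,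
  which is negative unless \<open>w = 0\<close>; hence the Morse index is at least \<open>2\<close>. Conversely, for \<open>lam > -\<lambda>\<^sub>1\<close> the
  quadratic form shifted by \<open>lam\<close> is coercive, and its minimiser under the constraint \<open>\<integral> \<rho> |u|\<^sup>p = 1\<close> is, up to
  a factor, a solution of Morse index at most \<open>1\<close>. So for \<open>m = 1\<close> the admissible parameters are exactly those
  in \<open>(-\<lambda>\<^sub>1, \<infinity>)\<close>.
\<close>

section \<open>Square integrable functions\<close>

text \<open>A weak derivative is picked by \<open>SOME\<close> and determined only up to null sets,
  while vertex conditions and uniform estimates concern values at points. So the work is done with
  \<open>has_L2_deriv\<close>, the Newton-Leibniz formula for the continuous representative; the
  lemma of du Bois-Reymond gives access to it. The constraint sets of the minimisations (unit
  spheres) are not convex, so averages of a minimising sequence leave them. Each constraint is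
  therefore traded for an inequality on a linear space: the energy is at least a constant times a
  functional homogeneous of degree 2. Positivity of the ground state \<phi> serves one purpose:
  \<integral> \<rho> |u|^(p-2) \<phi>^2 > 0 for every u \<noteq> 0. This strict term keeps the
  second variation negative even at lam = -\<lambda>_1, so the endpoint is not admissible and the
  infimum is not attained. In the converse direction the minimiser has a nonnegative second
  variation on the kernel of one linear form, the derivative of the constraint; a subspace on which
  the second variation is negative meets this kernel only in 0, hence has dimension at most
  1.\<close>

lemma abs_mult_le_sum_squares: "\<bar>x * y\<bar> \<le> x\<^sup>2 + (y::real)\<^sup>2"
proof -
  have "0 \<le> (\<bar>x\<bar> - \<bar>y\<bar>)\<^sup>2" by simp
  then have "2 * \<bar>x * y\<bar> \<le> x\<^sup>2 + y\<^sup>2" by (simp add: power2_diff abs_mult)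
  then show ?thesis by (smt (verit) zero_le_power2)
qed

lemma integrable_mult_of_squares:
  fixes f g :: "'a \<Rightarrow> real"
  assumes [measurable]: "f \<in> borel_measurable M" "g \<in> borel_measurable M"
    and "integrable M (\<lambda>x. (f x)\<^sup>2)" "integrable M (\<lambda>x. (g x)\<^sup>2)"
  shows "integrable M (\<lambda>x. f x * g x)"
proof (rule Bochner_Integration.integrable_bound)
  show "integrable M (\<lambda>x. (f x)\<^sup>2 + (g x)\<^sup>2)" using assms by simp
  show "AE x in M. norm (f x * g x) \<le> norm ((f x)\<^sup>2 + (g x)\<^sup>2)"
    using abs_mult_le_sum_squares by (auto simp: abs_of_nonneg)
qed simp

text \<open>For c \<noteq> 0 the form at (c, -b) equals c * (a * c - b^2). For c = 0 and s = 1 it is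
  affine in t, and the chosen t would give it the value -1. The degenerate case is what later yields
  the Euler-Lagrange equation of a minimiser.\<close>

lemma discriminant_of_nonneg_form:
  fixes a b c :: real
  assumes *: "\<And>s t. 0 \<le> s\<^sup>2 * a + 2 * s * t * b + t\<^sup>2 * c"
  shows "b\<^sup>2 \<le> a * c"
proof (cases "c = 0")
  case True
  show ?thesis
  proof (rule ccontr)
    assume "\<not> ?thesis"
    then have "b \<noteq> 0" using True by auto
    with *[of 1 "- (a + 1) / (2 * b)"] True show False by (simp add: field_simps)
  qed
next
  case False
  have "0 \<le> c" using *[of 0 1] by simp
  from *[of c "- b"] have "0 \<le> c * (a * c - b\<^sup>2)" by (simp add: power2_eq_square algebra_simps)
  then show ?thesis using False \<open>0 \<le> c\<close> by (simp add: zero_le_mult_iff)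
qed

lemma Cauchy_Schwarz_integral:
  fixes f g :: "'a \<Rightarrow> real"
  assumes [measurable]: "f \<in> borel_measurable M" "g \<in> borel_measurable M"
    and f: "integrable M (\<lambda>x. (f x)\<^sup>2)" and g: "integrable M (\<lambda>x. (g x)\<^sup>2)"
  shows "(\<integral>x. f x * g x \<partial>M)\<^sup>2 \<le> (\<integral>x. (f x)\<^sup>2 \<partial>M) * (\<integral>x. (g x)\<^sup>2 \<partial>M)"
proof -
  define a b c where "a = (\<integral>x. (f x)\<^sup>2 \<partial>M)" and "b = (\<integral>x. f x * g x \<partial>M)" and "c = (\<integral>x. (g x)\<^sup>2 \<partial>M)"
  have fg: "integrable M (\<lambda>x. f x * g x)" by (rule integrable_mult_of_squares) (use assms in auto)
  have *: "0 \<le> s\<^sup>2 * a + 2 * s * t * b + t\<^sup>2 * c" for s t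
  proof -
    have "0 \<le> (\<integral>x. (s * f x + t * g x)\<^sup>2 \<partial>M)" by simp
    also have "(\<lambda>x. (s * f x + t * g x)\<^sup>2)
        = (\<lambda>x. s\<^sup>2 * (f x)\<^sup>2 + (2 * s * t) * (f x * g x) + t\<^sup>2 * (g x)\<^sup>2)"
      by (auto simp: power2_eq_square algebra_simps)
    also have "(\<integral>x. s\<^sup>2 * (f x)\<^sup>2 + (2 * s * t) * (f x * g x) + t\<^sup>2 * (g x)\<^sup>2 \<partial>M)
        = s\<^sup>2 * a + 2 * s * t * b + t\<^sup>2 * c"
      unfolding a_def b_def c_def using f g fg by (simp add: Bochner_Integration.integral_add)
    finally show ?thesis .
  qed
  have "b\<^sup>2 \<le> a * c" using * by (rule discriminant_of_nonneg_form)
  then show ?thesis by (simp add: a_def b_def c_def)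
qed

lemma L2_measurable [measurable_dest]: "f \<in> L2_interval l \<Longrightarrow> f \<in> borel_measurable (edge_measure l)"
  and L2_square_integrable: "f \<in> L2_interval l \<Longrightarrow> integrable (edge_measure l) (\<lambda>x. (f x)\<^sup>2)"
  by (auto simp: L2_interval_def)

lemma L2_mult_integrable:
  "f \<in> L2_interval l \<Longrightarrow> g \<in> L2_interval l \<Longrightarrow> integrable (edge_measure l) (\<lambda>x. f x * g x)"
  by (auto simp: L2_interval_def intro: integrable_mult_of_squares)

lemma L2_bounded:
  assumes [measurable]: "f \<in> borel_measurable (edge_measure l)"
    and "AE x in edge_measure l. \<bar>f x\<bar> \<le> C"
  shows "f \<in> L2_interval l"
proof -
  interpret finite_measure "edge_measure l" by (rule finite_measure_lebesgue_on) simp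
  have "integrable (edge_measure l) (\<lambda>x. (f x)\<^sup>2)"
  proof (rule integrable_const_bound[of _ "C\<^sup>2"])
    show "AE x in edge_measure l. norm ((f x)\<^sup>2) \<le> C\<^sup>2"
      using assms(2) by eventually_elim (simp add: abs_le_square_iff[symmetric])
  qed measurable
  then show ?thesis by (simp add: L2_interval_def)
qed

lemma continuous_L2:
  assumes "continuous_on {0..l} f"
  shows "f \<in> L2_interval l"
proof -
  obtain C where "\<forall>x\<in>{0..l}. \<bar>f x\<bar> \<le> C"
    using compact_imp_bounded[OF compact_continuous_image[OF assms]] by (auto simp: bounded_iff)
  moreover have "f \<in> borel_measurable (edge_measure l)"
    using assms by (intro continuous_imp_measurable_on_sets_lebesgue) auto
  ultimately show ?thesis by (intro L2_bounded[of _ _ C]) auto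
qed

lemma L2_integrable: "f \<in> L2_interval l \<Longrightarrow> integrable (edge_measure l) f"
  using L2_mult_integrable[of f l "\<lambda>x. 1"] continuous_L2[of l "\<lambda>x. 1"] by simp

lemma L2_scale: "f \<in> L2_interval l \<Longrightarrow> (\<lambda>x. c * f x) \<in> L2_interval l"
  by (auto simp: L2_interval_def power_mult_distrib)

lemma L2_add:
  assumes "f \<in> L2_interval l" "g \<in> L2_interval l"
  shows "(\<lambda>x. f x + g x) \<in> L2_interval l"
proof -
  have "(\<lambda>x. (f x + g x)\<^sup>2) = (\<lambda>x. (f x)\<^sup>2 + 2 * (f x * g x) + (g x)\<^sup>2)"
    by (auto simp: power2_eq_square algebra_simps)
  then show ?thesis using assms L2_mult_integrable[OF assms] by (auto simp: L2_interval_def)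
qed

lemma L2_diff: "f \<in> L2_interval l \<Longrightarrow> g \<in> L2_interval l \<Longrightarrow> (\<lambda>x. f x - g x) \<in> L2_interval l"
  using L2_add[of f l "\<lambda>x. - 1 * g x"] L2_scale[of g l "-1"] by simp

lemma L2_bounded_mult:
  assumes b [measurable]: "b \<in> borel_measurable (edge_measure l)"
    and C: "AE x in edge_measure l. \<bar>b x\<bar> \<le> C" and f: "f \<in> L2_interval l"
  shows "(\<lambda>x. b x * f x) \<in> L2_interval l"
proof -
  have [measurable]: "f \<in> borel_measurable (edge_measure l)" using f by (rule L2_measurable)
  have "integrable (edge_measure l) (\<lambda>x. (b x * f x)\<^sup>2)"
  proof (rule Bochner_Integration.integrable_bound)
    show "integrable (edge_measure l) (\<lambda>x. C\<^sup>2 * (f x)\<^sup>2)" using L2_square_integrable[OF f] by simp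
    show "AE x in edge_measure l. norm ((b x * f x)\<^sup>2) \<le> norm (C\<^sup>2 * (f x)\<^sup>2)"
      using C by eventually_elim
        (auto simp: power_mult_distrib abs_le_square_iff[symmetric] intro!: mult_right_mono)
  qed simp
  then show ?thesis by (simp add: L2_interval_def)
qed

text \<open>Riesz-Fischer: along a rapidly converging subsequence the increments have summable L^1
  norms, so the subsequence converges almost everywhere. Finiteness of the measure bounds L^1 norms
  by L^2 norms. Fatou's lemma then turns the Cauchy estimate into convergence of the whole
  sequence.\<close>

lemma L2_complete:
  fixes f :: "nat \<Rightarrow> 'a \<Rightarrow> real"
  assumes [measurable]: "\<And>n. f n \<in> borel_measurable M"
    and sq: "\<And>n. integrable M (\<lambda>x. (f n x)\<^sup>2)" and "finite_measure M"
    and Cauchy: "\<And>e. e > 0 \<Longrightarrow> \<exists>N. \<forall>m\<ge>N. \<forall>n\<ge>N. (\<integral>x. (f m x - f n x)\<^sup>2 \<partial>M) \<le> e"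
  obtains g where "g \<in> borel_measurable M" "integrable M (\<lambda>x. (g x)\<^sup>2)"
    "\<And>e. e > 0 \<Longrightarrow> \<exists>N. \<forall>n\<ge>N. (\<integral>x. (g x - f n x)\<^sup>2 \<partial>M) \<le> e"
proof -
  interpret finite_measure M by fact
  have idiff: "integrable M (\<lambda>x. (f m x - f n x)\<^sup>2)" for m n
  proof -
    have "(\<lambda>x. (f m x - f n x)\<^sup>2) = (\<lambda>x. (f m x)\<^sup>2 - 2 * (f m x * f n x) + (f n x)\<^sup>2)"
      by (auto simp: power2_eq_square algebra_simps)
    then show ?thesis using sq integrable_mult_of_squares[of "f m" M "f n"] by auto
  qed
  \<comment> \<open>Squared distances of at most 4^-n are norms of at most 2^-n, which gives a
    geometric series.\<close>
  have "\<exists>r::nat\<Rightarrow>nat. \<forall>n. (\<forall>i\<ge>r n. \<forall>j\<ge>r n. (\<integral>x. (f i x - f j x)\<^sup>2 \<partial>M) \<le> (1/4)^n) \<and> r n < r (Suc n)"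
  proof (rule dependent_nat_choice)
    show "\<exists>N. \<forall>i\<ge>N. \<forall>j\<ge>N. (\<integral>x. (f i x - f j x)\<^sup>2 \<partial>M) \<le> (1/4)^0" using Cauchy[of 1] by simp
    fix N :: nat and n :: nat
    obtain K where "\<forall>i\<ge>K. \<forall>j\<ge>K. (\<integral>x. (f i x - f j x)\<^sup>2 \<partial>M) \<le> (1/4)^Suc n"
      using Cauchy[of "(1/4)^Suc n"] by auto
    then show "\<exists>N'. (\<forall>i\<ge>N'. \<forall>j\<ge>N'. (\<integral>x. (f i x - f j x)\<^sup>2 \<partial>M) \<le> (1/4)^Suc n) \<and> N < N'"
      by (intro exI[of _ "max K (Suc N)"]) auto
  qed
  then obtain r :: "nat \<Rightarrow> nat" where r: "\<And>n i j. i \<ge> r n \<Longrightarrow> j \<ge> r n \<Longrightarrow> (\<integral>x. (f i x - f j x)\<^sup>2 \<partial>M) \<le> (1/4)^n"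
    and mono: "\<And>n. r n < r (Suc n)" by blast
  have rmono: "strict_mono r" using mono by (simp add: strict_mono_Suc_iff)
  define d where "d n x = \<bar>f (r (Suc n)) x - f (r n) x\<bar>" for n x
  have [measurable]: "d n \<in> borel_measurable M" for n unfolding d_def by measurable
  have dsq: "integrable M (\<lambda>x. (d n x)\<^sup>2)" for n using idiff by (simp add: d_def)
  have dint: "integrable M (d n)" for n
    using integrable_mult_of_squares[of "d n" M "\<lambda>x. 1"] dsq by simp
  have dle: "(\<integral>x. d n x \<partial>M) \<le> sqrt (measure M (space M)) * (1/2)^n" for n
  proof -
    have "(\<integral>x. d n x * 1 \<partial>M)\<^sup>2 \<le> (\<integral>x. (d n x)\<^sup>2 \<partial>M) * (\<integral>x. 1\<^sup>2 \<partial>M)"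
      using dsq by (intro Cauchy_Schwarz_integral) auto
    also have "\<dots> \<le> (1/4)^n * measure M (space M)"
      using r[of n "r (Suc n)" "r n"] mono[of n] by (intro mult_mono) (auto simp: d_def)
    also have "\<dots> = (sqrt (measure M (space M)) * (1/2)^n)\<^sup>2"
    proof -
      have "((1/2)^n)\<^sup>2 = (1/4 :: real)^n" by (simp add: power2_eq_square flip: power_mult_distrib)
      then show ?thesis by (simp only: power_mult_distrib) simp
    qed
    finally have "(\<integral>x. d n x \<partial>M)\<^sup>2 \<le> (sqrt (measure M (space M)) * (1/2)^n)\<^sup>2"
      unfolding mult_1_right .
    then show ?thesis by (rule power2_le_imp_le) simp
  qed
  have "summable (\<lambda>n. sqrt (measure M (space M)) * (1/2)^n :: real)"
    by (intro summable_mult summable_geometric) simp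
  then have sum: "summable (\<lambda>n. \<integral>x. norm (d n x) \<partial>M)"
    by (rule summable_comparison_test'[where N=0]) (use dle in \<open>auto simp: d_def\<close>)
  have AEsum: "AE x in M. summable (\<lambda>n. norm (d n x))"
  proof -
    have "(\<integral>\<^sup>+x. (\<Sum>n. ennreal (d n x)) \<partial>M) = (\<Sum>n. \<integral>\<^sup>+x. ennreal (d n x) \<partial>M)"
      by (rule nn_integral_suminf) simp
    also have "\<dots> = (\<Sum>n. ennreal (\<integral>x. d n x \<partial>M))"
      by (rule arg_cong[where f=suminf], rule ext, rule nn_integral_eq_integral[OF dint]) (simp add: d_def)
    also have "\<dots> = ennreal (\<Sum>n. \<integral>x. d n x \<partial>M)"
      using sum by (intro suminf_ennreal2) (auto simp: d_def)
    finally have "(\<integral>\<^sup>+x. (\<Sum>n. ennreal (d n x)) \<partial>M) \<noteq> \<infinity>" by simp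
    then have "AE x in M. (\<Sum>n. ennreal (d n x)) \<noteq> \<infinity>" by (intro nn_integral_PInf_AE) auto
    then show ?thesis
    proof eventually_elim
      case (elim x)
      then show ?case by (auto intro!: summable_suminf_not_top simp: d_def)
    qed
  qed
  have AEconv: "AE x in M. convergent (\<lambda>n. f (r n) x)"
    using AEsum
  proof eventually_elim
    case (elim x)
    have "summable (\<lambda>n. f (r (Suc n)) x - f (r n) x)"
      by (rule summable_norm_cancel) (use elim in \<open>simp add: d_def\<close>)
    then have "convergent (\<lambda>n. \<Sum>i<n. f (r (Suc i)) x - f (r i) x)" by (simp add: summable_iff_convergent)
    then have "convergent (\<lambda>n. f (r n) x - f (r 0) x)" by (simp add: sum_lessThan_telescope[of "\<lambda>i. f (r i) x"])
    then have "convergent (\<lambda>n. f (r n) x - f (r 0) x + f (r 0) x)"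
      by (intro convergent_add convergent_const)
    then show ?case by simp
  qed
  define g where "g x = lim (\<lambda>n. f (r n) x)" for x
  have [measurable]: "g \<in> borel_measurable M" unfolding g_def by measurable
  have AElim: "AE x in M. (\<lambda>n. f (r n) x) \<longlonglongrightarrow> g x"
    using AEconv by eventually_elim (simp add: g_def convergent_LIMSEQ_iff)
  \<comment> \<open>Fatou along the subsequence, with n fixed. The nonnegative integral is used
    because integrability of (g - f n)^2 is itself deduced from this bound.\<close>
  have main: "(\<integral>\<^sup>+x. ennreal ((g x - f n x)\<^sup>2) \<partial>M) \<le> ennreal e"
    if N: "\<And>m. m \<ge> N \<Longrightarrow> (\<integral>x. (f m x - f n x)\<^sup>2 \<partial>M) \<le> e" and "e \<ge> 0" for n N e
  proof -
    have "(\<integral>\<^sup>+x. ennreal ((g x - f n x)\<^sup>2) \<partial>M)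
        = (\<integral>\<^sup>+x. liminf (\<lambda>k. ennreal ((f (r k) x - f n x)\<^sup>2)) \<partial>M)"
    proof (rule nn_integral_cong_AE)
      show "AE x in M. ennreal ((g x - f n x)\<^sup>2) = liminf (\<lambda>k. ennreal ((f (r k) x - f n x)\<^sup>2))"
        using AElim
      proof eventually_elim
        case (elim x)
        have "(\<lambda>k. ennreal ((f (r k) x - f n x)\<^sup>2)) \<longlonglongrightarrow> ennreal ((g x - f n x)\<^sup>2)"
          by (intro tendsto_intros elim)
        then show ?case using lim_imp_Liminf sequentially_bot by metis
      qed
    qed
    also have "\<dots> \<le> liminf (\<lambda>k. \<integral>\<^sup>+x. ennreal ((f (r k) x - f n x)\<^sup>2) \<partial>M)"
      by (rule nn_integral_liminf) measurable
    also have "\<dots> \<le> liminf (\<lambda>k. ennreal e)"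
    proof (rule Liminf_mono)
      show "\<forall>\<^sub>F k in sequentially. (\<integral>\<^sup>+x. ennreal ((f (r k) x - f n x)\<^sup>2) \<partial>M) \<le> ennreal e"
        using eventually_ge_at_top[of N]
      proof eventually_elim
        case (elim k)
        then have "r k \<ge> N" using seq_suble[OF rmono, of k] by linarith
        then show ?case using N \<open>e \<ge> 0\<close>
          by (subst nn_integral_eq_integral[OF idiff]) (auto intro: ennreal_leI)
      qed
    qed
    also have "\<dots> = ennreal e" by (simp add: Liminf_const)
    finally show ?thesis .
  qed
  have diffint: "integrable M (\<lambda>x. (g x - f n x)\<^sup>2)" if "\<And>m. m \<ge> N \<Longrightarrow> (\<integral>x. (f m x - f n x)\<^sup>2 \<partial>M) \<le> e" "e \<ge> 0" for n N e
    by (rule integrableI_nonneg) (use le_less_trans[OF main[OF that] ennreal_less_top] in simp_all)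
  obtain N1 where N1: "\<forall>m\<ge>N1. \<forall>n\<ge>N1. (\<integral>x. (f m x - f n x)\<^sup>2 \<partial>M) \<le> 1" using Cauchy[of 1] by auto
  have gN: "integrable M (\<lambda>x. (g x - f N1 x)\<^sup>2)" using N1 by (intro diffint[of N1 _ 1]) auto
  show ?thesis
  proof
    have "(\<lambda>x. (g x)\<^sup>2) = (\<lambda>x. (g x - f N1 x)\<^sup>2 + 2 * ((g x - f N1 x) * f N1 x) + (f N1 x)\<^sup>2)"
      by (auto simp: power2_eq_square algebra_simps)
    moreover have "integrable M (\<lambda>x. (g x - f N1 x) * f N1 x)"
      by (rule integrable_mult_of_squares) (use gN sq in auto)
    ultimately show "integrable M (\<lambda>x. (g x)\<^sup>2)" using gN sq by simp
    fix e :: real assume e: "e > 0"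
    obtain N where N: "\<forall>m\<ge>N. \<forall>n\<ge>N. (\<integral>x. (f m x - f n x)\<^sup>2 \<partial>M) \<le> e" using Cauchy[OF e] by auto
    have "(\<integral>x. (g x - f n x)\<^sup>2 \<partial>M) \<le> e" if "n \<ge> N" for n
    proof -
      have le: "\<And>m. m \<ge> N \<Longrightarrow> (\<integral>x. (f m x - f n x)\<^sup>2 \<partial>M) \<le> e" using N that by auto
      have "ennreal (\<integral>x. (g x - f n x)\<^sup>2 \<partial>M) \<le> ennreal e"
        using main[OF le] e nn_integral_eq_integral[OF diffint[OF le]] by simp
      then show ?thesis using e by (simp add: ennreal_le_iff)
    qed
    then show "\<exists>N. \<forall>n\<ge>N. (\<integral>x. (g x - f n x)\<^sup>2 \<partial>M) \<le> e" by blast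
  qed simp
qed

section \<open>Absolutely continuous functions with square integrable derivative\<close>

text \<open>The sets over which the extended k integrates to zero form a Dynkin system containing
  all half-lines, hence all Borel sets; Lebesgue sets differ from Borel sets by null sets. A
  function whose integral over every measurable set vanishes is zero almost everywhere.\<close>

lemma AE_zero_of_primitive_zero:
  fixes k :: "real \<Rightarrow> real"
  assumes k: "integrable (edge_measure l) k" and "0 < l"
    and zero: "\<And>x. x \<in> {0..l} \<Longrightarrow> (\<integral>t. k t \<partial>edge_measure x) = 0"
  shows "AE x in edge_measure l. k x = 0"
proof -
  \<comment> \<open>Extension by zero to the whole line: its integral over {..a} is the primitive of
    k at min a l if a \<ge> 0, and 0 otherwise.\<close>
  define K where "K x = (if x \<in> {0..l} then k x else 0)" for x
  have K: "integrable lebesgue K"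
    using k unfolding K_def by (subst Lebesgue_Measure.integrable_restrict_UNIV) auto
  then have Kset: "set_integrable lebesgue A K" if "A \<in> sets lebesgue" for A
    using that unfolding set_integrable_def by (intro integrable_mult_indicator)
  have total: "(\<integral>x. K x \<partial>lebesgue) = 0"
    using zero[of l] \<open>0 < l\<close> unfolding K_def by (subst Lebesgue_Measure.integral_restrict_UNIV) auto
  have borel: "set_lebesgue_integral lebesgue A K = 0" if "A \<in> sets borel" for A
  proof -
    have "A \<in> sigma_sets UNIV (range (\<lambda>a::real. {..a}))" using that by (simp add: borel_eq_atMost)
    moreover have "Int_stable (range (\<lambda>a::real. {..a}))"
    proof -
      have "{..a} \<inter> {..b} = {..min a b}" for a b :: real by auto
      then show ?thesis by (auto simp: Int_stable_def)
    qed
    ultimately have *: "Int_stable (range (\<lambda>a::real. {..a}))" "A \<in> sigma_sets UNIV (range (\<lambda>a::real. {..a}))" by auto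
    have sb: "B \<in> sets lebesgue" if "B \<in> sigma_sets UNIV (range (\<lambda>a::real. {..a}))" for B
    proof -
      have "B \<in> sets borel" using that by (simp add: borel_eq_atMost)
      then show ?thesis by simp
    qed
    show ?thesis
    proof (induction rule: sigma_sets_induct_disjoint[OF *(1) _ *(2), consumes 0, case_names Pow basic empty compl union])
      case (basic A)
      then obtain a where A: "A = {..a}" by auto
      have "set_lebesgue_integral lebesgue A K
          = (\<integral>x. (if x \<in> {0..min a l} then k x else 0) \<partial>lebesgue)"
        unfolding set_lebesgue_integral_def A K_def
        by (intro Bochner_Integration.integral_cong) (auto simp: indicator_def)
      also have "\<dots> = (\<integral>x. k x \<partial>edge_measure (min a l))"
        by (rule Lebesgue_Measure.integral_restrict_UNIV) simp
      also have "\<dots> = 0"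
        using zero[of "min a l"] \<open>0 < l\<close> by (cases "0 \<le> a") auto
      finally show ?case .
    next
      case (compl A)
      then have A: "A \<in> sets lebesgue" by (intro sb)
      have "set_lebesgue_integral lebesgue (UNIV - A) K
          = (\<integral>x. K x - indicator A x *\<^sub>R K x \<partial>lebesgue)"
        unfolding set_lebesgue_integral_def
        by (intro Bochner_Integration.integral_cong) (auto simp: indicator_def)
      also have "\<dots> = (\<integral>x. K x \<partial>lebesgue) - set_lebesgue_integral lebesgue A K"
        unfolding set_lebesgue_integral_def using K Kset[OF A]
        by (intro Bochner_Integration.integral_diff) (auto simp: set_integrable_def)
      finally show ?case using compl total by simp
    next
      case (union A)
      then have A: "\<And>i. A i \<in> sets lebesgue" by (intro sb) auto
      then have "set_integrable lebesgue (\<Union>i. A i) K" by (intro Kset) auto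
      then have "set_lebesgue_integral lebesgue (\<Union>i. A i) K = (\<Sum>i. set_lebesgue_integral lebesgue (A i) K)"
        using union.hyps A by (intro lebesgue_integral_countable_add) (auto simp: disjoint_family_on_def)
      then show ?case using union by simp
    qed (auto simp: set_lebesgue_integral_def)
  qed
  have "AE x in lebesgue. K x = 0"
  proof (rule sigma_finite_measure.density_zero[OF _ K])
    obtain A :: "real set set" where "countable A" "A \<subseteq> sets lborel" "\<Union>A = space lborel"
        "\<forall>a\<in>A. emeasure lborel a \<noteq> \<infinity>"
      using lborel.sigma_finite_countable by metis
    then have "A \<subseteq> sets lebesgue" "\<forall>a\<in>A. emeasure lebesgue a \<noteq> \<infinity>" by auto
    with \<open>countable A\<close> \<open>\<Union>A = space lborel\<close> show "sigma_finite_measure (lebesgue :: real measure)"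
      by (intro sigma_finite_measure.intro exI[of _ A]) auto
  next
    fix A :: "real set" assume "A \<in> sets lebesgue"
    then obtain S N N' where A: "A = S \<union> N" "N \<subseteq> N'" "N' \<in> null_sets lborel" "S \<in> sets lborel"
      by (rule sets_completionE)
    have "N' \<in> null_sets lebesgue" using A(3) null_sets_completionI by blast
    have "set_lebesgue_integral lebesgue A K = set_lebesgue_integral lebesgue S K"
      unfolding set_lebesgue_integral_def
    proof (rule integral_cong_AE)
      show "(\<lambda>x. indicat_real A x *\<^sub>R K x) \<in> borel_measurable lebesgue"
        using Kset[OF \<open>A \<in> sets lebesgue\<close>] unfolding set_integrable_def by simp
      show "(\<lambda>x. indicat_real S x *\<^sub>R K x) \<in> borel_measurable lebesgue"
        using Kset[of S] A(4) unfolding set_integrable_def by simp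
      show "AE x in lebesgue. indicat_real A x *\<^sub>R K x = indicat_real S x *\<^sub>R K x"
        using AE_not_in[OF \<open>N' \<in> null_sets lebesgue\<close>]
        by eventually_elim (use A in \<open>auto simp: indicator_def\<close>)
    qed
    then show "set_lebesgue_integral lebesgue A K = 0" using borel A(4) by simp
  qed
  then have "AE x in lebesgue. x \<in> {0..l} \<longrightarrow> k x = 0"
    by eventually_elim (auto simp: K_def split: if_splits)
  then show ?thesis by (subst AE_restrict_space_iff) auto
qed

text \<open>On a mesh finer than \<delta> the increments telescope to at most e * (K l - K 0), and e
  is arbitrary. This replaces differentiation in the chain rule: there K is the primitive of |g|,
  and no derivative of d at a given point is available.\<close>

lemma constant_of_small_increments:
  fixes d K :: "real \<Rightarrow> real"
  assumes "0 \<le> l" and small: "\<And>e. e > 0 \<Longrightarrow> \<exists>\<delta>>0. \<forall>x y. 0 \<le> x \<longrightarrow> x \<le> y \<longrightarrow> y \<le> l \<longrightarrow> y - x < \<delta>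
      \<longrightarrow> \<bar>d y - d x\<bar> \<le> e * (K y - K x)"
  shows "d l = d 0"
proof -
  have bound: "\<bar>d l - d 0\<bar> \<le> e * (K l - K 0)" if e: "e > 0" for e
  proof -
    obtain \<delta> where \<delta>: "\<delta> > 0" "\<And>x y. 0 \<le> x \<Longrightarrow> x \<le> y \<Longrightarrow> y \<le> l \<Longrightarrow> y - x < \<delta> \<Longrightarrow> \<bar>d y - d x\<bar> \<le> e * (K y - K x)"
      using small[OF e] by blast
    obtain N :: nat where N: "l / \<delta> < real N" using reals_Archimedean2 by blast
    have "0 \<le> l / \<delta>" using \<open>0 \<le> l\<close> \<delta>(1) by simp
    with N have "N > 0" using of_nat_0_less_iff[of N] by linarith
    define x where "x i = real i * l / real N" for i
    have mono: "x i \<le> x j" if "i \<le> j" for i j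
      unfolding x_def using that \<open>0 \<le> l\<close> by (intro divide_right_mono mult_right_mono) auto
    have x0: "x 0 = 0" and xN: "x N = l" using \<open>N > 0\<close> by (auto simp: x_def)
    have "\<bar>d (x (Suc i)) - d (x i)\<bar> \<le> e * (K (x (Suc i)) - K (x i))" if "i < N" for i
    proof (rule \<delta>(2))
      have "x (Suc i) - x i = l / real N" by (simp add: x_def add_divide_distrib algebra_simps)
      also have "\<dots> < \<delta>" using N \<open>N > 0\<close> \<delta>(1) by (simp add: field_simps)
      finally show "x (Suc i) - x i < \<delta>" .
      show "0 \<le> x i" "x i \<le> x (Suc i)" "x (Suc i) \<le> l"
        using mono[of 0 i] mono[of i "Suc i"] mono[of "Suc i" N] that x0 xN by auto
    qed
    then have "(\<Sum>i<N. \<bar>d (x (Suc i)) - d (x i)\<bar>) \<le> (\<Sum>i<N. e * (K (x (Suc i)) - K (x i)))"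
      by (intro sum_mono) simp
    also have "\<dots> = e * (K (x N) - K (x 0))"
      by (simp add: sum_distrib_left[symmetric] sum_lessThan_telescope[of "\<lambda>i. K (x i)"])
    finally have "\<bar>\<Sum>i<N. d (x (Suc i)) - d (x i)\<bar> \<le> e * (K l - K 0)"
      using sum_abs[of "\<lambda>i. d (x (Suc i)) - d (x i)" "{..<N}"] unfolding x0 xN by linarith
    then show ?thesis by (simp add: sum_lessThan_telescope[of "\<lambda>i. d (x i)"] x0 xN)
  qed
  have "\<bar>d l - d 0\<bar> \<le> 0"
  proof (rule field_le_epsilon)
    fix e :: real assume "e > 0"
    have "\<bar>d l - d 0\<bar> \<le> e / (\<bar>K l - K 0\<bar> + 1) * (K l - K 0)" using \<open>e > 0\<close> by (intro bound) simp
    also have "\<dots> \<le> e / (\<bar>K l - K 0\<bar> + 1) * (\<bar>K l - K 0\<bar> + 1)"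
      using \<open>e > 0\<close> by (intro mult_left_mono) auto
    also have "\<dots> = e" by (simp add: field_simps)
    finally show "\<bar>d l - d 0\<bar> \<le> 0 + e" by simp
  qed
  then show ?thesis by simp
qed

text \<open>H^1 of an interval through the absolutely continuous representative: u has genuine
  values at every point, in particular at the ends, while g may still be changed on a null
  set.\<close>

definition has_L2_deriv :: "real \<Rightarrow> (real \<Rightarrow> real) \<Rightarrow> (real \<Rightarrow> real) \<Rightarrow> bool" where
  "has_L2_deriv l u g \<longleftrightarrow> g \<in> L2_interval l \<and> (\<forall>x\<in>{0..l}. u x - u 0 = (\<integral>t. g t \<partial>edge_measure x))"

lemma has_L2_derivD: "has_L2_deriv l u g \<Longrightarrow> g \<in> L2_interval l"
  by (simp add: has_L2_deriv_def)

lemma L2_integrable_subinterval: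
  "g \<in> L2_interval l \<Longrightarrow> 0 \<le> x \<Longrightarrow> y \<le> l \<Longrightarrow> integrable (lebesgue_on {x..y}) g"
  by (rule integrable_subinterval[of 0 l]) (auto intro: L2_integrable)

lemma has_L2_deriv_integrable:
  "has_L2_deriv l u g \<Longrightarrow> 0 \<le> x \<Longrightarrow> y \<le> l \<Longrightarrow> integrable (lebesgue_on {x..y}) g"
  by (intro L2_integrable_subinterval) (auto dest: has_L2_derivD)

lemma has_L2_deriv_increment:
  assumes "has_L2_deriv l u g" "0 \<le> x" "x \<le> y" "y \<le> l"
  shows "u y - u x = (\<integral>t. g t \<partial>lebesgue_on {x..y})"
proof -
  have "u y - u 0 = (\<integral>t. g t \<partial>edge_measure y)" "u x - u 0 = (\<integral>t. g t \<partial>edge_measure x)"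
    using assms by (auto simp: has_L2_deriv_def)
  moreover have "(\<integral>t. g t \<partial>edge_measure y) = (\<integral>t. g t \<partial>edge_measure x) + (\<integral>t. g t \<partial>lebesgue_on {x..y})"
    using has_L2_deriv_integrable[OF assms(1), of 0 y] assms
    by (intro Equivalence_Measurable_On_Borel.integral_combine) auto
  ultimately show ?thesis by simp
qed

lemma has_L2_deriv_continuous:
  assumes "has_L2_deriv l u g"
  shows "continuous_on {0..l} u"
proof -
  have "continuous_on {0..l} (\<lambda>x. u 0 + (\<integral>t. g t \<partial>edge_measure x))"
    using assms by (intro continuous_intros indefinite_integral_continuous_real)
      (auto dest: has_L2_derivD L2_integrable)
  then show ?thesis
  proof (rule continuous_on_eq)
    fix x assume "x \<in> {0..l}"
    then have "u x - u 0 = (\<integral>t. g t \<partial>edge_measure x)" using assms by (simp add: has_L2_deriv_def)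
    then show "u 0 + (\<integral>t. g t \<partial>edge_measure x) = u x" by simp
  qed
qed

lemma has_L2_deriv_L2: "has_L2_deriv l u g \<Longrightarrow> u \<in> L2_interval l"
  using has_L2_deriv_continuous continuous_L2 by blast

text \<open>Cauchy-Schwarz against the constant 1 on {x..y}. This Hoelder bound of exponent 1/2 is
  the source of equicontinuity and of the sup bounds on the graph.\<close>

lemma has_L2_deriv_Holder:
  assumes u: "has_L2_deriv l u g" and xy: "0 \<le> x" "x \<le> y" "y \<le> l"
  shows "(u y - u x)\<^sup>2 \<le> (y - x) * (\<integral>t. (g t)\<^sup>2 \<partial>edge_measure l)"
proof -
  have g2: "integrable (lebesgue_on {x..y}) (\<lambda>t. (g t)\<^sup>2)"
    using L2_square_integrable[OF has_L2_derivD[OF u]] xy by (rule_tac integrable_subinterval[of 0 l]) auto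
  have g: "g \<in> borel_measurable (lebesgue_on {x..y})"
    using has_L2_deriv_integrable[OF u] xy by auto
  have "(u y - u x)\<^sup>2 = (\<integral>t. 1 * g t \<partial>lebesgue_on {x..y})\<^sup>2"
    using has_L2_deriv_increment[OF u xy] by simp
  also have "\<dots> \<le> (\<integral>t. 1\<^sup>2 \<partial>lebesgue_on {x..y}) * (\<integral>t. (g t)\<^sup>2 \<partial>lebesgue_on {x..y})"
    using g g2 by (intro Cauchy_Schwarz_integral) auto
  also have "(\<integral>t. 1\<^sup>2 \<partial>lebesgue_on {x..y}) = y - x"
    using xy by (simp add: measure_restrict_space)
  also have "(y - x) * (\<integral>t. (g t)\<^sup>2 \<partial>lebesgue_on {x..y}) \<le> (y - x) * (\<integral>t. (g t)\<^sup>2 \<partial>edge_measure l)"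
    using xy L2_square_integrable[OF has_L2_derivD[OF u]]
    by (intro mult_left_mono integral_mono_lebesgue_on_AE) auto
  finally show ?thesis .
qed

lemma has_L2_deriv_add:
  assumes "has_L2_deriv l u g" "has_L2_deriv l v h"
  shows "has_L2_deriv l (\<lambda>x. u x + v x) (\<lambda>x. g x + h x)"
proof -
  have "u x + v x - (u 0 + v 0) = (\<integral>t. g t + h t \<partial>edge_measure x)" if "x \<in> {0..l}" for x
    using has_L2_deriv_increment[OF assms(1), of 0 x] has_L2_deriv_increment[OF assms(2), of 0 x]
      has_L2_deriv_integrable[OF assms(1), of 0 x] has_L2_deriv_integrable[OF assms(2), of 0 x] that by simp
  then show ?thesis using assms by (auto simp: has_L2_deriv_def intro: L2_add)
qed

lemma has_L2_deriv_scale: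
  assumes "has_L2_deriv l u g"
  shows "has_L2_deriv l (\<lambda>x. c * u x) (\<lambda>x. c * g x)"
proof -
  have "c * u x - c * u 0 = (\<integral>t. c * g t \<partial>edge_measure x)" if "x \<in> {0..l}" for x
    using assms that by (simp add: has_L2_deriv_def right_diff_distrib[symmetric])
  then show ?thesis using assms by (auto simp: has_L2_deriv_def intro: L2_scale)
qed

lemma has_L2_deriv_diff:
  assumes "has_L2_deriv l u g" "has_L2_deriv l v h"
  shows "has_L2_deriv l (\<lambda>x. u x - v x) (\<lambda>x. g x - h x)"
  using has_L2_deriv_add[OF assms(1) has_L2_deriv_scale[OF assms(2), of "-1"]] by simp

lemma has_L2_deriv_cong:
  assumes "has_L2_deriv l u g" "\<And>x. x \<in> {0..l} \<Longrightarrow> u x = v x"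
  shows "has_L2_deriv l v g"
proof -
  have "u x - u 0 = v x - v 0" if "x \<in> {0..l}" for x using assms(2)[of x] assms(2)[of 0] that by auto
  then show ?thesis using assms(1) unfolding has_L2_deriv_def by auto
qed

lemma has_L2_deriv_cong_AE:
  assumes u: "has_L2_deriv l u g" and h: "h \<in> L2_interval l" and ae: "AE x in edge_measure l. g x = h x"
  shows "has_L2_deriv l u h"
proof -
  have "(\<integral>t. g t \<partial>edge_measure x) = (\<integral>t. h t \<partial>edge_measure x)" if x: "x \<in> {0..l}" for x
  proof (rule integral_cong_AE)
    show "g \<in> borel_measurable (edge_measure x)" "h \<in> borel_measurable (edge_measure x)"
      using L2_integrable_subinterval[OF h, of 0 x] has_L2_deriv_integrable[OF u, of 0 x] x by auto
    have "AE t in lebesgue. t \<in> {0..l} \<longrightarrow> g t = h t" using ae by (subst (asm) AE_restrict_space_iff) auto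
    then have "AE t in lebesgue. t \<in> {0..x} \<longrightarrow> g t = h t" by eventually_elim (use x in auto)
    then show "AE t in edge_measure x. g t = h t" by (subst AE_restrict_space_iff) auto
  qed
  then show ?thesis using u h by (auto simp: has_L2_deriv_def)
qed

lemma has_L2_deriv_unique:
  assumes "has_L2_deriv l u g" "has_L2_deriv l u h" "0 < l"
  shows "AE x in edge_measure l. g x = h x"
proof -
  have "has_L2_deriv l (\<lambda>x. 0) (\<lambda>x. g x - h x)" using has_L2_deriv_diff[OF assms(1,2)] by simp
  then have "AE x in edge_measure l. g x - h x = 0"
    using \<open>0 < l\<close> by (intro AE_zero_of_primitive_zero L2_integrable) (auto simp: has_L2_deriv_def)
  then show ?thesis by simp
qed

lemma has_L2_deriv_C1:
  assumes "\<And>x. x \<in> {0..l} \<Longrightarrow> (u has_real_derivative g x) (at x within {0..l})"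
    and g: "continuous_on {0..l} g"
  shows "has_L2_deriv l u g"
  unfolding has_L2_deriv_def
proof (intro conjI ballI)
  show "g \<in> L2_interval l" using g by (rule continuous_L2)
  fix x assume x: "x \<in> {0..l}"
  have "(g has_integral (u x - u 0)) {0..x}"
  proof (rule fundamental_theorem_of_calculus)
    fix t assume t: "t \<in> {0..x}"
    then have "(u has_real_derivative g t) (at t within {0..x})"
      using x by (intro has_field_derivative_subset[OF assms(1)]) auto
    then show "(u has_vector_derivative g t) (at t within {0..x})"
      by (simp add: has_real_derivative_iff_has_vector_derivative)
  qed (use x in auto)
  moreover have "integrable (edge_measure x) g"
    using x g by (intro continuous_imp_integrable_real) (auto intro: continuous_on_subset)
  ultimately show "u x - u 0 = (\<integral>t. g t \<partial>edge_measure x)"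
    by (simp add: lebesgue_integral_eq_integral integral_unique)
qed

lemma has_L2_deriv_primitive:
  assumes "g \<in> L2_interval l"
  shows "has_L2_deriv l (\<lambda>x. c + (\<integral>t. g t \<partial>edge_measure x)) g"
proof -
  have "(\<integral>t. g t \<partial>edge_measure 0) = 0"
    using has_bochner_integral_null[of "{0}" g] by (auto simp: has_bochner_integral_integral_eq)
  then show ?thesis using assms by (simp add: has_L2_deriv_def)
qed

text \<open>F o u and the primitive of F'(u) * g have almost equal increments on short intervals:
  the mean value theorem yields one slope F'(u s), and by uniform continuity of F' o u this slope is
  within e of F'(u t) for all t in the interval. The error is at most e times the increment of the
  primitive of |g|.\<close>

lemma has_L2_deriv_chain:
  assumes u: "has_L2_deriv l u g"
    and F: "\<And>x. x \<in> {0..l} \<Longrightarrow> (F has_real_derivative F' (u x)) (at (u x))"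
    and F': "continuous_on (u ` {0..l}) F'"
  shows "has_L2_deriv l (\<lambda>x. F (u x)) (\<lambda>x. F' (u x) * g x)"
proof -
  define h where "h x = F' (u x) * g x" for x
  have cu: "continuous_on {0..l} u" using u by (rule has_L2_deriv_continuous)
  have cF: "continuous_on {0..l} (\<lambda>x. F' (u x))" using continuous_on_compose2[OF F' cu] by simp
  obtain C where C: "\<forall>x\<in>{0..l}. \<bar>F' (u x)\<bar> \<le> C"
    using compact_imp_bounded[OF compact_continuous_image[OF cF]] by (auto simp: bounded_iff)
  have g: "g \<in> L2_interval l" using u by (rule has_L2_derivD)
  have h: "h \<in> L2_interval l"
    unfolding h_def using cF C by (intro L2_bounded_mult[where C=C] g)
      (auto intro: continuous_imp_measurable_on_sets_lebesgue)
  define P where "P x = (\<integral>t. h t \<partial>edge_measure x)" for x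
  define K where "K x = (\<integral>t. \<bar>g t\<bar> \<partial>edge_measure x)" for x
  have inth: "integrable (lebesgue_on {x..y}) h" and intg: "integrable (lebesgue_on {x..y}) g"
    if "0 \<le> x" "y \<le> l" for x y
    using that L2_integrable_subinterval[OF h] L2_integrable_subinterval[OF g] by auto
  have Pinc: "P y - P x = (\<integral>t. h t \<partial>lebesgue_on {x..y})"
    and Kinc: "K y - K x = (\<integral>t. \<bar>g t\<bar> \<partial>lebesgue_on {x..y})" if "0 \<le> x" "x \<le> y" "y \<le> l" for x y
    using Equivalence_Measurable_On_Borel.integral_combine[of 0 y h x]
      Equivalence_Measurable_On_Borel.integral_combine[of 0 y "\<lambda>t. \<bar>g t\<bar>" x] that inth[of 0 y] intg[of 0 y]
    by (auto simp: P_def K_def)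
  have uc: "uniformly_continuous_on {0..l} (\<lambda>x. F' (u x))"
    using cF by (rule compact_uniformly_continuous) simp
  have key: "F (u x) - P x = F (u 0) - P 0" if x: "x \<in> {0..l}" for x
  proof (rule constant_of_small_increments[of x "\<lambda>x. F (u x) - P x" K])
    fix e :: real assume "e > 0"
    then obtain \<delta> where \<delta>: "\<delta> > 0" and
      close: "\<And>s t. s \<in> {0..l} \<Longrightarrow> t \<in> {0..l} \<Longrightarrow> \<bar>t - s\<bar> < \<delta> \<Longrightarrow> \<bar>F' (u t) - F' (u s)\<bar> < e"
      using uc unfolding uniformly_continuous_on_def dist_real_def by metis
    have "\<bar>F (u y) - P y - (F (u z) - P z)\<bar> \<le> e * (K y - K z)"
      if yz: "0 \<le> z" "z \<le> y" "y \<le> x" "y - z < \<delta>" for z y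
    proof -
      have yl: "y \<le> l" using yz x by auto
      have czy: "continuous_on {z..y} u" using cu yz yl by (auto intro: continuous_on_subset)
      \<comment> \<open>F is known to be differentiable only at values of u, so the intermediate
        point between u z and u y must itself be a value u s; connectedness of the image of {z..y}
        provides s.\<close>
      have "\<exists>s\<in>{z..y}. F (u y) - F (u z) = F' (u s) * (u y - u z)"
      proof -
        have sub: "{min (u z) (u y)..max (u z) (u y)} \<subseteq> u ` {z..y}"
        proof -
          have "Topological_Spaces.connected (u ` {z..y})" using czy by (intro connected_continuous_image) auto
          moreover have "u z \<in> u ` {z..y}" "u y \<in> u ` {z..y}" using yz by auto
          ultimately show ?thesis
            by (intro connected_contains_Icc) (auto simp: min_def max_def)
        qed
        have der: "(F has_real_derivative F' \<xi>) (at \<xi>)" if \<xi>: "min (u z) (u y) \<le> \<xi>" "\<xi> \<le> max (u z) (u y)" for \<xi>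
        proof -
          obtain s where "s \<in> {z..y}" "\<xi> = u s" using \<xi> sub by force
          then show ?thesis using F[of s] yz yl by auto
        qed
        have "\<exists>\<xi>\<in>{min (u z) (u y)..max (u z) (u y)}. F (u y) - F (u z) = F' \<xi> * (u y - u z)"
        proof (cases "u z" "u y" rule: linorder_cases)
          case less
          then obtain \<xi> where "u z < \<xi>" "\<xi> < u y" "F (u y) - F (u z) = (u y - u z) * F' \<xi>"
            using MVT2[of "u z" "u y" F F'] der by auto
          then show ?thesis by (intro bexI[of _ \<xi>]) auto
        next
          case greater
          then obtain \<xi> where "u y < \<xi>" "\<xi> < u z" "F (u z) - F (u y) = (u z - u y) * F' \<xi>"
            using MVT2[of "u y" "u z" F F'] der by auto
          then show ?thesis by (intro bexI[of _ \<xi>]) (auto simp: algebra_simps)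
        next
          case equal
          then show ?thesis by (intro bexI[of _ "u y"]) auto
        qed
        then show ?thesis using sub by blast
      qed
      then obtain s where s: "s \<in> {z..y}" and eq: "F (u y) - F (u z) = F' (u s) * (u y - u z)" by blast
      have "F (u y) - P y - (F (u z) - P z) = F' (u s) * (u y - u z) - (P y - P z)" using eq by simp
      \<comment> \<open>Both increments are integrals over {z..y}; the integrand is (F'(u s) - F'(u
        t)) * g t.\<close>
      also have "\<dots> = (\<integral>t. F' (u s) * g t - h t \<partial>lebesgue_on {z..y})"
        using yz yl inth[of z y] intg[of z y] has_L2_deriv_increment[OF u, of z y] Pinc[of z y] by simp
      finally have "\<bar>F (u y) - P y - (F (u z) - P z)\<bar> = \<bar>\<integral>t. F' (u s) * g t - h t \<partial>lebesgue_on {z..y}\<bar>"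
        by simp
      also have "\<dots> \<le> (\<integral>t. \<bar>F' (u s) * g t - h t\<bar> \<partial>lebesgue_on {z..y})" by (rule integral_abs_bound)
      also have "\<dots> \<le> (\<integral>t. e * \<bar>g t\<bar> \<partial>lebesgue_on {z..y})"
      proof (rule Bochner_Integration.integral_mono)
        fix t assume "t \<in> space (lebesgue_on {z..y})"
        then have t: "t \<in> {z..y}" by simp
        have "\<bar>s - t\<bar> < \<delta>" using t s yz by auto
        then have le: "\<bar>F' (u s) - F' (u t)\<bar> \<le> e" using close[of t s] t s yz yl by auto
        have "\<bar>F' (u s) * g t - h t\<bar> = \<bar>F' (u s) - F' (u t)\<bar> * \<bar>g t\<bar>"
          by (simp add: h_def abs_mult[symmetric] algebra_simps)
        also have "\<dots> \<le> e * \<bar>g t\<bar>"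
          using le by (intro mult_right_mono) auto
        finally show "\<bar>F' (u s) * g t - h t\<bar> \<le> e * \<bar>g t\<bar>" .
      qed (use inth[of z y] intg[of z y] yz yl in auto)
      also have "\<dots> = e * (K y - K z)" using Kinc[of z y] yz yl by simp
      finally show ?thesis .
    qed
    then show "\<exists>\<delta>>0. \<forall>z y. 0 \<le> z \<longrightarrow> z \<le> y \<longrightarrow> y \<le> x \<longrightarrow> y - z < \<delta>
        \<longrightarrow> \<bar>F (u y) - P y - (F (u z) - P z)\<bar> \<le> e * (K y - K z)" using \<delta> by blast
  qed (use x in auto)
  have "has_L2_deriv l (\<lambda>x. 0 + P x) h" unfolding P_def by (rule has_L2_deriv_primitive[OF h])
  then have "P x - P 0 = (\<integral>t. h t \<partial>edge_measure x)" if "x \<in> {0..l}" for x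
    using that by (simp add: has_L2_deriv_def)
  moreover have "F (u x) - F (u 0) = P x - P 0" if "x \<in> {0..l}" for x using key[OF that] by simp
  ultimately show ?thesis using h unfolding has_L2_deriv_def h_def[symmetric] by auto
qed

text \<open>Polarisation, 4 u v = (u + v)^2 - (u - v)^2, reduces the product rule to the chain rule
  for squares.\<close>

lemma has_L2_deriv_mult:
  assumes u: "has_L2_deriv l u g" and v: "has_L2_deriv l v h"
  shows "has_L2_deriv l (\<lambda>x. u x * v x) (\<lambda>x. u x * h x + g x * v x)"
proof -
  have sq: "has_L2_deriv l (\<lambda>x. (w x)\<^sup>2) (\<lambda>x. 2 * w x * k x)" if "has_L2_deriv l w k" for w k
    using that by (rule has_L2_deriv_chain[where F="\<lambda>y. y\<^sup>2" and F'="\<lambda>y. 2 * y"])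
      (auto intro!: derivative_eq_intros continuous_intros)
  have "has_L2_deriv l (\<lambda>x. 1/4 * ((u x + v x)\<^sup>2 - (u x - v x)\<^sup>2))
     (\<lambda>x. 1/4 * (2 * (u x + v x) * (g x + h x) - 2 * (u x - v x) * (g x - h x)))"
    by (intro has_L2_deriv_scale has_L2_deriv_diff sq has_L2_deriv_add u v)
  moreover have "(\<lambda>x. 1/4 * ((u x + v x)\<^sup>2 - (u x - v x)\<^sup>2)) = (\<lambda>x. u x * v x)"
    by (auto simp: power2_eq_square algebra_simps)
  moreover have "(\<lambda>x. 1/4 * (2 * (u x + v x) * (g x + h x) - 2 * (u x - v x) * (g x - h x)))
      = (\<lambda>x. u x * h x + g x * v x)"
    by (auto simp: algebra_simps)
  ultimately show ?thesis by simp
qed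

lemma integration_by_parts_L2_deriv:
  assumes u: "has_L2_deriv l u g" and v: "has_L2_deriv l v h" and "0 \<le> l"
  shows "(\<integral>x. u x * h x \<partial>edge_measure l) = u l * v l - u 0 * v 0 - (\<integral>x. g x * v x \<partial>edge_measure l)"
proof -
  have "u l * v l - u 0 * v 0 = (\<integral>x. u x * h x + g x * v x \<partial>edge_measure l)"
    using has_L2_deriv_increment[OF has_L2_deriv_mult[OF u v], of 0 l] \<open>0 \<le> l\<close> by simp
  also have "\<dots> = (\<integral>x. u x * h x \<partial>edge_measure l) + (\<integral>x. g x * v x \<partial>edge_measure l)"
    using u v by (intro Bochner_Integration.integral_add L2_mult_integrable)
      (auto dest: has_L2_derivD has_L2_deriv_L2)
  finally show ?thesis by simp
qed

section \<open>Weak derivatives\<close>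

text \<open>The lemma of du Bois-Reymond is proved with explicit test functions: second differences of
  \<open>(max 0 x)\<^sup>2\<close>, whose derivatives are trapezoids approximating indicator functions of intervals.\<close>

definition ramp_sq :: "real \<Rightarrow> real" where "ramp_sq x = (max 0 x)\<^sup>2"

lemma ramp_sq_deriv: "(ramp_sq has_real_derivative 2 * max 0 x) (at x)"
proof (cases x "0::real" rule: linorder_cases)
  case less
  have "((\<lambda>x. 0) has_real_derivative 2 * max 0 x) (at x)" using less by simp
  then show ?thesis
    by (rule has_field_derivative_transform_within_open[of _ _ _ "{..<0}"])
      (use less in \<open>auto simp: ramp_sq_def\<close>)
next
  case greater
  have "((\<lambda>x. x\<^sup>2) has_real_derivative 2 * max 0 x) (at x)"
    using greater by (auto intro!: derivative_eq_intros)
  then show ?thesis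
    by (rule has_field_derivative_transform_within_open[of _ _ _ "{0<..}"])
      (use greater in \<open>auto simp: ramp_sq_def\<close>)
next
  case equal
  have "((\<lambda>h. max 0 h) \<longlongrightarrow> max 0 0) (at (0::real))" by (intro tendsto_intros)
  then have "((\<lambda>h. (ramp_sq (0 + h) - ramp_sq 0) / h) \<longlongrightarrow> 0) (at 0)"
    unfolding max.idem
    by (rule Lim_transform_eventually) (auto simp: eventually_at_filter ramp_sq_def max_def power2_eq_square)
  then show ?thesis using equal by (simp add: DERIV_def)
qed

definition trapezoid :: "real \<Rightarrow> real \<Rightarrow> real \<Rightarrow> real \<Rightarrow> real" where
  "trapezoid a b h x = (max 0 (x - a) - max 0 (x - a - h) - max 0 (x - b) + max 0 (x - b - h)) / h"

definition trapezoid_primitive :: "real \<Rightarrow> real \<Rightarrow> real \<Rightarrow> real \<Rightarrow> real" where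
  "trapezoid_primitive a b h x =
     (ramp_sq (x - a) - ramp_sq (x - a - h) - ramp_sq (x - b) + ramp_sq (x - b - h)) / (2 * h)"

lemma trapezoid_primitive_deriv:
  assumes "h > 0"
  shows "(trapezoid_primitive a b h has_real_derivative trapezoid a b h x) (at x)"
proof -
  have d: "((\<lambda>x. ramp_sq (x - c)) has_real_derivative 2 * max 0 (x - c)) (at x)" for c
  proof -
    have "((\<lambda>x. x - c) has_real_derivative 1) (at x)" by (auto intro!: derivative_eq_intros)
    from DERIV_chain2[where f=ramp_sq and g="\<lambda>x. x - c", OF ramp_sq_deriv this] show ?thesis by simp
  qed
  have "((\<lambda>x. (ramp_sq (x - a) - ramp_sq (x - (a + h)) - ramp_sq (x - b) + ramp_sq (x - (b + h))) / (2 * h))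
     has_real_derivative (2 * max 0 (x - a) - 2 * max 0 (x - (a + h)) - 2 * max 0 (x - b) + 2 * max 0 (x - (b + h))) / (2 * h)) (at x)"
    using assms by (intro DERIV_cdivide DERIV_add DERIV_diff d)
  moreover have "(2 * max 0 (x - a) - 2 * max 0 (x - (a + h)) - 2 * max 0 (x - b) + 2 * max 0 (x - (b + h))) / (2 * h)
      = trapezoid a b h x"
    using assms by (simp add: trapezoid_def field_simps diff_diff_eq)
  ultimately show ?thesis unfolding trapezoid_primitive_def[abs_def] by (simp add: diff_diff_eq)
qed

lemma trapezoid_primitive_left: "0 < h \<Longrightarrow> a \<le> b \<Longrightarrow> x \<le> a \<Longrightarrow> trapezoid_primitive a b h x = 0"
  by (simp add: trapezoid_primitive_def ramp_sq_def)

lemma trapezoid_primitive_right: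
  assumes "0 < h" "a \<le> b" "b + h \<le> x"
  shows "trapezoid_primitive a b h x = b - a"
proof -
  have "max 0 (x - a) = x - a" "max 0 (x - a - h) = x - a - h" "max 0 (x - b) = x - b"
    "max 0 (x - b - h) = x - b - h" using assms by auto
  then have "trapezoid_primitive a b h x
      = ((x - a)\<^sup>2 - (x - a - h)\<^sup>2 - (x - b)\<^sup>2 + (x - b - h)\<^sup>2) / (2 * h)"
    by (simp add: trapezoid_primitive_def ramp_sq_def)
  also have "(x - a)\<^sup>2 - (x - a - h)\<^sup>2 - (x - b)\<^sup>2 + (x - b - h)\<^sup>2 = (b - a) * (2 * h)"
    by (simp add: power2_eq_square algebra_simps)
  finally show ?thesis using assms by simp
qed

text \<open>Numerator: a difference of two ramps, each with values in [0, h]. The bound, uniform in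
  h, supplies the majorant for dominated convergence.\<close>

lemma trapezoid_bound:
  assumes "0 < h"
  shows "\<bar>trapezoid a b h x\<bar> \<le> 1"
proof -
  define R where "R c = max 0 (x - c) - max 0 (x - c - h)" for c
  have "0 \<le> R c" "R c \<le> h" for c using assms by (auto simp: R_def)
  from this[of a] this[of b] have "\<bar>R a - R b\<bar> \<le> h" by linarith
  moreover have "R a - R b = max 0 (x - a) - max 0 (x - a - h) - max 0 (x - b) + max 0 (x - b - h)"
    by (simp add: R_def)
  ultimately have "\<bar>max 0 (x - a) - max 0 (x - a - h) - max 0 (x - b) + max 0 (x - b - h)\<bar> \<le> h" by metis
  then show ?thesis using assms by (simp add: trapezoid_def abs_divide)
qed

text \<open>The two alternatives exclude exactly the interiors of the sloping pieces. For fixed x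
  they hold for all small h, also at x = a and x = b, so the pointwise limit is the indicator of the
  half-open interval.\<close>

lemma trapezoid_eq_indicator:
  assumes "0 < h" "a \<le> b" "x \<le> a \<or> h \<le> x - a" "x \<le> b \<or> h \<le> x - b"
  shows "trapezoid a b h x = indicator {a<..b} x"
proof -
  have "max 0 (x - c) - max 0 (x - c - h) = (if x \<le> c then 0 else h)" if "x \<le> c \<or> h \<le> x - c" for c
    using that assms(1) by auto
  from this[of a] this[of b] assms
  have "max 0 (x - a) - max 0 (x - a - h) - max 0 (x - b) + max 0 (x - b - h) = (if a < x \<and> x \<le> b then h else 0)"
    by (auto split: if_splits)
  then show ?thesis using assms(1) by (simp add: trapezoid_def indicator_def)
qed

lemma trapezoid_continuous: "h > 0 \<Longrightarrow> continuous_on S (trapezoid a b h)"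
  unfolding trapezoid_def by (intro continuous_intros) auto

text \<open>To the right of both trapezoids the two primitives take the values b - a and d - c. The
  crossed weights make the contributions cancel, so the combination has compact support in (0,
  l).\<close>

lemma test_fun_trapezoids:
  assumes h: "0 < h" and "0 < a" "a < b" "b + h < l" "0 < c" "c < d" "d + h < l"
  defines "\<phi> \<equiv> \<lambda>x. (d - c) * trapezoid_primitive a b h x - (b - a) * trapezoid_primitive c d h x"
  shows "\<phi> \<in> test_funs l" "deriv \<phi> = (\<lambda>x. (d - c) * trapezoid a b h x - (b - a) * trapezoid c d h x)"
proof -
  have D: "(\<phi> has_real_derivative (d - c) * trapezoid a b h x - (b - a) * trapezoid c d h x) (at x)" for x
    unfolding \<phi>_def by (intro DERIV_diff DERIV_cmult trapezoid_primitive_deriv h)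
  then show deriv: "deriv \<phi> = (\<lambda>x. (d - c) * trapezoid a b h x - (b - a) * trapezoid c d h x)"
    by (intro ext DERIV_imp_deriv)
  have "\<phi> x = 0" if "x \<notin> {min a c..max b d + h}" for x
  proof (cases "x \<le> min a c")
    case True
    then show ?thesis using assms by (simp add: trapezoid_primitive_left)
  next
    case False
    then have "b + h \<le> x" "d + h \<le> x" using that by auto
    then show ?thesis using assms by (simp add: trapezoid_primitive_right)
  qed
  moreover have "{min a c..max b d + h} \<subseteq> {0<..<l}" using assms by auto
  moreover have "\<phi> differentiable (at x)" for x using D real_differentiable_def by blast
  moreover have "continuous_on UNIV (deriv \<phi>)"
    unfolding deriv by (intro continuous_intros trapezoid_continuous h)
  ultimately show "\<phi> \<in> test_funs l"
    unfolding test_funs_def by (intro CollectI conjI allI exI[of _ "{min a c..max b d + h}"]) auto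
qed

text \<open>The means of w over any two interior intervals agree. This is the weak equation for the
  trapezoid test functions with h = 1 / Suc n, passed to the limit by dominated convergence; the
  test functions are admissible once h is below the distance of both intervals to l.\<close>

lemma weakly_constant_intervals:
  fixes w :: "real \<Rightarrow> real"
  assumes w: "integrable (edge_measure l) w"
    and orth: "\<And>\<phi>. \<phi> \<in> test_funs l \<Longrightarrow> (\<integral>x. w x * deriv \<phi> x \<partial>edge_measure l) = 0"
    and ab: "0 < a" "a < b" "b < l" and cd: "0 < c" "c < d" "d < l"
  shows "(d - c) * (\<integral>x. w x \<partial>lebesgue_on {a..b}) = (b - a) * (\<integral>x. w x \<partial>lebesgue_on {c..d})"
proof -
  define \<tau> where "\<tau> n x = (d - c) * trapezoid a b (1 / Suc n) x - (b - a) * trapezoid c d (1 / Suc n) x" for n x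
  define \<psi> where "\<psi> x = (d - c) * indicator {a<..b} x - (b - a) * indicator {c<..d} x" for x :: real
  have lim: "(\<lambda>n. \<integral>x. w x * \<tau> n x \<partial>edge_measure l) \<longlonglongrightarrow> (\<integral>x. w x * \<psi> x \<partial>edge_measure l)"
  proof (rule integral_dominated_convergence[where w="\<lambda>x. ((d - c) + (b - a)) * \<bar>w x\<bar>"])
    have [measurable]: "w \<in> borel_measurable (edge_measure l)" using w by simp
    show "(\<lambda>x. w x * \<psi> x) \<in> borel_measurable (edge_measure l)"
      unfolding \<psi>_def by (intro borel_measurable_times borel_measurable_diff borel_measurable_const
        borel_measurable_indicator \<open>w \<in> _\<close>) (use ab cd in \<open>auto simp: sets_restrict_space_iff\<close>)
    have tm: "\<tau> n \<in> borel_measurable (edge_measure l)" for n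
      unfolding \<tau>_def by (intro continuous_imp_measurable_on_sets_lebesgue continuous_intros trapezoid_continuous) auto
    show "(\<lambda>x. w x * \<tau> n x) \<in> borel_measurable (edge_measure l)" for n
      using tm by measurable
    show "integrable (edge_measure l) (\<lambda>x. ((d - c) + (b - a)) * \<bar>w x\<bar>)" using w by simp
    show "AE x in edge_measure l. norm (w x * \<tau> n x) \<le> ((d - c) + (b - a)) * \<bar>w x\<bar>" for n
    proof (intro AE_I2)
      fix x
      have "\<bar>\<tau> n x\<bar> \<le> (d - c) * \<bar>trapezoid a b (1 / Suc n) x\<bar> + (b - a) * \<bar>trapezoid c d (1 / Suc n) x\<bar>"
        unfolding \<tau>_def using ab cd abs_triangle_ineq4 by (simp add: abs_mult order_trans[OF abs_triangle_ineq4])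
      also have "\<dots> \<le> (d - c) * 1 + (b - a) * 1"
        using ab cd by (intro add_mono mult_left_mono trapezoid_bound) auto
      finally have "\<bar>w x\<bar> * \<bar>\<tau> n x\<bar> \<le> \<bar>w x\<bar> * ((d - c) + (b - a))" by (intro mult_left_mono) auto
      then show "norm (w x * \<tau> n x) \<le> ((d - c) + (b - a)) * \<bar>w x\<bar>" by (simp add: abs_mult mult.commute)
    qed
    show "AE x in edge_measure l. (\<lambda>n. w x * \<tau> n x) \<longlonglongrightarrow> w x * \<psi> x"
    proof (intro AE_I2 tendsto_eventually)
      fix x
      have ev: "\<forall>\<^sub>F n in sequentially. x \<le> e \<or> 1 / Suc n \<le> x - e" for e
      proof (cases "x \<le> e")
        case False
        then have "\<forall>\<^sub>F n in sequentially. 1 / real (Suc n) < x - e"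
          using LIMSEQ_inverse_real_of_nat by (intro order_tendstoD(2)[of _ 0]) (auto simp: inverse_eq_divide)
        then show ?thesis by eventually_elim auto
      qed simp
      show "\<forall>\<^sub>F n in sequentially. w x * \<tau> n x = w x * \<psi> x"
        using ev[of a] ev[of b] ev[of c] ev[of d]
        by eventually_elim (use ab cd in \<open>simp add: \<tau>_def \<psi>_def trapezoid_eq_indicator\<close>)
    qed
  qed
  have "\<forall>\<^sub>F n in sequentially. 1 / real (Suc n) < min (l - b) (l - d)"
    using LIMSEQ_inverse_real_of_nat ab cd by (intro order_tendstoD(2)[of _ 0]) (auto simp: inverse_eq_divide)
  then have "\<forall>\<^sub>F n in sequentially. (\<integral>x. w x * \<tau> n x \<partial>edge_measure l) = 0"
  proof eventually_elim
    case (elim n)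
    let ?\<phi> = "\<lambda>x. (d - c) * trapezoid_primitive a b (1 / Suc n) x - (b - a) * trapezoid_primitive c d (1 / Suc n) x"
    have "?\<phi> \<in> test_funs l" "deriv ?\<phi> = \<tau> n"
      using test_fun_trapezoids[of "1 / Suc n" a b l c d] elim ab cd unfolding \<tau>_def by auto
    then show ?case using orth[of ?\<phi>] by simp
  qed
  from tendsto_eventually[OF this] have "(\<integral>x. w x * \<psi> x \<partial>edge_measure l) = 0"
    by (rule LIMSEQ_unique[OF lim])
  moreover have ind: "integrable (edge_measure l) (\<lambda>x. w x * indicator {r<..s} x)"
      "(\<integral>x. w x * indicator {r<..s} x \<partial>edge_measure l) = (\<integral>x. w x \<partial>lebesgue_on {r..s})"
    if "0 < r" "s < l" for r s
  proof -
    have m: "{r<..s} \<in> sets (edge_measure l)" using that by (auto simp: sets_restrict_space_iff)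
    have "integrable (edge_measure l) (\<lambda>x. indicator {r<..s} x *\<^sub>R w x)"
      using m w by (rule integrable_mult_indicator)
    then show "integrable (edge_measure l) (\<lambda>x. w x * indicator {r<..s} x)" by (simp add: mult.commute)
    have "(\<integral>x. w x * indicator {r<..s} x \<partial>edge_measure l)
        = (\<integral>x. (if x \<in> {r<..s} then w x else 0) \<partial>edge_measure l)"
      by (intro Bochner_Integration.integral_cong) (auto simp: indicator_def)
    also have "\<dots> = (\<integral>x. w x \<partial>lebesgue_on {r<..s})"
      using that by (intro integral_restrict) auto
    also have "\<dots> = (\<integral>x. (if x \<in> {r<..s} then w x else 0) \<partial>lebesgue)"
      by (rule Lebesgue_Measure.integral_restrict_UNIV[symmetric]) simp
    \<comment> \<open>The half-open and the closed interval differ by the null set {r}.\<close>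
    also have "\<dots> = (\<integral>x. (if x \<in> {r..s} then w x else 0) \<partial>lebesgue)"
    proof (rule integral_cong_AE)
      have "integrable lebesgue (\<lambda>x. if x \<in> {r..s} then w x else 0)"
        using that integrable_subinterval[OF w, of r s] by (subst Lebesgue_Measure.integrable_restrict_UNIV) auto
      then show "(\<lambda>x. if x \<in> {r..s} then w x else 0) \<in> borel_measurable lebesgue" by simp
      then have "(\<lambda>x. indicator {r<..s} x * (if x \<in> {r..s} then w x else 0)) \<in> borel_measurable lebesgue"
        by (intro borel_measurable_times borel_measurable_indicator) auto
      also have "(\<lambda>x. indicator {r<..s} x * (if x \<in> {r..s} then w x else 0)) = (\<lambda>x. if x \<in> {r<..s} then w x else 0)"
        by (auto simp: indicator_def)
      finally show "(\<lambda>x. if x \<in> {r<..s} then w x else 0) \<in> borel_measurable lebesgue" .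
      have "{r} \<in> null_sets lebesgue" by simp
      then show "AE x in lebesgue. (if x \<in> {r<..s} then w x else 0) = (if x \<in> {r..s} then w x else 0)"
        by (rule AE_I') (auto split: if_splits)
    qed
    also have "\<dots> = (\<integral>x. w x \<partial>lebesgue_on {r..s})"
      by (rule Lebesgue_Measure.integral_restrict_UNIV) simp
    finally show "(\<integral>x. w x * indicator {r<..s} x \<partial>edge_measure l) = (\<integral>x. w x \<partial>lebesgue_on {r..s})" .
  qed
  moreover have "(\<lambda>x. w x * \<psi> x) = (\<lambda>x. (d - c) * (w x * indicator {a<..b} x) - (b - a) * (w x * indicator {c<..d} x))"
    by (auto simp: \<psi>_def algebra_simps)
  ultimately show ?thesis using ind[of a b] ind[of c d] ab cd by simp
qed

text \<open>K is the mean of w over the middle third, a reference interval away from both ends. By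
  equality of means the primitive of w has slope K between any two interior points, so w - K has
  vanishing primitive.\<close>

lemma weakly_constant_imp_constant:
  fixes w :: "real \<Rightarrow> real"
  assumes "0 < l" and w: "integrable (edge_measure l) w"
    and orth: "\<And>\<phi>. \<phi> \<in> test_funs l \<Longrightarrow> (\<integral>x. w x * deriv \<phi> x \<partial>edge_measure l) = 0"
  obtains K where "AE x in edge_measure l. w x = K"
proof -
  define P where "P x = (\<integral>t. w t \<partial>edge_measure x)" for x
  define K where "K = (\<integral>t. w t \<partial>lebesgue_on {l/3..2*l/3}) / (l / 3)"
  define f where "f x = P x - K * x" for x
  have inc: "P y - P x = K * (y - x)" if "0 < x" "x < y" "y < l" for x y
  proof -
    have "P y = P x + (\<integral>t. w t \<partial>lebesgue_on {x..y})" unfolding P_def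
      using that by (intro Equivalence_Measurable_On_Borel.integral_combine integrable_subinterval[OF w]) auto
    moreover have "(2*l/3 - l/3) * (\<integral>t. w t \<partial>lebesgue_on {x..y}) = (y - x) * (\<integral>t. w t \<partial>lebesgue_on {l/3..2*l/3})"
      using that \<open>0 < l\<close> by (intro weakly_constant_intervals[OF w orth]) auto
    ultimately show ?thesis using \<open>0 < l\<close> by (simp add: K_def field_simps)
  qed
  have cf: "continuous_on {0..l} f"
    unfolding f_def P_def by (intro continuous_intros indefinite_integral_continuous_real w)
  have fconst: "f x = f (l/2)" if "x \<in> {0<..<l}" for x
    using inc[of x "l/2"] inc[of "l/2" x] that \<open>0 < l\<close>
    by (cases x "l/2" rule: linorder_cases) (auto simp: f_def algebra_simps)
  \<comment> \<open>Equality of means speaks of interior intervals only; continuity of the primitive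
    carries the affine formula to the ends.\<close>
  have closure: "closure {0<..<l} = {0..l}" using \<open>0 < l\<close> by simp
  have const: "f x = f (l/2)" if "x \<in> {0..l}" for x
    using continuous_constant_on_closure[of "{0<..<l}" f "f (l/2)" x] cf fconst that unfolding closure by metis
  have "f 0 = 0"
    using has_bochner_integral_null[of "{0}" w] by (simp add: f_def P_def has_bochner_integral_integral_eq)
  then have f0: "f x = 0" if "x \<in> {0..l}" for x using const[OF that] const[of 0] \<open>0 < l\<close> by simp
  have "AE x in edge_measure l. w x - K = 0"
  proof (rule AE_zero_of_primitive_zero[OF _ \<open>0 < l\<close>])
    show "integrable (edge_measure l) (\<lambda>x. w x - K)"
      using w by (intro Bochner_Integration.integrable_diff) (auto intro: continuous_imp_integrable_real)
    fix x assume x: "x \<in> {0..l}"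
    have "(\<integral>t. w t - K \<partial>edge_measure x) = P x - (\<integral>t. K \<partial>edge_measure x)"
      unfolding P_def using x
      by (intro Bochner_Integration.integral_diff integrable_subinterval[OF w])
        (auto intro: continuous_imp_integrable_real)
    also have "\<dots> = f x" using x by (simp add: f_def measure_restrict_space)
    finally show "(\<integral>t. w t - K \<partial>edge_measure x) = 0" using f0[OF x] by simp
  qed
  then show ?thesis using that by simp
qed

lemma test_fun_has_L2_deriv:
  assumes "\<phi> \<in> test_funs l"
  shows "has_L2_deriv l \<phi> (deriv \<phi>)"
proof (rule has_L2_deriv_C1)
  show "continuous_on {0..l} (deriv \<phi>)" using assms by (auto simp: test_funs_def intro: continuous_on_subset)
  fix x
  have "\<phi> differentiable (at x)" using assms by (auto simp: test_funs_def)
  then show "(\<phi> has_real_derivative deriv \<phi> x) (at x within {0..l})"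
    using DERIV_deriv_iff_real_differentiable has_field_derivative_at_within by blast
qed

lemma test_fun_ends: "\<phi> \<in> test_funs l \<Longrightarrow> \<phi> 0 = 0 \<and> \<phi> l = 0"
  by (fastforce simp: test_funs_def)

lemma has_L2_deriv_imp_weak_deriv:
  assumes "has_L2_deriv l u g" "0 < l"
  shows "is_weak_deriv l u g"
  unfolding is_weak_deriv_def
proof
  fix \<phi> assume \<phi>: "\<phi> \<in> test_funs l"
  show "(\<integral>x. u x * deriv \<phi> x \<partial>edge_measure l) = - (\<integral>x. g x * \<phi> x \<partial>edge_measure l)"
    using integration_by_parts_L2_deriv[OF assms(1) test_fun_has_L2_deriv[OF \<phi>]] test_fun_ends[OF \<phi>] assms(2)
    by simp
qed

text \<open>u minus a primitive of g has weak derivative zero, hence is almost everywhere a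
  constant, which is absorbed into the primitive.\<close>

lemma weak_deriv_imp_primitive:
  assumes "0 < l" "u \<in> L2_interval l" "g \<in> L2_interval l" "is_weak_deriv l u g"
  obtains v where "has_L2_deriv l v g" "AE x in edge_measure l. u x = v x"
proof -
  define v where "v x = (\<integral>t. g t \<partial>edge_measure x)" for x
  have v: "has_L2_deriv l (\<lambda>x. c + v x) g" for c
    unfolding v_def using assms(3) by (rule has_L2_deriv_primitive)
  then have v0: "has_L2_deriv l v g" using v[of 0] by simp
  obtain K where "AE x in edge_measure l. u x - v x = K"
  proof (rule weakly_constant_imp_constant[OF \<open>0 < l\<close>, of "\<lambda>x. u x - v x"])
    show "integrable (edge_measure l) (\<lambda>x. u x - v x)"
      using assms(2) has_L2_deriv_L2[OF v0] by (auto intro: L2_integrable)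
    fix \<phi> assume \<phi>: "\<phi> \<in> test_funs l"
    have L: "deriv \<phi> \<in> L2_interval l" using test_fun_has_L2_deriv[OF \<phi>] by (rule has_L2_derivD)
    have "(\<integral>x. (u x - v x) * deriv \<phi> x \<partial>edge_measure l)
        = (\<integral>x. u x * deriv \<phi> x \<partial>edge_measure l) - (\<integral>x. v x * deriv \<phi> x \<partial>edge_measure l)"
      using L2_mult_integrable[OF assms(2) L] L2_mult_integrable[OF has_L2_deriv_L2[OF v0] L]
      by (simp add: left_diff_distrib)
    then show "(\<integral>x. (u x - v x) * deriv \<phi> x \<partial>edge_measure l) = 0"
      using assms(4) has_L2_deriv_imp_weak_deriv[OF v0 \<open>0 < l\<close>] \<phi> by (simp add: is_weak_deriv_def)
  qed
  then have "AE x in edge_measure l. u x = K + v x" by eventually_elim auto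
  with v show ?thesis using that by blast
qed

lemma continuous_AE_eq:
  fixes u v :: "real \<Rightarrow> real"
  assumes "0 < l" "continuous_on {0..l} u" "continuous_on {0..l} v" "AE x in edge_measure l. u x = v x"
    and "x \<in> {0..l}"
  shows "u x = v x"
proof -
  have "(\<integral>x. \<bar>u x - v x\<bar> \<partial>edge_measure l) = 0"
    by (rule integral_eq_zero_AE) (use assms(4) in auto)
  then have "\<forall>x\<in>{0..l}. \<bar>u x - v x\<bar> = 0"
    using assms by (subst (asm) integralL_eq_0_iff) (auto intro!: continuous_intros)
  then show ?thesis using assms(5) by simp
qed

lemma continuous_weak_deriv_imp_has_L2_deriv:
  assumes "0 < l" "continuous_on {0..l} u" "g \<in> L2_interval l" "is_weak_deriv l u g"
  shows "has_L2_deriv l u g"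
proof -
  obtain v where v: "has_L2_deriv l v g" and "AE x in edge_measure l. u x = v x"
    using weak_deriv_imp_primitive[OF assms(1) continuous_L2[OF assms(2)] assms(3,4)] .
  then have "u x = v x" if "x \<in> {0..l}" for x
    using continuous_AE_eq[OF assms(1,2) has_L2_deriv_continuous[OF v] _ that] by simp
  then show ?thesis by (intro has_L2_deriv_cong[OF v]) simp
qed

lemma H1_intervalI:
  assumes "has_L2_deriv l u g" "0 < l"
  shows "u \<in> H1_interval l"
  using has_L2_deriv_imp_weak_deriv[OF assms] has_L2_derivD[OF assms(1)] has_L2_deriv_L2[OF assms(1)]
  by (auto simp: H1_interval_def)

lemma H1_weak_deriv:
  assumes "u \<in> H1_interval l"
  shows "weak_deriv l u \<in> L2_interval l" "is_weak_deriv l u (weak_deriv l u)"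
proof -
  have "\<exists>g. g \<in> L2_interval l \<and> is_weak_deriv l u g" using assms by (auto simp: H1_interval_def)
  from someI_ex[OF this] show "weak_deriv l u \<in> L2_interval l" "is_weak_deriv l u (weak_deriv l u)"
    by (auto simp: weak_deriv_def)
qed

lemma H1_has_L2_deriv:
  assumes "0 < l" "continuous_on {0..l} u" "u \<in> H1_interval l"
  shows "has_L2_deriv l u (weak_deriv l u)"
  using continuous_weak_deriv_imp_has_L2_deriv[OF assms(1,2) H1_weak_deriv[OF assms(3)]] .

text \<open>This makes the choice inside \<open>weak_deriv\<close> harmless: whichever derivative is
  exhibited by the calculus of \<open>has_L2_deriv\<close> agrees with the chosen one almost
  everywhere.\<close>

lemma weak_deriv_unique:
  assumes "has_L2_deriv l u g" "0 < l"
  shows "AE x in edge_measure l. weak_deriv l u x = g x"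
  using has_L2_deriv_unique[OF H1_has_L2_deriv[OF assms(2) has_L2_deriv_continuous H1_intervalI] assms(1,2)] assms
  by auto

section \<open>Forms on the Sobolev space of a metric graph\<close>

context compact_metric_graph
begin

abbreviation H1 :: "'e graph_fun set" where "H1 \<equiv> graph_H1 G len"
abbreviation D :: "'e graph_fun \<Rightarrow> 'e graph_fun" where "D u \<equiv> graph_deriv len u"
abbreviation gint :: "'e graph_fun \<Rightarrow> real" where "gint f \<equiv> graph_integral G len f"

definition edge_continuous :: "'e graph_fun \<Rightarrow> bool" where
  "edge_continuous u \<longleftrightarrow> (\<forall>e\<in>arcs G. continuous_on {0..len e} (u e))"

definition close :: "real \<Rightarrow> 'e graph_fun \<Rightarrow> 'e graph_fun \<Rightarrow> bool" where
  "close \<delta> u v \<longleftrightarrow> (\<forall>e\<in>arcs G. \<forall>x\<in>{0..len e}. \<bar>u e x - v e x\<bar> \<le> \<delta>)"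

definition dirichlet :: "'e graph_fun \<Rightarrow> 'e graph_fun \<Rightarrow> real" where
  "dirichlet u v = gint (\<lambda>e x. D u e x * D v e x)"

definition weighted_inner :: "'e graph_fun \<Rightarrow> 'e graph_fun \<Rightarrow> 'e graph_fun \<Rightarrow> real" where
  "weighted_inner b u v = gint (\<lambda>e x. b e x * u e x * v e x)"

definition gintegrable :: "'e graph_fun \<Rightarrow> bool" where
  "gintegrable f \<longleftrightarrow> (\<forall>e\<in>arcs G. integrable (edge_measure (len e)) (f e))"

lemma gint_add: "gintegrable f \<Longrightarrow> gintegrable g \<Longrightarrow> gint (\<lambda>e x. f e x + g e x) = gint f + gint g"
  by (simp add: graph_integral_def gintegrable_def sum.distrib)

lemma gint_diff: "gintegrable f \<Longrightarrow> gintegrable g \<Longrightarrow> gint (\<lambda>e x. f e x - g e x) = gint f - gint g"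
  by (simp add: graph_integral_def gintegrable_def sum_subtractf)

lemma gint_cmult: "gint (\<lambda>e x. c * f e x) = c * gint f"
  by (simp add: graph_integral_def sum_distrib_left)

lemma gint_mono:
  "gintegrable f \<Longrightarrow> gintegrable g \<Longrightarrow> (\<And>e. e \<in> arcs G \<Longrightarrow> AE x in edge_measure (len e). f e x \<le> g e x)
    \<Longrightarrow> gint f \<le> gint g"
  unfolding graph_integral_def gintegrable_def by (intro sum_mono integral_mono_AE) auto

lemma gint_nonneg:
  "(\<And>e. e \<in> arcs G \<Longrightarrow> AE x in edge_measure (len e). 0 \<le> f e x) \<Longrightarrow> 0 \<le> gint f"
  unfolding graph_integral_def by (intro sum_nonneg integral_nonneg_AE) auto

lemma gint_cong:
  "(\<And>e x. e \<in> arcs G \<Longrightarrow> x \<in> {0..len e} \<Longrightarrow> f e x = g e x) \<Longrightarrow> gint f = gint g"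
  unfolding graph_integral_def by (intro sum.cong refl Bochner_Integration.integral_cong) auto

lemma gintegrable_add: "gintegrable f \<Longrightarrow> gintegrable g \<Longrightarrow> gintegrable (\<lambda>e x. f e x + g e x)"
  and gintegrable_diff: "gintegrable f \<Longrightarrow> gintegrable g \<Longrightarrow> gintegrable (\<lambda>e x. f e x - g e x)"
  and gintegrable_cmult: "gintegrable f \<Longrightarrow> gintegrable (\<lambda>e x. c * f e x)"
  by (auto simp: gintegrable_def)

lemma gint_zero_AE:
  assumes "gintegrable f" "\<And>e. e \<in> arcs G \<Longrightarrow> AE x in edge_measure (len e). 0 \<le> f e x" "gint f = 0"
    and "e \<in> arcs G"
  shows "AE x in edge_measure (len e). f e x = 0"
proof -
  have "(\<integral>x. f e x \<partial>edge_measure (len e)) = 0"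
    using assms(3,4) unfolding graph_integral_def
    by (subst (asm) sum_nonneg_eq_0_iff) (auto intro!: integral_nonneg_AE assms)
  then show ?thesis
    using assms by (subst (asm) integral_nonneg_eq_0_iff_AE) (auto simp: gintegrable_def)
qed

lemma H1_edge:
  assumes "u \<in> H1" "e \<in> arcs G"
  shows "has_L2_deriv (len e) (u e) (D u e)"
  using assms len_pos[OF assms(2)] unfolding graph_deriv_def
  by (intro H1_has_L2_deriv) (auto simp: graph_H1_def graph_continuous_def)

lemma H1_edge_continuous: "u \<in> H1 \<Longrightarrow> edge_continuous u"
  by (auto simp: graph_H1_def graph_continuous_def edge_continuous_def)

lemma H1_I:
  assumes "\<And>e. e \<in> arcs G \<Longrightarrow> has_L2_deriv (len e) (u e) (g e)"
    and "\<And>e. e \<in> arcs G \<Longrightarrow> u e 0 = c (tail G e)" "\<And>e. e \<in> arcs G \<Longrightarrow> u e (len e) = c (head G e)"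
    and "\<And>e x. \<not> (e \<in> arcs G \<and> x \<in> {0..len e}) \<Longrightarrow> u e x = 0"
  shows "u \<in> H1"
  unfolding graph_H1_def graph_continuous_def
proof (intro CollectI conjI ballI allI impI exI[of _ c])
  fix e assume e: "e \<in> arcs G"
  show "continuous_on {0..len e} (u e)" using has_L2_deriv_continuous[OF assms(1)[OF e]] .
  show "u e \<in> H1_interval (len e)" using H1_intervalI[OF assms(1)[OF e] len_pos[OF e]] .
qed (use assms in auto)

lemma D_unique:
  "e \<in> arcs G \<Longrightarrow> has_L2_deriv (len e) (u e) g \<Longrightarrow> AE x in edge_measure (len e). D u e x = g x"
  unfolding graph_deriv_def using weak_deriv_unique len_pos by blast

lemma H1_vertex:
  assumes "u \<in> H1"
  obtains c where "\<forall>e\<in>arcs G. u e 0 = c (tail G e) \<and> u e (len e) = c (head G e)"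
  using assms unfolding graph_H1_def graph_continuous_def by blast

lemma H1_outside: "u \<in> H1 \<Longrightarrow> \<not> (e \<in> arcs G \<and> x \<in> {0..len e}) \<Longrightarrow> u e x = 0"
  unfolding graph_H1_def by blast

text \<open>Cut off outside the graph, because members of \<open>graph_H1\<close> vanish at
  irrelevant arguments and F 0 need not be 0.\<close>

definition compose :: "(real \<Rightarrow> real) \<Rightarrow> 'e graph_fun \<Rightarrow> 'e graph_fun" where
  "compose F u e x = (if e \<in> arcs G \<and> x \<in> {0..len e} then F (u e x) else 0)"

text \<open>Continuity at vertices is preserved because F acts on the vertex values.
  Differentiability is asked only at values taken by u, which admits ln (y + \<epsilon>) and 1 / (y
  + \<epsilon>) for nonnegative u.\<close>

lemma compose_H1:
  assumes u: "u \<in> H1"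
    and F: "\<And>e x. e \<in> arcs G \<Longrightarrow> x \<in> {0..len e} \<Longrightarrow> (F has_real_derivative F' (u e x)) (at (u e x))"
    and F': "\<And>e. e \<in> arcs G \<Longrightarrow> continuous_on (u e ` {0..len e}) F'"
  shows "compose F u \<in> H1"
    and "e \<in> arcs G \<Longrightarrow> AE x in edge_measure (len e). D (compose F u) e x = F' (u e x) * D u e x"
proof -
  have *: "has_L2_deriv (len e) (compose F u e) (\<lambda>x. F' (u e x) * D u e x)" if "e \<in> arcs G" for e
    using has_L2_deriv_chain[OF H1_edge[OF u that] F[OF that] F'[OF that]]
    by (rule has_L2_deriv_cong) (use that in \<open>auto simp: compose_def\<close>)
  obtain c where c: "\<forall>e\<in>arcs G. u e 0 = c (tail G e) \<and> u e (len e) = c (head G e)"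
    by (rule H1_vertex[OF u])
  show "compose F u \<in> H1"
    by (rule H1_I[where c="\<lambda>v. F (c v)", OF *])
      (use c len_pos in \<open>auto simp: compose_def less_imp_le\<close>)
  show "e \<in> arcs G \<Longrightarrow> AE x in edge_measure (len e). D (compose F u) e x = F' (u e x) * D u e x"
    using D_unique * by blast
qed

lemma H1_zero: "0 \<in> H1"
  by (rule H1_I[of _ "\<lambda>e x. 0" "\<lambda>v. 0"]) (auto simp: has_L2_deriv_def intro: continuous_L2)

lemma linear_combination_edge:
  assumes "u \<in> H1" "v \<in> H1" "e \<in> arcs G"
  shows "has_L2_deriv (len e) ((a *\<^sub>R u + b *\<^sub>R v) e) (\<lambda>x. a * D u e x + b * D v e x)"
  using has_L2_deriv_add[OF has_L2_deriv_scale[OF H1_edge[OF assms(1,3)], of a] has_L2_deriv_scale[OF H1_edge[OF assms(2,3)], of b]]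
  by (simp add: scaleR_fun_def plus_fun_def)

lemma H1_linear_combination:
  assumes "u \<in> H1" "v \<in> H1"
  shows "a *\<^sub>R u + b *\<^sub>R v \<in> H1"
proof -
  obtain c where "\<forall>e\<in>arcs G. u e 0 = c (tail G e) \<and> u e (len e) = c (head G e)"
    by (rule H1_vertex[OF assms(1)])
  moreover obtain d where "\<forall>e\<in>arcs G. v e 0 = d (tail G e) \<and> v e (len e) = d (head G e)"
    by (rule H1_vertex[OF assms(2)])
  ultimately show ?thesis
    by (intro H1_I[where c="\<lambda>w. a * c w + b * d w", OF linear_combination_edge[OF assms]])
      (auto simp: scaleR_fun_def plus_fun_def H1_outside[OF assms(1)] H1_outside[OF assms(2)])
qed

lemma H1_add: "u \<in> H1 \<Longrightarrow> v \<in> H1 \<Longrightarrow> u + v \<in> H1"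
  and H1_scale: "u \<in> H1 \<Longrightarrow> a *\<^sub>R u \<in> H1"
  and H1_diff: "u \<in> H1 \<Longrightarrow> v \<in> H1 \<Longrightarrow> u - v \<in> H1"
  using H1_linear_combination[of u v 1 1] H1_linear_combination[of u u a 0] H1_linear_combination[of u v 1 "-1"]
  by auto

lemma subspace_H1: "subspace H1"
  by (simp add: subspace_def H1_zero H1_add H1_scale)

lemma D_L2: "u \<in> H1 \<Longrightarrow> e \<in> arcs G \<Longrightarrow> D u e \<in> L2_interval (len e)"
  using H1_edge has_L2_derivD by blast

lemma D_linear_combination:
  "u \<in> H1 \<Longrightarrow> v \<in> H1 \<Longrightarrow> e \<in> arcs G
    \<Longrightarrow> AE x in edge_measure (len e). D (a *\<^sub>R u + b *\<^sub>R v) e x = a * D u e x + b * D v e x"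
  by (rule D_unique[OF _ linear_combination_edge])

text \<open>Allows a concrete representative g to stand in for the chosen derivative of u inside the
  Dirichlet form.\<close>

lemma dirichlet_eq:
  assumes "\<And>e. e \<in> arcs G \<Longrightarrow> AE x in edge_measure (len e). D u e x = g e x"
    and "u \<in> H1" "v \<in> H1" "\<And>e. e \<in> arcs G \<Longrightarrow> g e \<in> L2_interval (len e)"
  shows "dirichlet u v = gint (\<lambda>e x. g e x * D v e x)"
  unfolding dirichlet_def graph_integral_def
proof (intro sum.cong refl integral_cong_AE)
  fix e assume e: "e \<in> arcs G"
  have [measurable]: "g e \<in> borel_measurable (edge_measure (len e))"
    "D u e \<in> borel_measurable (edge_measure (len e))" "D v e \<in> borel_measurable (edge_measure (len e))"
    using assms e D_L2 L2_measurable by blast+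
  show "(\<lambda>x. D u e x * D v e x) \<in> borel_measurable (edge_measure (len e))"
    "(\<lambda>x. g e x * D v e x) \<in> borel_measurable (edge_measure (len e))" by measurable
  show "AE x in edge_measure (len e). D u e x * D v e x = g e x * D v e x"
    using assms(1)[OF e] by eventually_elim simp
qed

lemma dirichlet_integrable: "u \<in> H1 \<Longrightarrow> v \<in> H1 \<Longrightarrow> gintegrable (\<lambda>e x. D u e x * D v e x)"
  by (simp add: gintegrable_def D_L2 L2_mult_integrable)

lemma dirichlet_commute: "dirichlet u v = dirichlet v u"
  by (simp add: dirichlet_def mult.commute)

lemma dirichlet_lincomb:
  assumes "u \<in> H1" "v \<in> H1" "w \<in> H1"
  shows "dirichlet (a *\<^sub>R u + b *\<^sub>R v) w = a * dirichlet u w + b * dirichlet v w"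
proof -
  have "dirichlet (a *\<^sub>R u + b *\<^sub>R v) w = gint (\<lambda>e x. (a * D u e x + b * D v e x) * D w e x)"
    using assms by (intro dirichlet_eq D_linear_combination H1_linear_combination L2_add L2_scale D_L2)
  also have "\<dots> = gint (\<lambda>e x. a * (D u e x * D w e x) + b * (D v e x * D w e x))"
    by (simp add: algebra_simps)
  also have "\<dots> = a * dirichlet u w + b * dirichlet v w"
    unfolding dirichlet_def using assms
    by (simp add: gint_add gint_cmult gintegrable_cmult dirichlet_integrable)
  finally show ?thesis .
qed

lemma dirichlet_nonneg: "0 \<le> dirichlet u u"
  unfolding dirichlet_def by (intro gint_nonneg) auto

section \<open>Bounded weights and weighted bilinear forms\<close>

lemma edge_continuous_L2: "edge_continuous u \<Longrightarrow> e \<in> arcs G \<Longrightarrow> u e \<in> L2_interval (len e)"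
  by (auto simp: edge_continuous_def intro: continuous_L2)

lemma edge_continuous_intros:
  "edge_continuous u \<Longrightarrow> edge_continuous v \<Longrightarrow> edge_continuous (u + v)"
  "edge_continuous u \<Longrightarrow> edge_continuous v \<Longrightarrow> edge_continuous (u - v)"
  "edge_continuous u \<Longrightarrow> edge_continuous (a *\<^sub>R u)"
  by (auto simp: edge_continuous_def plus_fun_def fun_diff_def scaleR_fun_def intro!: continuous_intros)

lemma Linfty_mult_L2:
  assumes "b \<in> graph_Linfty G len" "e \<in> arcs G" "f \<in> L2_interval (len e)"
  shows "(\<lambda>x. b e x * f x) \<in> L2_interval (len e)"
proof -
  obtain C where "b e \<in> borel_measurable (edge_measure (len e))" "AE x in edge_measure (len e). \<bar>b e x\<bar> \<le> C"
    using assms(1,2) unfolding graph_Linfty_def by auto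
  then show ?thesis using assms(3) by (rule L2_bounded_mult)
qed

lemma Linfty_L2:
  assumes "b \<in> graph_Linfty G len" "e \<in> arcs G"
  shows "b e \<in> L2_interval (len e)"
proof -
  obtain C where "b e \<in> borel_measurable (edge_measure (len e))" "AE x in edge_measure (len e). \<bar>b e x\<bar> \<le> C"
    using assms unfolding graph_Linfty_def by auto
  then show ?thesis by (rule L2_bounded)
qed

lemma Linfty_bound:
  assumes "b \<in> graph_Linfty G len"
  obtains C where "C > 0" "\<And>e. e \<in> arcs G \<Longrightarrow> AE x in edge_measure (len e). \<bar>b e x\<bar> \<le> C"
proof -
  obtain C where C: "\<And>e. e \<in> arcs G \<Longrightarrow> AE x in edge_measure (len e). \<bar>b e x\<bar> \<le> C e"
    using assms unfolding graph_Linfty_def mem_Collect_eq by metis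
  define K where "K = 1 + (\<Sum>e\<in>arcs G. \<bar>C e\<bar>)"
  have "K > 0" unfolding K_def by (smt (verit) sum_nonneg abs_ge_zero)
  moreover have "AE x in edge_measure (len e). \<bar>b e x\<bar> \<le> K" if "e \<in> arcs G" for e
  proof -
    have "C e \<le> K" using member_le_sum[of e "arcs G" "\<lambda>e. \<bar>C e\<bar>"] that unfolding K_def by auto
    then show ?thesis using C[OF that] by (auto elim: eventually_mono)
  qed
  ultimately show ?thesis using that by blast
qed

lemma edge_continuous_bound:
  assumes "edge_continuous u"
  obtains M where "M > 0" "\<And>e x. e \<in> arcs G \<Longrightarrow> x \<in> {0..len e} \<Longrightarrow> \<bar>u e x\<bar> \<le> M"
proof -
  have "\<exists>C. \<forall>x\<in>{0..len e}. \<bar>u e x\<bar> \<le> C" if "e \<in> arcs G" for e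
    using compact_imp_bounded[OF compact_continuous_image, of "{0..len e}" "u e"] assms that
    by (auto simp: edge_continuous_def bounded_iff)
  then obtain C where C: "\<And>e x. e \<in> arcs G \<Longrightarrow> x \<in> {0..len e} \<Longrightarrow> \<bar>u e x\<bar> \<le> C e" by metis
  define K where "K = 1 + (\<Sum>e\<in>arcs G. \<bar>C e\<bar>)"
  have "K > 0" unfolding K_def by (smt (verit) sum_nonneg abs_ge_zero)
  moreover have "\<bar>u e x\<bar> \<le> K" if "e \<in> arcs G" "x \<in> {0..len e}" for e x
  proof -
    have "\<bar>C e\<bar> \<le> (\<Sum>e\<in>arcs G. \<bar>C e\<bar>)" using that by (intro member_le_sum) auto
    then show ?thesis using C[OF that] unfolding K_def by linarith
  qed
  ultimately show ?thesis using that by blast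
qed

lemma const_Linfty: "(\<lambda>e x. c) \<in> graph_Linfty G len"
  by (auto simp: graph_Linfty_def intro!: exI[of _ "\<bar>c\<bar>"])

lemma edge_continuous_Linfty:
  assumes "edge_continuous u"
  shows "u \<in> graph_Linfty G len"
proof -
  obtain M where "\<And>e x. e \<in> arcs G \<Longrightarrow> x \<in> {0..len e} \<Longrightarrow> \<bar>u e x\<bar> \<le> M"
    using edge_continuous_bound[OF assms] by blast
  then show ?thesis using edge_continuous_L2[OF assms] L2_measurable
    unfolding graph_Linfty_def by (intro CollectI ballI conjI exI[of _ M] AE_I2) auto
qed

lemma Linfty_mult:
  assumes "b \<in> graph_Linfty G len" "c \<in> graph_Linfty G len"
  shows "(\<lambda>e x. b e x * c e x) \<in> graph_Linfty G len"
proof -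
  obtain B C where B: "B > 0" "\<And>e. e \<in> arcs G \<Longrightarrow> AE x in edge_measure (len e). \<bar>b e x\<bar> \<le> B"
    and C: "C > 0" "\<And>e. e \<in> arcs G \<Longrightarrow> AE x in edge_measure (len e). \<bar>c e x\<bar> \<le> C"
    using Linfty_bound[OF assms(1)] Linfty_bound[OF assms(2)] by metis
  have "AE x in edge_measure (len e). \<bar>b e x * c e x\<bar> \<le> B * C" if "e \<in> arcs G" for e
    using B(2)[OF that] C(2)[OF that]
    by eventually_elim (use B(1) C(1) in \<open>auto simp: abs_mult intro!: mult_mono\<close>)
  moreover have "(\<lambda>x. b e x * c e x) \<in> borel_measurable (edge_measure (len e))" if "e \<in> arcs G" for e
    using assms that unfolding graph_Linfty_def by (intro borel_measurable_times) auto
  ultimately show ?thesis unfolding graph_Linfty_def by blast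
qed

lemma Linfty_add:
  assumes "b \<in> graph_Linfty G len" "c \<in> graph_Linfty G len"
  shows "(\<lambda>e x. b e x + c e x) \<in> graph_Linfty G len"
proof -
  obtain B C where B: "B > 0" "\<And>e. e \<in> arcs G \<Longrightarrow> AE x in edge_measure (len e). \<bar>b e x\<bar> \<le> B"
    and C: "C > 0" "\<And>e. e \<in> arcs G \<Longrightarrow> AE x in edge_measure (len e). \<bar>c e x\<bar> \<le> C"
    using Linfty_bound[OF assms(1)] Linfty_bound[OF assms(2)] by metis
  have "AE x in edge_measure (len e). \<bar>b e x + c e x\<bar> \<le> B + C" if "e \<in> arcs G" for e
    using B(2)[OF that] C(2)[OF that] by eventually_elim auto
  moreover have "(\<lambda>x. b e x + c e x) \<in> borel_measurable (edge_measure (len e))" if "e \<in> arcs G" for e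
    using assms that unfolding graph_Linfty_def by (intro borel_measurable_add) auto
  ultimately show ?thesis unfolding graph_Linfty_def by blast
qed

lemma compose_Linfty:
  assumes "edge_continuous u" "continuous_on UNIV F"
  shows "(\<lambda>e x. F (u e x)) \<in> graph_Linfty G len"
proof (rule edge_continuous_Linfty)
  show "edge_continuous (\<lambda>e x. F (u e x))"
    using assms continuous_on_compose2[OF assms(2)] by (auto simp: edge_continuous_def)
qed

lemma Linfty_integrable: "b \<in> graph_Linfty G len \<Longrightarrow> gintegrable b"
  by (auto simp: gintegrable_def intro: L2_integrable Linfty_L2)

lemma weighted_integrable:
  assumes "b \<in> graph_Linfty G len" "edge_continuous u" "edge_continuous v"
  shows "gintegrable (\<lambda>e x. b e x * u e x * v e x)"
  by (rule Linfty_integrable[OF Linfty_mult[OF Linfty_mult[OF assms(1) edge_continuous_Linfty[OF assms(2)]]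
    edge_continuous_Linfty[OF assms(3)]]])

lemma weighted_inner_commute: "weighted_inner b u v = weighted_inner b v u"
  by (simp add: weighted_inner_def mult_ac)

lemma weighted_inner_lincomb:
  assumes "b \<in> graph_Linfty G len" "edge_continuous u" "edge_continuous v" "edge_continuous w"
  shows "weighted_inner b (s *\<^sub>R u + t *\<^sub>R v) w = s * weighted_inner b u w + t * weighted_inner b v w"
proof -
  have "weighted_inner b (s *\<^sub>R u + t *\<^sub>R v) w
      = gint (\<lambda>e x. s * (b e x * u e x * w e x) + t * (b e x * v e x * w e x))"
    unfolding weighted_inner_def by (intro gint_cong) (simp add: scaleR_fun_def plus_fun_def algebra_simps)
  then show ?thesis using assms unfolding weighted_inner_def
    by (simp add: gint_add gint_cmult gintegrable_cmult weighted_integrable)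
qed


abbreviation inner_L2 :: "'e graph_fun \<Rightarrow> 'e graph_fun \<Rightarrow> real" where
  "inner_L2 \<equiv> weighted_inner (\<lambda>e x. 1)"

text \<open>The form of -v'' + b v. The Kirchhoff conditions on derivatives are its natural boundary
  conditions, so they need not be imposed on the arguments.\<close>

definition energy :: "'e graph_fun \<Rightarrow> 'e graph_fun \<Rightarrow> 'e graph_fun \<Rightarrow> real" where
  "energy b u v = dirichlet u v + weighted_inner b u v"

lemma energy_commute: "energy b u v = energy b v u"
  by (simp add: energy_def dirichlet_commute[of u] weighted_inner_commute[of _ u])

lemma energy_lincomb:
  assumes "b \<in> graph_Linfty G len" "u \<in> H1" "v \<in> H1" "w \<in> H1"
  shows "energy b (s *\<^sub>R u + t *\<^sub>R v) w = s * energy b u w + t * energy b v w"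
  using assms by (simp add: energy_def dirichlet_lincomb weighted_inner_lincomb H1_edge_continuous algebra_simps)

lemma energy_square:
  assumes "b \<in> graph_Linfty G len" "u \<in> H1" "v \<in> H1"
  shows "energy b (s *\<^sub>R u + t *\<^sub>R v) (s *\<^sub>R u + t *\<^sub>R v)
    = s\<^sup>2 * energy b u u + 2 * s * t * energy b u v + t\<^sup>2 * energy b v v"
proof -
  have "energy b (s *\<^sub>R u + t *\<^sub>R v) (s *\<^sub>R u + t *\<^sub>R v)
      = s * energy b (s *\<^sub>R u + t *\<^sub>R v) u + t * energy b (s *\<^sub>R u + t *\<^sub>R v) v"
    using energy_lincomb[OF assms H1_linear_combination[OF assms(2,3)], of s t s t]
    by (simp only: energy_commute[of b u "s *\<^sub>R u + t *\<^sub>R v"] energy_commute[of b v "s *\<^sub>R u + t *\<^sub>R v"])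
  also have "\<dots> = s * (s * energy b u u + t * energy b u v) + t * (s * energy b u v + t * energy b v v)"
    using energy_lincomb[OF assms assms(2), of s t] energy_lincomb[OF assms assms(3), of s t]
    by (simp only: energy_commute[of b v u])
  finally show ?thesis by (simp add: power2_eq_square algebra_simps)
qed

lemma weighted_inner_square:
  assumes "b \<in> graph_Linfty G len" "edge_continuous u" "edge_continuous v"
  shows "weighted_inner b (s *\<^sub>R u + t *\<^sub>R v) (s *\<^sub>R u + t *\<^sub>R v)
    = s\<^sup>2 * weighted_inner b u u + 2 * s * t * weighted_inner b u v + t\<^sup>2 * weighted_inner b v v"
proof -
  have "weighted_inner b (s *\<^sub>R u + t *\<^sub>R v) (s *\<^sub>R u + t *\<^sub>R v)
      = s * weighted_inner b (s *\<^sub>R u + t *\<^sub>R v) u + t * weighted_inner b (s *\<^sub>R u + t *\<^sub>R v) v"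
    using weighted_inner_lincomb[OF assms edge_continuous_intros(1)[OF edge_continuous_intros(3)[OF assms(2)] edge_continuous_intros(3)[OF assms(3)]], of s t s t]
    by (simp only: weighted_inner_commute[of b u "s *\<^sub>R u + t *\<^sub>R v"] weighted_inner_commute[of b v "s *\<^sub>R u + t *\<^sub>R v"])
  also have "\<dots> = s * (s * weighted_inner b u u + t * weighted_inner b u v)
      + t * (s * weighted_inner b u v + t * weighted_inner b v v)"
    using weighted_inner_lincomb[OF assms assms(2), of s t] weighted_inner_lincomb[OF assms assms(3), of s t]
    by (simp only: weighted_inner_commute[of b v u])
  finally show ?thesis by (simp add: power2_eq_square algebra_simps)
qed

lemma dirichlet_square:
  assumes "u \<in> H1" "v \<in> H1"
  shows "dirichlet (s *\<^sub>R u + t *\<^sub>R v) (s *\<^sub>R u + t *\<^sub>R v)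
    = s\<^sup>2 * dirichlet u u + 2 * s * t * dirichlet u v + t\<^sup>2 * dirichlet v v"
proof -
  have "energy (\<lambda>e x. 0) u v = dirichlet u v" for u v
    by (simp add: energy_def weighted_inner_def graph_integral_def)
  then show ?thesis using energy_square[OF const_Linfty assms, of 0 s t] by simp
qed

lemma dirichlet_Cauchy_Schwarz:
  assumes "u \<in> H1" "v \<in> H1"
  shows "\<bar>dirichlet u v\<bar> \<le> sqrt (dirichlet u u) * sqrt (dirichlet v v)"
proof -
  have "(dirichlet u v)\<^sup>2 \<le> dirichlet u u * dirichlet v v"
  proof (rule discriminant_of_nonneg_form)
    show "0 \<le> s\<^sup>2 * dirichlet u u + 2 * s * t * dirichlet u v + t\<^sup>2 * dirichlet v v" for s t
      using dirichlet_nonneg[of "s *\<^sub>R u + t *\<^sub>R v"] dirichlet_square[OF assms, of s t] by simp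
  qed
  then have "sqrt ((dirichlet u v)\<^sup>2) \<le> sqrt (dirichlet u u * dirichlet v v)" by (rule real_sqrt_le_mono)
  then show ?thesis by (simp only: real_sqrt_abs real_sqrt_mult)
qed

lemma inner_L2_nonneg: "0 \<le> inner_L2 u u"
  unfolding weighted_inner_def by (intro gint_nonneg) auto

section \<open>Sup bounds and oscillation along paths\<close>

lemma edge_dirichlet_le:
  assumes "u \<in> H1" "e \<in> arcs G"
  shows "(\<integral>x. (D u e x)\<^sup>2 \<partial>edge_measure (len e)) \<le> dirichlet u u"
  unfolding dirichlet_def graph_integral_def power2_eq_square
  using assms by (intro member_le_sum[where f="\<lambda>e. \<integral>x. D u e x * D u e x \<partial>edge_measure (len e)"]) auto

lemma edge_inner_L2_le:
  assumes "e \<in> arcs G"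
  shows "(\<integral>x. (u e x)\<^sup>2 \<partial>edge_measure (len e)) \<le> inner_L2 u u"
  unfolding weighted_inner_def graph_integral_def power2_eq_square mult_1
  using assms by (intro member_le_sum[where f="\<lambda>e. \<integral>x. u e x * u e x \<partial>edge_measure (len e)"]) auto

lemma edge_oscillation_sq:
  assumes u: "u \<in> H1" and e: "e \<in> arcs G" and "x \<in> {0..len e}" "y \<in> {0..len e}"
  shows "(u e x - u e y)\<^sup>2 \<le> \<bar>x - y\<bar> * dirichlet u u"
proof -
  have *: "(u e y - u e x)\<^sup>2 \<le> (y - x) * dirichlet u u" if "x \<in> {0..len e}" "y \<in> {0..len e}" "x \<le> y" for x y
  proof -
    have "(u e y - u e x)\<^sup>2 \<le> (y - x) * (\<integral>t. (D u e t)\<^sup>2 \<partial>edge_measure (len e))"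
      using that by (intro has_L2_deriv_Holder[OF H1_edge[OF u e]]) auto
    also have "\<dots> \<le> (y - x) * dirichlet u u"
      using edge_dirichlet_le[OF u e] that by (intro mult_left_mono) auto
    finally show ?thesis .
  qed
  show ?thesis using *[of x y] *[of y x] assms(3,4)
    by (cases "x \<le> y") (auto simp: power2_commute[of "u e x"])
qed

lemma edge_oscillation_length:
  assumes "u \<in> H1" "e \<in> arcs G" "x \<in> {0..len e}" "y \<in> {0..len e}"
  shows "(u e x - u e y)\<^sup>2 \<le> len e * dirichlet u u"
proof -
  have "\<bar>x - y\<bar> \<le> len e" using assms(3,4) by auto
  then have "\<bar>x - y\<bar> * dirichlet u u \<le> len e * dirichlet u u"
    using dirichlet_nonneg by (rule mult_right_mono)
  then show ?thesis using edge_oscillation_sq[OF assms] by linarith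
qed

lemma edge_oscillation:
  assumes "u \<in> H1" "e \<in> arcs G" "x \<in> {0..len e}" "y \<in> {0..len e}"
  shows "\<bar>u e x - u e y\<bar> \<le> sqrt (len e) * sqrt (dirichlet u u)"
proof -
  have "sqrt ((u e x - u e y)\<^sup>2) \<le> sqrt (len e * dirichlet u u)"
    using edge_oscillation_length[OF assms] by (rule real_sqrt_le_mono)
  then show ?thesis by (simp only: real_sqrt_abs real_sqrt_mult)
qed

text \<open>The value at x is compared with the value at every y of the same edge through the
  Hoelder bound, and the comparison is integrated over y. This gives the constants 2 / len e and 2 *
  len e; summing over the edges makes C uniform.\<close>

lemma sup_bound:
  obtains C where "C > 0"
    "\<And>u e x. u \<in> H1 \<Longrightarrow> e \<in> arcs G \<Longrightarrow> x \<in> {0..len e} \<Longrightarrow> (u e x)\<^sup>2 \<le> C * (dirichlet u u + inner_L2 u u)"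
proof -
  define C where "C = 1 + (\<Sum>e\<in>arcs G. 2 / len e + 2 * len e)"
  have nn: "0 \<le> 2 / len e + 2 * len e" if "e \<in> arcs G" for e using len_pos[OF that] by simp
  have "C > 0" unfolding C_def by (smt (verit) sum_nonneg nn)
  moreover have "(u e x)\<^sup>2 \<le> C * (dirichlet u u + inner_L2 u u)"
    if u: "u \<in> H1" and e: "e \<in> arcs G" and x: "x \<in> {0..len e}" for u e x
  proof -
    let ?l = "len e" and ?d = "dirichlet u u" and ?i = "inner_L2 u u"
    have l: "?l > 0" using len_pos[OF e] .
    have pt: "(u e x)\<^sup>2 \<le> 2 * (u e y)\<^sup>2 + 2 * ?l * ?d" if y: "y \<in> {0..?l}" for y
    proof -
      have "(u e x)\<^sup>2 \<le> 2 * (u e y)\<^sup>2 + 2 * (u e x - u e y)\<^sup>2"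
      proof -
        \<comment> \<open>With a = u e x and b = u e y: 2 b^2 + 2 (a - b)^2 - a^2 = (a - 2
          b)^2.\<close>
        have "0 \<le> (u e x - 2 * u e y)\<^sup>2" by simp
        then show ?thesis by (simp add: power2_eq_square algebra_simps)
      qed
      also have "(u e x - u e y)\<^sup>2 \<le> ?l * ?d"
        using edge_oscillation_length[OF u e x y] .
      finally show ?thesis by simp
    qed
    have i2: "integrable (edge_measure ?l) (\<lambda>y. (u e y)\<^sup>2)"
      using edge_continuous_L2[OF H1_edge_continuous[OF u] e] by (rule L2_square_integrable)
    have ic: "integrable (edge_measure ?l) (\<lambda>y. c)" for c :: real
      by (rule continuous_imp_integrable_real) simp
    have "(\<integral>y. (u e x)\<^sup>2 \<partial>edge_measure ?l) \<le> (\<integral>y. 2 * (u e y)\<^sup>2 + 2 * ?l * ?d \<partial>edge_measure ?l)"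
      using i2 pt by (intro Bochner_Integration.integral_mono Bochner_Integration.integrable_add ic) auto
    also have "\<dots> = 2 * (\<integral>y. (u e y)\<^sup>2 \<partial>edge_measure ?l) + ?l * (2 * ?l * ?d)"
      using i2 ic l by (simp add: measure_restrict_space)
    also have "(\<integral>y. (u e x)\<^sup>2 \<partial>edge_measure ?l) = ?l * (u e x)\<^sup>2"
      using l by (simp add: measure_restrict_space)
    finally have "?l * (u e x)\<^sup>2 \<le> 2 * ?i + ?l * (2 * ?l * ?d)"
      using edge_inner_L2_le[OF e, of u] by linarith
    then have "(u e x)\<^sup>2 \<le> (2 / ?l) * ?i + 2 * ?l * ?d" using l by (simp add: field_simps)
    also have "\<dots> \<le> (2 / ?l + 2 * ?l) * ?i + (2 / ?l + 2 * ?l) * ?d"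
      using l inner_L2_nonneg dirichlet_nonneg by (intro add_mono mult_right_mono) auto
    also have "\<dots> = (2 / ?l + 2 * ?l) * (?d + ?i)" by (simp add: algebra_simps)
    also have "\<dots> \<le> C * (?d + ?i)"
    proof (intro mult_right_mono)
      show "2 / ?l + 2 * ?l \<le> C"
        unfolding C_def using member_le_sum[of e "arcs G" "\<lambda>e. 2 / len e + 2 * len e"] e nn by force
    qed (use inner_L2_nonneg dirichlet_nonneg in auto)
    finally show ?thesis .
  qed
  ultimately show ?thesis using that by blast
qed

text \<open>Connectedness enters here: along a path in the symmetrised graph each edge contributes
  sqrt (len e), so K depends on the path but not on u. Quantifying over the vertex function c avoids
  choosing one for each u.\<close>

lemma vertex_oscillation:
  assumes "a \<in> verts G" "b \<in> verts G"
  shows "\<exists>K. \<forall>u\<in>H1. \<forall>c. (\<forall>e\<in>arcs G. u e 0 = c (tail G e) \<and> u e (len e) = c (head G e))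
    \<longrightarrow> \<bar>c a - c b\<bar> \<le> K * sqrt (dirichlet u u)"
proof -
  interpret S: pair_wf_digraph "mk_symmetric G" by (rule wellformed_mk_symmetric)
  have "a \<rightarrow>\<^sup>*\<^bsub>mk_symmetric G\<^esub> b"
    using connected assms unfolding Digraph_Component.connected_def strongly_connected_def by auto
  then show ?thesis
  proof (induction rule: S.reachable_induct)
    case base
    show ?case by (intro exI[of _ 0]) auto
  next
    case (step x y)
    then obtain K where K: "\<forall>u\<in>H1. \<forall>c. (\<forall>e\<in>arcs G. u e 0 = c (tail G e) \<and> u e (len e) = c (head G e))
      \<longrightarrow> \<bar>c a - c x\<bar> \<le> K * sqrt (dirichlet u u)" by blast
    have "(x, y) \<in> parcs (mk_symmetric G)"
      using step.hyps(2) by (simp add: arcs_ends_def arc_to_ends_def)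
    \<comment> \<open>An arc of the symmetrised graph is an edge traversed in either
      direction.\<close>
    then obtain e where e: "e \<in> arcs G" "(x = tail G e \<and> y = head G e) \<or> (x = head G e \<and> y = tail G e)"
      by (auto simp: mk_symmetric_def)
    show ?case
    proof (intro exI[of _ "K + sqrt (len e)"] ballI allI impI)
      fix u c assume u: "u \<in> H1" and c: "\<forall>e\<in>arcs G. u e 0 = c (tail G e) \<and> u e (len e) = c (head G e)"
      have "\<bar>c x - c y\<bar> \<le> sqrt (len e) * sqrt (dirichlet u u)"
        using edge_oscillation[OF u e(1), of 0 "len e"] len_pos[OF e(1)] e c by (auto simp: abs_minus_commute)
      moreover have "\<bar>c a - c x\<bar> \<le> K * sqrt (dirichlet u u)" using K u c by blast
      ultimately show "\<bar>c a - c y\<bar> \<le> (K + sqrt (len e)) * sqrt (dirichlet u u)"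
        by (simp add: distrib_right)
    qed
  qed
qed

lemma oscillation:
  assumes "e \<in> arcs G" "x \<in> {0..len e}" "e' \<in> arcs G" "y \<in> {0..len e'}"
  shows "\<exists>K. \<forall>u\<in>H1. \<bar>u e x - u e' y\<bar> \<le> K * sqrt (dirichlet u u)"
proof -
  obtain K where K: "\<forall>u\<in>H1. \<forall>c. (\<forall>e\<in>arcs G. u e 0 = c (tail G e) \<and> u e (len e) = c (head G e))
    \<longrightarrow> \<bar>c (tail G e) - c (tail G e')\<bar> \<le> K * sqrt (dirichlet u u)"
    using vertex_oscillation[of "tail G e" "tail G e'"] assms by auto
  show ?thesis
  proof (intro exI[of _ "sqrt (len e) + K + sqrt (len e')"] ballI)
    fix u assume u: "u \<in> H1"
    obtain c where c: "\<forall>e\<in>arcs G. u e 0 = c (tail G e) \<and> u e (len e) = c (head G e)"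
      by (rule H1_vertex[OF u])
    have "\<bar>u e 0 - u e' 0\<bar> \<le> K * sqrt (dirichlet u u)" using K u c assms by auto
    moreover have "\<bar>u e x - u e 0\<bar> \<le> sqrt (len e) * sqrt (dirichlet u u)"
      "\<bar>u e' y - u e' 0\<bar> \<le> sqrt (len e') * sqrt (dirichlet u u)"
      using assms by (auto intro!: edge_oscillation u)
    ultimately show "\<bar>u e x - u e' y\<bar> \<le> (sqrt (len e) + K + sqrt (len e')) * sqrt (dirichlet u u)"
      by (simp add: distrib_right)
  qed
qed

section \<open>Compactness and strong limits in H^1\<close>

text \<open>Arzela-Ascoli on one edge after the other, refining the subsequence by induction over
  the finite edge set. The limit is so far only continuous on each edge; that it lies in H^1 needs
  convergence of the derivatives.\<close>

lemma bounded_subsequence_converges: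
  fixes u :: "nat \<Rightarrow> 'e graph_fun"
  assumes u: "\<And>n. u n \<in> H1" and bound: "\<And>n. dirichlet (u n) (u n) + inner_L2 (u n) (u n) \<le> M"
  obtains r g where "strict_mono (r :: nat \<Rightarrow> nat)" "edge_continuous g"
    "\<And>e x. \<not> (e \<in> arcs G \<and> x \<in> {0..len e}) \<Longrightarrow> g e x = 0"
    "\<And>\<delta>. \<delta> > 0 \<Longrightarrow> \<exists>N. \<forall>n\<ge>N. close \<delta> (u (r n)) g"
proof -
  obtain C where C: "C > 0"
    "\<And>u e x. u \<in> H1 \<Longrightarrow> e \<in> arcs G \<Longrightarrow> x \<in> {0..len e} \<Longrightarrow> (u e x)\<^sup>2 \<le> C * (dirichlet u u + inner_L2 u u)"
    using sup_bound by blast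
  have dM: "dirichlet (u n) (u n) \<le> M" for n using bound[of n] inner_L2_nonneg[of "u n"] by linarith
  have M0: "0 \<le> M" using dM[of 0] dirichlet_nonneg[of "u 0"] by linarith
  have uM: "\<bar>u n e x\<bar> \<le> sqrt (C * M)" if "e \<in> arcs G" "x \<in> {0..len e}" for n e x
  proof -
    have "(u n e x)\<^sup>2 \<le> C * (dirichlet (u n) (u n) + inner_L2 (u n) (u n))" using C(2)[OF u that] .
    also have "\<dots> \<le> C * M" using bound[of n] C(1) by (intro mult_left_mono) auto
    finally have "sqrt ((u n e x)\<^sup>2) \<le> sqrt (C * M)" by (rule real_sqrt_le_mono)
    then show ?thesis by simp
  qed
  have "\<exists>r g. strict_mono (r :: nat \<Rightarrow> nat) \<and> (\<forall>e\<in>A. continuous_on {0..len e} (g e) \<and>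
      (\<forall>\<delta>>0. \<exists>N. \<forall>n\<ge>N. \<forall>x\<in>{0..len e}. \<bar>u (r n) e x - g e x\<bar> < \<delta>))" if "A \<subseteq> arcs G" for A
    using finite_subset[OF that finite_arcs] that
  proof (induction A rule: finite_induct)
    case empty
    show ?case by (intro exI[of _ id]) (simp add: strict_mono_def)
  next
    case (insert e A)
    then obtain r g where r: "strict_mono (r :: nat \<Rightarrow> nat)"
      and g: "\<forall>e\<in>A. continuous_on {0..len e} (g e) \<and>
        (\<forall>\<delta>>0. \<exists>N. \<forall>n\<ge>N. \<forall>x\<in>{0..len e}. \<bar>u (r n) e x - g e x\<bar> < \<delta>)" by auto
    have e: "e \<in> arcs G" using insert by auto
    obtain h k where h: "continuous_on {0..len e} h" "strict_mono (k :: nat \<Rightarrow> nat)"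
      "\<And>\<delta>. 0 < \<delta> \<Longrightarrow> \<exists>N. \<forall>n x. n \<ge> N \<and> x \<in> {0..len e} \<longrightarrow> norm (u (r (k n)) e x - h x) < \<delta>"
    proof (rule Arzela_Ascoli[of "{0..len e}" "\<lambda>n x. u (r n) e x" "sqrt (C * M)"])
      fix x \<delta> :: real assume x: "x \<in> {0..len e}" and "\<delta> > 0"
      show "\<exists>d. 0 < d \<and> (\<forall>n y. y \<in> {0..len e} \<and> norm (x - y) < d \<longrightarrow> norm (u (r n) e x - u (r n) e y) < \<delta>)"
      \<comment> \<open>The squared oscillation is at most |x - y| * M, so this radius keeps it
        below \<delta>^2; M + 1 avoids dividing by zero.\<close>
      proof (intro exI[of _ "\<delta>\<^sup>2 / (M + 1)"] conjI allI impI)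
        show "0 < \<delta>\<^sup>2 / (M + 1)" using \<open>\<delta> > 0\<close> M0 by simp
        fix n y assume y: "y \<in> {0..len e} \<and> norm (x - y) < \<delta>\<^sup>2 / (M + 1)"
        have "(u (r n) e x - u (r n) e y)\<^sup>2 \<le> \<bar>x - y\<bar> * dirichlet (u (r n)) (u (r n))"
          using edge_oscillation_sq[OF u e x] y by blast
        also have "\<dots> \<le> \<bar>x - y\<bar> * (M + 1)" using dM[of "r n"] by (intro mult_left_mono) auto
        also have "\<dots> < \<delta>\<^sup>2" using y M0 by (simp add: pos_less_divide_eq)
        finally show "norm (u (r n) e x - u (r n) e y) < \<delta>"
          using \<open>\<delta> > 0\<close> by (metis abs_le_square_iff abs_of_pos not_less real_norm_def)
      qed
    qed (use uM[OF e] in auto)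
    have "strict_mono (r \<circ> k)" using r h(2) by (rule strict_mono_o)
    moreover have "\<exists>N. \<forall>n\<ge>N. \<forall>x\<in>{0..len e'}. \<bar>u ((r \<circ> k) n) e' x - (g(e := h)) e' x\<bar> < \<delta>"
      if e': "e' \<in> insert e A" and \<delta>: "\<delta> > 0" for e' \<delta>
    proof (cases "e' = e")
      case True
      obtain N where "\<forall>n x. n \<ge> N \<and> x \<in> {0..len e} \<longrightarrow> norm (u (r (k n)) e x - h x) < \<delta>"
        using h(3)[OF \<delta>] by blast
      then show ?thesis using True by (intro exI[of _ N]) auto
    next
      case False
      then obtain N where "\<forall>n\<ge>N. \<forall>x\<in>{0..len e'}. \<bar>u (r n) e' x - g e' x\<bar> < \<delta>" using g e' \<delta> by blast
      then show ?thesis using seq_suble[OF h(2)] False by (intro exI[of _ N]) (auto intro: order_trans)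
    qed
    moreover have "continuous_on {0..len e'} ((g(e := h)) e')" if "e' \<in> insert e A" for e'
      using g h(1) that by auto
    ultimately show ?case by (intro exI[of _ "r \<circ> k"] exI[of _ "g(e := h)"] conjI ballI allI impI)
  qed
  from this[of "arcs G"] obtain r g where r: "strict_mono (r :: nat \<Rightarrow> nat)"
    and g: "\<forall>e\<in>arcs G. continuous_on {0..len e} (g e) \<and>
      (\<forall>\<delta>>0. \<exists>N. \<forall>n\<ge>N. \<forall>x\<in>{0..len e}. \<bar>u (r n) e x - g e x\<bar> < \<delta>)" by auto
  define h where "h e x = (if e \<in> arcs G \<and> x \<in> {0..len e} then g e x else 0)" for e x
  show ?thesis
  proof (rule that[OF r])
    show "edge_continuous h" unfolding edge_continuous_def
    proof
      fix e assume "e \<in> arcs G"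
      then show "continuous_on {0..len e} (h e)"
        using g by (intro continuous_on_eq[of _ "g e" "h e"]) (auto simp: h_def)
    qed
    show "\<not> (e \<in> arcs G \<and> x \<in> {0..len e}) \<Longrightarrow> h e x = 0" for e x by (auto simp: h_def)
    fix \<delta> :: real assume \<delta>: "\<delta> > 0"
    then have "\<forall>e\<in>arcs G. \<exists>N. \<forall>n\<ge>N. \<forall>x\<in>{0..len e}. \<bar>u (r n) e x - g e x\<bar> < \<delta>" using g by blast
    from bchoice[OF this] obtain N
      where N: "\<forall>e\<in>arcs G. \<forall>n\<ge>N e. \<forall>x\<in>{0..len e}. \<bar>u (r n) e x - g e x\<bar> < \<delta>" by blast
    show "\<exists>N. \<forall>n\<ge>N. close \<delta> (u (r n)) h"
    \<comment> \<open>The sum of the thresholds dominates each of them.\<close>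
    proof (intro exI[of _ "\<Sum>e\<in>arcs G. N e"] allI impI)
      fix n assume n: "(\<Sum>e\<in>arcs G. N e) \<le> n"
      have "N e \<le> n" if "e \<in> arcs G" for e using member_le_sum[of e "arcs G" N] that n by auto
      then show "close \<delta> (u (r n)) h" unfolding close_def using N by (auto simp: h_def intro!: less_imp_le)
    qed
  qed
qed

text \<open>On each edge the derivatives converge in L^2 by completeness. Passing to the limit in
  u_n(x) - u_n(0) = \<integral> D u_n over [0, x] identifies their limit as the derivative of
  g.\<close>

lemma strong_limit:
  fixes u :: "nat \<Rightarrow> 'e graph_fun"
  assumes u: "\<And>n. u n \<in> H1"
    and outside: "\<And>e x. \<not> (e \<in> arcs G \<and> x \<in> {0..len e}) \<Longrightarrow> g e x = 0"
    and unif: "\<And>\<delta>. \<delta> > 0 \<Longrightarrow> \<exists>N. \<forall>n\<ge>N. close \<delta> (u n) g"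
    and Cauchy: "\<And>\<epsilon>. \<epsilon> > 0 \<Longrightarrow> \<exists>N. \<forall>m\<ge>N. \<forall>n\<ge>N. dirichlet (u m - u n) (u m - u n) \<le> \<epsilon>"
  shows "g \<in> H1" and "\<And>\<epsilon>. \<epsilon> > 0 \<Longrightarrow> \<exists>N. \<forall>n\<ge>N. dirichlet (u n - g) (u n - g) \<le> \<epsilon>"
proof -
  have Ddiff: "AE x in edge_measure (len e). D (v - w) e x = D v e x - D w e x"
    if "v \<in> H1" "w \<in> H1" "e \<in> arcs G" for v w e
    using D_linear_combination[OF that, of 1 "-1"] by simp
  have int_eq: "(\<integral>x. (D (v - w) e x)\<^sup>2 \<partial>edge_measure (len e)) = (\<integral>x. (D v e x - D w e x)\<^sup>2 \<partial>edge_measure (len e))"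
    if "v \<in> H1" "w \<in> H1" "e \<in> arcs G" for v w e
  proof (rule integral_cong_AE)
    have [measurable]: "D (v - w) e \<in> borel_measurable (edge_measure (len e))"
      "D v e \<in> borel_measurable (edge_measure (len e))" "D w e \<in> borel_measurable (edge_measure (len e))"
      using that by (auto intro!: L2_measurable D_L2 H1_diff)
    show "(\<lambda>x. (D (v - w) e x)\<^sup>2) \<in> borel_measurable (edge_measure (len e))"
      "(\<lambda>x. (D v e x - D w e x)\<^sup>2) \<in> borel_measurable (edge_measure (len e))" by measurable
    show "AE x in edge_measure (len e). (D (v - w) e x)\<^sup>2 = (D v e x - D w e x)\<^sup>2"
      using Ddiff[OF that] by eventually_elim simp
  qed
  have ptlim: "(\<lambda>n. u n e x) \<longlonglongrightarrow> g e x" if "e \<in> arcs G" "x \<in> {0..len e}" for e x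
  proof (rule LIMSEQ_I)
    fix r :: real assume "r > 0"
    then obtain N where "\<forall>n\<ge>N. close (r/2) (u n) g" using unif[of "r/2"] by auto
    then have "\<forall>n\<ge>N. \<bar>u n e x - g e x\<bar> \<le> r/2" using that by (auto simp: close_def)
    then show "\<exists>N. \<forall>n\<ge>N. norm (u n e x - g e x) < r" using \<open>r > 0\<close>
      by (intro exI[of _ N]) (auto intro: le_less_trans)
  qed
  have "\<exists>h. has_L2_deriv (len e) (g e) h \<and> (\<forall>\<epsilon>>0. \<exists>N. \<forall>n\<ge>N. (\<integral>x. (h x - D (u n) e x)\<^sup>2 \<partial>edge_measure (len e)) \<le> \<epsilon>)"
    if e: "e \<in> arcs G" for e
  proof -
    let ?M = "edge_measure (len e)"
    have l: "len e > 0" using len_pos[OF e] .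
    obtain h where h: "h \<in> borel_measurable ?M" "integrable ?M (\<lambda>x. (h x)\<^sup>2)"
      "\<And>\<epsilon>. \<epsilon> > 0 \<Longrightarrow> \<exists>N. \<forall>n\<ge>N. (\<integral>x. (h x - D (u n) e x)\<^sup>2 \<partial>?M) \<le> \<epsilon>"
    proof (rule L2_complete[of "\<lambda>n. D (u n) e" ?M])
      show "D (u n) e \<in> borel_measurable ?M" "integrable ?M (\<lambda>x. (D (u n) e x)\<^sup>2)" for n
        using D_L2[OF u e] by (auto dest: L2_measurable L2_square_integrable)
      show "finite_measure ?M" by (rule finite_measure_lebesgue_on) simp
      fix \<epsilon> :: real assume "\<epsilon> > 0"
      then obtain N where N: "\<forall>m\<ge>N. \<forall>n\<ge>N. dirichlet (u m - u n) (u m - u n) \<le> \<epsilon>" using Cauchy by blast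
      show "\<exists>N. \<forall>m\<ge>N. \<forall>n\<ge>N. (\<integral>x. (D (u m) e x - D (u n) e x)\<^sup>2 \<partial>?M) \<le> \<epsilon>"
      proof (intro exI[of _ N] allI impI)
        fix m n assume "N \<le> m" "N \<le> n"
        then have "dirichlet (u m - u n) (u m - u n) \<le> \<epsilon>" using N by blast
        then show "(\<integral>x. (D (u m) e x - D (u n) e x)\<^sup>2 \<partial>?M) \<le> \<epsilon>"
          using edge_dirichlet_le[OF H1_diff[OF u u] e, of m n] int_eq[OF u u e, of m n] by linarith
      qed
    qed blast
    have hL2: "h \<in> L2_interval (len e)" using h(1,2) by (simp add: L2_interval_def)
    have "g e x - g e 0 = (\<integral>t. h t \<partial>edge_measure x)" if x: "x \<in> {0..len e}" for x
    proof (rule LIMSEQ_unique)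
      show "(\<lambda>n. u n e x - u n e 0) \<longlonglongrightarrow> g e x - g e 0"
        using x l by (intro tendsto_diff ptlim e) auto
      show "(\<lambda>n. u n e x - u n e 0) \<longlonglongrightarrow> (\<integral>t. h t \<partial>edge_measure x)"
      proof (rule LIMSEQ_I)
        fix r :: real assume "r > 0"
        \<comment> \<open>The Hoelder estimate multiplies this bound by x, and x * r^2 / (2 * (x +
          1)) < r^2.\<close>
        obtain N where N: "\<forall>n\<ge>N. (\<integral>t. (h t - D (u n) e t)\<^sup>2 \<partial>?M) \<le> r\<^sup>2 / (2 * (x + 1))"
          using h(3)[of "r\<^sup>2 / (2 * (x + 1))"] \<open>r > 0\<close> x by auto
        have "norm (u n e x - u n e 0 - (\<integral>t. h t \<partial>edge_measure x)) < r" if "n \<ge> N" for n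
        proof -
          have dL2: "(\<lambda>t. h t - D (u n) e t) \<in> L2_interval (len e)" by (intro L2_diff hL2 D_L2 u e)
          have "has_L2_deriv (len e) (\<lambda>y. 0 + (\<integral>t. h t - D (u n) e t \<partial>edge_measure y)) (\<lambda>t. h t - D (u n) e t)"
            using dL2 by (rule has_L2_deriv_primitive)
          from has_L2_deriv_Holder[OF this, of 0 x] has_L2_deriv_increment[OF this, of 0 x]
          have "(\<integral>t. h t - D (u n) e t \<partial>edge_measure x)\<^sup>2 \<le> x * (\<integral>t. (h t - D (u n) e t)\<^sup>2 \<partial>?M)"
            using x by simp
          also have "\<dots> \<le> x * (r\<^sup>2 / (2 * (x + 1)))" using N that x by (intro mult_left_mono) auto
          also have "\<dots> < r\<^sup>2" using x \<open>r > 0\<close> by (simp add: field_simps) (smt (verit) mult_nonneg_nonneg zero_less_power2)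
          finally have "\<bar>\<integral>t. h t - D (u n) e t \<partial>edge_measure x\<bar> < r"
            using \<open>r > 0\<close> by (metis abs_le_square_iff abs_of_pos not_less)
          moreover have "(\<integral>t. h t - D (u n) e t \<partial>edge_measure x)
              = (\<integral>t. h t \<partial>edge_measure x) - (\<integral>t. D (u n) e t \<partial>edge_measure x)"
            using x by (intro Bochner_Integration.integral_diff L2_integrable_subinterval[OF hL2]
              L2_integrable_subinterval[OF D_L2[OF u e]]) auto
          moreover have "u n e x - u n e 0 = (\<integral>t. D (u n) e t \<partial>edge_measure x)"
            using has_L2_deriv_increment[OF H1_edge[OF u e], of 0 x] x by simp
          ultimately show ?thesis by simp
        qed
        then show "\<exists>N. \<forall>n\<ge>N. norm (u n e x - u n e 0 - (\<integral>t. h t \<partial>edge_measure x)) < r" by blast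
      qed
    qed
    then have "has_L2_deriv (len e) (g e) h" using hL2 by (simp add: has_L2_deriv_def)
    then show ?thesis using h(3) by blast
  qed
  then obtain h where h: "\<And>e. e \<in> arcs G \<Longrightarrow> has_L2_deriv (len e) (g e) (h e)"
    and hlim: "\<And>e \<epsilon>. e \<in> arcs G \<Longrightarrow> \<epsilon> > 0 \<Longrightarrow> \<exists>N. \<forall>n\<ge>N. (\<integral>x. (h e x - D (u n) e x)\<^sup>2 \<partial>edge_measure (len e)) \<le> \<epsilon>"
    by metis
  obtain c where c: "\<And>n. \<forall>e\<in>arcs G. u n e 0 = c n (tail G e) \<and> u n e (len e) = c n (head G e)"
  proof -
    have "\<exists>c. \<forall>e\<in>arcs G. u n e 0 = c (tail G e) \<and> u n e (len e) = c (head G e)" for n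
      by (rule H1_vertex[OF u[of n]]) blast
    then show ?thesis using that by metis
  qed
  \<comment> \<open>At an endpoint of an edge the limit exists by pointwise convergence; at a vertex
    without edges \<open>lim\<close> may be any value, and no condition is read there.\<close>
  define d where "d v = lim (\<lambda>n. c n v)" for v
  have "g e 0 = d (tail G e)" "g e (len e) = d (head G e)" if e: "e \<in> arcs G" for e
    using ptlim[OF e, of 0] ptlim[OF e, of "len e"] len_pos[OF e] c e by (auto simp: d_def limI)
  then show g: "g \<in> H1" by (intro H1_I[where c=d, OF h] outside)
  fix \<epsilon> :: real assume \<epsilon>: "\<epsilon> > 0"
  define k where "k = real (card (arcs G)) + 1"
  have "\<epsilon> / k > 0" using \<epsilon> by (simp add: k_def)
  then have "\<forall>e\<in>arcs G. \<exists>N. \<forall>n\<ge>N. (\<integral>x. (h e x - D (u n) e x)\<^sup>2 \<partial>edge_measure (len e)) \<le> \<epsilon> / k"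
    by (intro ballI hlim)
  from bchoice[OF this] obtain N
    where N: "\<forall>e\<in>arcs G. \<forall>n\<ge>N e. (\<integral>x. (h e x - D (u n) e x)\<^sup>2 \<partial>edge_measure (len e)) \<le> \<epsilon> / k"
    by blast
  show "\<exists>N. \<forall>n\<ge>N. dirichlet (u n - g) (u n - g) \<le> \<epsilon>"
  proof (intro exI[of _ "\<Sum>e\<in>arcs G. N e"] allI impI)
    fix n assume n: "(\<Sum>e\<in>arcs G. N e) \<le> n"
    have "(\<integral>x. (D (u n - g) e x)\<^sup>2 \<partial>edge_measure (len e)) \<le> \<epsilon> / k" if e: "e \<in> arcs G" for e
    proof -
      have "N e \<le> n" using member_le_sum[of e "arcs G" N] that n by auto
      have "(\<integral>x. (D (u n - g) e x)\<^sup>2 \<partial>edge_measure (len e))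
          = (\<integral>x. (h e x - D (u n) e x)\<^sup>2 \<partial>edge_measure (len e))"
      proof (rule integral_cong_AE)
        have [measurable]: "D (u n - g) e \<in> borel_measurable (edge_measure (len e))"
          "D (u n) e \<in> borel_measurable (edge_measure (len e))" "h e \<in> borel_measurable (edge_measure (len e))"
          using u g e by (auto intro!: L2_measurable D_L2 H1_diff has_L2_derivD[OF h])
        show "(\<lambda>x. (D (u n - g) e x)\<^sup>2) \<in> borel_measurable (edge_measure (len e))"
          "(\<lambda>x. (h e x - D (u n) e x)\<^sup>2) \<in> borel_measurable (edge_measure (len e))" by measurable
        show "AE x in edge_measure (len e). (D (u n - g) e x)\<^sup>2 = (h e x - D (u n) e x)\<^sup>2"
          using Ddiff[OF u g e, of n] D_unique[where u=g and g="h e", OF e h[OF e]]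
          by eventually_elim (simp add: power2_commute)
      qed
      then show ?thesis using N e \<open>N e \<le> n\<close> by simp
    qed
    then have "dirichlet (u n - g) (u n - g) \<le> (\<Sum>e\<in>arcs G. \<epsilon> / k)"
      unfolding dirichlet_def graph_integral_def by (intro sum_mono) (simp add: power2_eq_square)
    also have "\<dots> = \<epsilon> * (real (card (arcs G)) / k)" by simp
    also have "\<dots> \<le> \<epsilon> * 1" using \<epsilon> by (intro mult_left_mono) (auto simp: k_def)
    finally show "dirichlet (u n - g) (u n - g) \<le> \<epsilon>" by simp
  qed
qed


section \<open>Continuity of integral functionals and the direct method\<close>

definition total_length :: real where "total_length = (\<Sum>e\<in>arcs G. len e)"

lemma total_length_nonneg: "0 \<le> total_length"
  unfolding total_length_def by (intro sum_nonneg) (simp add: len_pos less_imp_le)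

lemma gint_bound:
  assumes f: "gintegrable f" and K: "\<And>e. e \<in> arcs G \<Longrightarrow> AE x in edge_measure (len e). \<bar>f e x\<bar> \<le> K"
  shows "\<bar>gint f\<bar> \<le> K * total_length"
proof -
  have "\<bar>\<integral>x. f e x \<partial>edge_measure (len e)\<bar> \<le> K * len e" if e: "e \<in> arcs G" for e
  proof -
    have "\<bar>\<integral>x. f e x \<partial>edge_measure (len e)\<bar> \<le> (\<integral>x. \<bar>f e x\<bar> \<partial>edge_measure (len e))"
      by (rule integral_abs_bound)
    also have "\<dots> \<le> (\<integral>x. K \<partial>edge_measure (len e))"
      using f e K[OF e] by (intro integral_mono_AE)
        (auto simp: gintegrable_def intro: continuous_imp_integrable_real)
    also have "\<dots> = K * len e" using len_pos[OF e] by (simp add: measure_restrict_space)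
    finally show ?thesis .
  qed
  then have "(\<Sum>e\<in>arcs G. \<bar>\<integral>x. f e x \<partial>edge_measure (len e)\<bar>) \<le> K * total_length"
    unfolding total_length_def sum_distrib_left by (rule sum_mono)
  then show ?thesis unfolding graph_integral_def by (rule order_trans[OF sum_abs])
qed

text \<open>F is uniformly continuous on an interval one unit larger than the range of u. Since
  \<delta> \<le> 1, functions close to u stay in that interval.\<close>

lemma nemytskii_continuous:
  assumes b: "b \<in> graph_Linfty G len" and F: "continuous_on UNIV F" and u: "edge_continuous u" and "\<epsilon> > 0"
  obtains \<delta> where "\<delta> > 0" "\<And>v. edge_continuous v \<Longrightarrow> close \<delta> v u
    \<Longrightarrow> \<bar>gint (\<lambda>e x. b e x * F (v e x)) - gint (\<lambda>e x. b e x * F (u e x))\<bar> \<le> \<epsilon>"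
proof -
  obtain M where M: "M > 0" "\<And>e x. e \<in> arcs G \<Longrightarrow> x \<in> {0..len e} \<Longrightarrow> \<bar>u e x\<bar> \<le> M"
    by (rule edge_continuous_bound[OF u]) blast
  obtain C where C: "C > 0" "\<And>e. e \<in> arcs G \<Longrightarrow> AE x in edge_measure (len e). \<bar>b e x\<bar> \<le> C"
    by (rule Linfty_bound[OF b]) blast
  \<comment> \<open>Integration costs a factor C * total_length; the added 1 keeps the denominator
    positive.\<close>
  define \<eta> where "\<eta> = \<epsilon> / (C * (total_length + 1))"
  have "\<eta> > 0" using \<open>\<epsilon> > 0\<close> C(1) total_length_nonneg by (simp add: \<eta>_def)
  have "uniformly_continuous_on {-M-1..M+1} F"
    using F by (intro compact_uniformly_continuous) (auto intro: continuous_on_subset)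
  then obtain d where d: "d > 0" "\<And>x y. x \<in> {-M-1..M+1} \<Longrightarrow> y \<in> {-M-1..M+1} \<Longrightarrow> dist y x < d \<Longrightarrow> dist (F y) (F x) < \<eta>"
    using \<open>\<eta> > 0\<close> unfolding uniformly_continuous_on_def by metis
  define \<delta> where "\<delta> = min 1 (d / 2)"
  have "\<delta> > 0" using d(1) by (simp add: \<delta>_def)
  moreover have "\<bar>gint (\<lambda>e x. b e x * F (v e x)) - gint (\<lambda>e x. b e x * F (u e x))\<bar> \<le> \<epsilon>"
    if v: "edge_continuous v" and "close \<delta> v u" for v
  proof -
    have int: "gintegrable (\<lambda>e x. b e x * F (w e x))" if "edge_continuous w" for w
      by (intro Linfty_integrable Linfty_mult b compose_Linfty[OF that F])
    have Fc: "\<bar>F (v e x) - F (u e x)\<bar> \<le> \<eta>" if e: "e \<in> arcs G" and x: "x \<in> {0..len e}" for e x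
    proof -
      have c: "\<bar>v e x - u e x\<bar> \<le> \<delta>" using \<open>close \<delta> v u\<close> e x by (simp add: close_def)
      then have "\<bar>v e x - u e x\<bar> \<le> 1" "\<bar>v e x - u e x\<bar> \<le> d / 2" by (auto simp: \<delta>_def)
      then have "dist (F (v e x)) (F (u e x)) < \<eta>"
        using d(1) M(2)[OF e x] by (intro d(2)) (auto simp: dist_real_def)
      then show ?thesis by (simp add: dist_real_def)
    qed
    have "gint (\<lambda>e x. b e x * F (v e x)) - gint (\<lambda>e x. b e x * F (u e x))
        = gint (\<lambda>e x. b e x * F (v e x) - b e x * F (u e x))"
      using int[OF v] int[OF u] by (simp add: gint_diff)
    moreover have "\<bar>gint (\<lambda>e x. b e x * F (v e x) - b e x * F (u e x))\<bar> \<le> (C * \<eta>) * total_length"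
    proof (rule gint_bound)
      show "gintegrable (\<lambda>e x. b e x * F (v e x) - b e x * F (u e x))"
        using int[OF v] int[OF u] by (rule gintegrable_diff)
      fix e assume e: "e \<in> arcs G"
      show "AE x in edge_measure (len e). \<bar>b e x * F (v e x) - b e x * F (u e x)\<bar> \<le> C * \<eta>"
        using C(2)[OF e] AE_space
      proof eventually_elim
        case (elim x)
        have "\<bar>b e x\<bar> * \<bar>F (v e x) - F (u e x)\<bar> \<le> C * \<eta>"
          using elim Fc[OF e] C(1) by (intro mult_mono) auto
        then show ?case by (simp add: right_diff_distrib[symmetric] abs_mult)
      qed
    qed
    moreover have "(C * \<eta>) * total_length \<le> \<epsilon>"
    proof -
      have "(C * \<eta>) * total_length \<le> (C * \<eta>) * (total_length + 1)"
        using C(1) \<open>\<eta> > 0\<close> by (intro mult_left_mono) auto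
      also have "\<dots> = \<epsilon>" using C(1) total_length_nonneg by (simp add: \<eta>_def)
      finally show ?thesis .
    qed
    ultimately show ?thesis by linarith
  qed
  ultimately show ?thesis using that by blast
qed

lemma weighted_inner_continuous:
  assumes b: "b \<in> graph_Linfty G len" and u: "edge_continuous u" and "\<epsilon> > 0"
  obtains \<delta> where "\<delta> > 0"
    "\<And>v. edge_continuous v \<Longrightarrow> close \<delta> v u \<Longrightarrow> \<bar>weighted_inner b v v - weighted_inner b u u\<bar> \<le> \<epsilon>"
proof -
  have eq: "gint (\<lambda>e x. b e x * (v e x)\<^sup>2) = weighted_inner b v v" for v
    by (simp add: weighted_inner_def power2_eq_square mult.assoc)
  show ?thesis
    by (rule nemytskii_continuous[OF b _ u \<open>\<epsilon> > 0\<close>, of "\<lambda>x. x\<^sup>2"])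
      (auto intro!: continuous_intros that simp: eq)
qed

lemma close_mono: "close \<delta> u v \<Longrightarrow> \<delta> \<le> \<delta>' \<Longrightarrow> close \<delta>' u v"
  unfolding close_def by (meson order_trans)

lemma close_average:
  assumes "close \<delta> u w" "close \<delta> v w"
  shows "close \<delta> ((1/2) *\<^sub>R u + (1/2) *\<^sub>R v) w"
  unfolding close_def
proof (intro ballI)
  fix e x assume "e \<in> arcs G" "x \<in> {0..len e}"
  then have "\<bar>u e x - w e x\<bar> \<le> \<delta>" "\<bar>v e x - w e x\<bar> \<le> \<delta>" using assms by (auto simp: close_def)
  then show "\<bar>((1/2) *\<^sub>R u + (1/2) *\<^sub>R v) e x - w e x\<bar> \<le> \<delta>"
    by (simp add: scaleR_fun_def plus_fun_def abs_le_iff)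
qed

lemma weighted_inner_small:
  assumes b: "b \<in> graph_Linfty G len"
  obtains C where "C \<ge> 0"
    "\<And>v \<delta>. edge_continuous v \<Longrightarrow> close \<delta> v 0 \<Longrightarrow> \<delta> \<ge> 0 \<Longrightarrow> \<bar>weighted_inner b v v\<bar> \<le> C * \<delta>\<^sup>2"
proof -
  obtain C where C: "C > 0" "\<And>e. e \<in> arcs G \<Longrightarrow> AE x in edge_measure (len e). \<bar>b e x\<bar> \<le> C"
    by (rule Linfty_bound[OF b]) blast
  have "\<bar>weighted_inner b v v\<bar> \<le> (C * total_length) * \<delta>\<^sup>2"
    if v: "edge_continuous v" and "close \<delta> v 0" "\<delta> \<ge> 0" for v \<delta>
  proof -
    have "\<bar>weighted_inner b v v\<bar> \<le> (C * \<delta>\<^sup>2) * total_length"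
      unfolding weighted_inner_def
    proof (rule gint_bound[OF weighted_integrable[OF b v v]])
      fix e assume e: "e \<in> arcs G"
      show "AE x in edge_measure (len e). \<bar>b e x * v e x * v e x\<bar> \<le> C * \<delta>\<^sup>2"
        using C(2)[OF e] AE_space
      proof eventually_elim
        case (elim x)
        have "\<bar>v e x\<bar> \<le> \<delta>" using \<open>close \<delta> v 0\<close> e elim by (auto simp: close_def)
        then have "(v e x)\<^sup>2 \<le> \<delta>\<^sup>2" using \<open>\<delta> \<ge> 0\<close> by (simp add: abs_le_square_iff[symmetric])
        then have "\<bar>b e x\<bar> * (v e x)\<^sup>2 \<le> C * \<delta>\<^sup>2" using elim C(1) by (intro mult_mono) auto
        then show ?case by (simp add: abs_mult power2_eq_square mult.assoc)
      qed
    qed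
    then show ?thesis by (simp add: mult_ac)
  qed
  then show ?thesis using that[of "C * total_length"] C(1) total_length_nonneg by simp
qed

text \<open>Instead of weak compactness, minimising sequences are made strongly convergent by the parallelogram
  identity, since their averages cannot have lower energy.\<close>
lemma minimizing_sequence_limit:
  fixes un :: "nat \<Rightarrow> 'e graph_fun"
  assumes b: "b \<in> graph_Linfty G len" and VH: "V \<subseteq> H1" and un: "\<And>n. un n \<in> V"
    and avg: "\<And>v w. v \<in> V \<Longrightarrow> w \<in> V \<Longrightarrow> (1/2) *\<^sub>R v + (1/2) *\<^sub>R w \<in> V"
    and lower: "\<And>v. v \<in> V \<Longrightarrow> \<Psi> v \<le> energy b v v"
    and lsc: "\<And>\<epsilon>. \<epsilon> > 0 \<Longrightarrow> \<exists>\<delta>>0. \<forall>v\<in>V. close \<delta> v u \<longrightarrow> \<Psi> u - \<epsilon> \<le> \<Psi> v"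
    and upper: "\<And>\<epsilon>. \<epsilon> > 0 \<Longrightarrow> \<exists>N. \<forall>n\<ge>N. energy b (un n) (un n) \<le> \<Psi> u + \<epsilon>"
    and unif: "\<And>\<delta>. \<delta> > 0 \<Longrightarrow> \<exists>N. \<forall>n\<ge>N. close \<delta> (un n) u"
    and outside: "\<And>e x. \<not> (e \<in> arcs G \<and> x \<in> {0..len e}) \<Longrightarrow> u e x = 0"
  shows "u \<in> H1" and "energy b u u \<le> \<Psi> u"
proof -
  have unH: "un n \<in> H1" for n using un VH by auto
  obtain C where C: "C \<ge> 0"
    "\<And>v \<delta>. edge_continuous v \<Longrightarrow> close \<delta> v 0 \<Longrightarrow> \<delta> \<ge> 0 \<Longrightarrow> \<bar>weighted_inner b v v\<bar> \<le> C * \<delta>\<^sup>2"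
    by (rule weighted_inner_small[OF b]) blast
  have Cauchy: "\<exists>N. \<forall>m\<ge>N. \<forall>n\<ge>N. dirichlet (un m - un n) (un m - un n) \<le> \<epsilon>" if "\<epsilon> > 0" for \<epsilon>
  proof -
    \<comment> \<open>Chosen so that C * (2 * \<eta>)^2 \<le> \<epsilon> / 2.\<close>
    define \<eta> where "\<eta> = sqrt (\<epsilon> / (8 * (C + 1)))"
    have \<eta>: "\<eta> > 0" "\<eta>\<^sup>2 = \<epsilon> / (8 * (C + 1))" using \<open>\<epsilon> > 0\<close> C(1) by (auto simp: \<eta>_def)
    obtain \<delta> where \<delta>: "\<delta> > 0" "\<forall>v\<in>V. close \<delta> v u \<longrightarrow> \<Psi> u - \<epsilon> / 16 \<le> \<Psi> v"
      using lsc[of "\<epsilon> / 16"] \<open>\<epsilon> > 0\<close> by auto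
    obtain N1 where N1: "\<forall>n\<ge>N1. energy b (un n) (un n) \<le> \<Psi> u + \<epsilon> / 16" using upper[of "\<epsilon> / 16"] \<open>\<epsilon> > 0\<close> by auto
    obtain N2 where N2: "\<forall>n\<ge>N2. close (min \<delta> \<eta>) (un n) u" using unif[of "min \<delta> \<eta>"] \<delta>(1) \<eta>(1) by auto
    have "dirichlet (un m - un n) (un m - un n) \<le> \<epsilon>" if "m \<ge> max N1 N2" "n \<ge> max N1 N2" for m n
    proof -
      \<comment> \<open>The average lies in V and is close to u, so its energy is almost as large as
        \<Psi> u, which bounds the energies of the two sequence members from above up to \<epsilon>
        / 16.\<close>
      let ?a = "(1/2) *\<^sub>R un m + (1/2) *\<^sub>R un n"
      have cm: "close (min \<delta> \<eta>) (un m) u" and cn: "close (min \<delta> \<eta>) (un n) u" using N2 that by auto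
      have "close \<delta> ?a u" using close_average[OF cm cn] by (rule close_mono) simp
      then have "\<Psi> u - \<epsilon> / 16 \<le> \<Psi> ?a" using \<delta>(2) avg[OF un un, of m n] by blast
      also have "\<dots> \<le> energy b ?a ?a" by (intro lower avg un)
      also have "\<dots> = 1/4 * energy b (un m) (un m) + 1/2 * energy b (un m) (un n) + 1/4 * energy b (un n) (un n)"
        using energy_square[OF b unH unH, of "1/2" m "1/2" n] by (simp add: power2_eq_square)
      finally have a: "4 * \<Psi> u - \<epsilon> / 4
          \<le> energy b (un m) (un m) + 2 * energy b (un m) (un n) + energy b (un n) (un n)" by simp
      \<comment> \<open>Parallelogram identity: twice the sum of the two energies, minus four times
        the energy of the average. The errors \<epsilon> / 16 add up to \<epsilon> / 2.\<close>
      have "energy b (un m - un n) (un m - un n)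
          = energy b (un m) (un m) - 2 * energy b (un m) (un n) + energy b (un n) (un n)"
        using energy_square[OF b unH unH, of 1 m "-1" n] by simp
      also have "\<dots> \<le> \<epsilon> / 2"
      proof -
        have "energy b (un m) (un m) \<le> \<Psi> u + \<epsilon> / 16" "energy b (un n) (un n) \<le> \<Psi> u + \<epsilon> / 16" using N1 that by auto
        then show ?thesis using a by linarith
      qed
      finally have e: "energy b (un m - un n) (un m - un n) \<le> \<epsilon> / 2" .
      \<comment> \<open>The energy may be indefinite, so its zeroth-order part is estimated
        separately from uniform closeness; what remains is the Dirichlet part.\<close>
      have "close (2 * \<eta>) (un m - un n) 0" unfolding close_def
      proof (intro ballI)
        fix e x assume "e \<in> arcs G" "x \<in> {0..len e}"
        then have "\<bar>un m e x - u e x\<bar> \<le> \<eta>" "\<bar>un n e x - u e x\<bar> \<le> \<eta>" using cm cn by (auto simp: close_def)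
        then show "\<bar>(un m - un n) e x - 0 e x\<bar> \<le> 2 * \<eta>" by (simp add: abs_le_iff)
      qed
      then have "\<bar>weighted_inner b (un m - un n) (un m - un n)\<bar> \<le> C * (2 * \<eta>)\<^sup>2"
        using \<eta>(1) by (intro C(2) H1_edge_continuous H1_diff unH) auto
      also have "\<dots> = (C / (C + 1)) * (\<epsilon> / 2)" using \<eta>(2) C(1) by (simp add: power_mult_distrib field_simps)
      also have "\<dots> \<le> 1 * (\<epsilon> / 2)" using C(1) \<open>\<epsilon> > 0\<close> by (intro mult_right_mono) auto
      finally show ?thesis using e unfolding energy_def by linarith
    qed
    then show ?thesis by blast
  qed
  show u: "u \<in> H1" using strong_limit(1)[OF unH outside unif Cauchy] by blast
  have dlim: "\<exists>N. \<forall>n\<ge>N. dirichlet (un n - u) (un n - u) \<le> \<epsilon>" if "\<epsilon> > 0" for \<epsilon>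
    using strong_limit(2)[OF unH outside unif Cauchy that] by blast
  show "energy b u u \<le> \<Psi> u"
  proof (rule field_le_epsilon)
    fix \<epsilon> :: real assume "\<epsilon> > 0"
    define d where "d = dirichlet u u + 1"
    have d: "d > 0" using dirichlet_nonneg[of u] by (simp add: d_def)
    obtain \<delta> where \<delta>: "\<delta> > 0"
      "\<And>v. edge_continuous v \<Longrightarrow> close \<delta> v u \<Longrightarrow> \<bar>weighted_inner b v v - weighted_inner b u u\<bar> \<le> \<epsilon> / 4"
      using weighted_inner_continuous[OF b H1_edge_continuous[OF u], of "\<epsilon> / 4"] \<open>\<epsilon> > 0\<close> by auto
    obtain N1 where N1: "\<forall>n\<ge>N1. energy b (un n) (un n) \<le> \<Psi> u + \<epsilon> / 4" using upper[of "\<epsilon> / 4"] \<open>\<epsilon> > 0\<close> by auto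
    obtain N2 where N2: "\<forall>n\<ge>N2. close \<delta> (un n) u" using unif[OF \<delta>(1)] by auto
    \<comment> \<open>By Cauchy-Schwarz this threshold bounds the mixed Dirichlet term by sqrt d *
      \<epsilon> / (4 * sqrt d) = \<epsilon> / 4.\<close>
    obtain N3 where N3: "\<forall>n\<ge>N3. dirichlet (un n - u) (un n - u) \<le> \<epsilon>\<^sup>2 / (16 * d)"
      using dlim[of "\<epsilon>\<^sup>2 / (16 * d)"] \<open>\<epsilon> > 0\<close> d by auto
    define n where "n = max N1 (max N2 N3)"
    define w where "w = un n - u"
    have w: "w \<in> H1" unfolding w_def by (rule H1_diff[OF unH u])
    have dw: "dirichlet w w \<le> \<epsilon>\<^sup>2 / (16 * d)" using N3 by (simp add: w_def n_def)
    have "dirichlet (un n) (un n) = dirichlet u u + 2 * dirichlet u w + dirichlet w w"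
      using dirichlet_square[OF u w, of 1 1] by (simp add: w_def)
    moreover have "\<bar>dirichlet u w\<bar> \<le> \<epsilon> / 4"
    proof -
      have "\<bar>dirichlet u w\<bar> \<le> sqrt (dirichlet u u) * sqrt (dirichlet w w)"
        by (rule dirichlet_Cauchy_Schwarz[OF u w])
      also have "\<dots> \<le> sqrt d * sqrt (\<epsilon>\<^sup>2 / (16 * d))"
        using dw by (intro mult_mono real_sqrt_le_mono) (auto simp: d_def dirichlet_nonneg)
      also have "\<dots> = sqrt ((\<epsilon> / 4)\<^sup>2)" using d
        by (simp add: real_sqrt_mult[symmetric] power_divide del: real_sqrt_abs)
      finally show ?thesis using \<open>\<epsilon> > 0\<close> by simp
    qed
    ultimately have "dirichlet u u \<le> dirichlet (un n) (un n) + \<epsilon> / 2"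
      using dirichlet_nonneg[of w] by linarith
    moreover have "weighted_inner b u u \<le> weighted_inner b (un n) (un n) + \<epsilon> / 4"
    proof -
      have "close \<delta> (un n) u" using N2 by (simp add: n_def)
      from \<delta>(2)[OF H1_edge_continuous[OF unH] this] show ?thesis by linarith
    qed
    moreover have "energy b (un n) (un n) \<le> \<Psi> u + \<epsilon> / 4" using N1 by (simp add: n_def)
    ultimately show "energy b u u \<le> \<Psi> u + \<epsilon>" unfolding energy_def by linarith
  qed
qed

section \<open>Eigenfunctions\<close>

definition weak_eigenfunction :: "'e graph_fun \<Rightarrow> real \<Rightarrow> 'e graph_fun \<Rightarrow> bool" where
  "weak_eigenfunction W \<mu> v \<longleftrightarrow> v \<in> H1 \<and> (\<forall>\<phi>\<in>H1. energy W v \<phi> = \<mu> * inner_L2 v \<phi>)"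

text \<open>Link to \<open>kirchhoff_sum\<close>, which is defined by classical one-sided
  derivatives at the ends of the edges.\<close>

lemma has_L2_deriv_vector_derivative:
  assumes v: "has_L2_deriv l v g" and g: "continuous_on {0..l} g" and x: "x \<in> {0..l}" and "0 < l"
  shows "vector_derivative v (at x within {0..l}) = g x"
proof -
  have "((\<lambda>y. integral {0..y} g) has_vector_derivative g x) (at x within {0..l})"
    using g x by (rule integral_has_vector_derivative)
  then have "((\<lambda>y. v 0 + integral {0..y} g) has_vector_derivative g x) (at x within {0..l})"
    by (auto intro!: derivative_eq_intros)
  then have "(v has_vector_derivative g x) (at x within {0..l})"
  proof (rule has_vector_derivative_transform[OF x, rotated])
    fix y assume y: "y \<in> {0..l}"
    have "v y - v 0 = (\<integral>t. g t \<partial>edge_measure y)" using v y by (simp add: has_L2_deriv_def)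
    also have "\<dots> = integral {0..y} g"
      using has_L2_deriv_integrable[OF v, of 0 y] y by (intro lebesgue_integral_eq_integral) auto
    finally show "v y = v 0 + integral {0..y} g" by simp
  qed
  then show ?thesis using x \<open>0 < l\<close>
    by (intro vector_derivative_within_cbox[of 0 l, simplified]) auto
qed

text \<open>The boundary terms of integration by parts, regrouped by vertex. Every edge contributes
  once at its tail and once at its head, so a loop contributes twice at its vertex.\<close>

lemma sum_over_vertices:
  fixes a b :: "'e \<Rightarrow> real" and c :: "'v \<Rightarrow> real"
  shows "(\<Sum>e\<in>arcs G. a e * c (head G e) - b e * c (tail G e))
    = - (\<Sum>w\<in>verts G. c w * ((\<Sum>e\<in>out_arcs G w. b e) + (\<Sum>e\<in>in_arcs G w. - a e)))"
proof -
  have "(\<Sum>w\<in>verts G. c w * (\<Sum>e\<in>out_arcs G w. b e)) = (\<Sum>w\<in>verts G. \<Sum>e\<in>{e\<in>arcs G. tail G e = w}. b e * c (tail G e))"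
    by (intro sum.cong refl) (auto simp: sum_distrib_left out_arcs_def mult.commute intro!: sum.cong)
  also have "\<dots> = (\<Sum>e\<in>arcs G. b e * c (tail G e))"
    by (rule sum.group) auto
  finally have 1: "(\<Sum>w\<in>verts G. c w * (\<Sum>e\<in>out_arcs G w. b e)) = (\<Sum>e\<in>arcs G. b e * c (tail G e))" .
  have "(\<Sum>w\<in>verts G. c w * (\<Sum>e\<in>in_arcs G w. - a e)) = (\<Sum>w\<in>verts G. \<Sum>e\<in>{e\<in>arcs G. head G e = w}. - a e * c (head G e))"
    by (intro sum.cong refl) (auto simp: sum_distrib_left in_arcs_def mult.commute intro!: sum.cong)
  also have "\<dots> = (\<Sum>e\<in>arcs G. - a e * c (head G e))"
    by (rule sum.group) auto
  finally have 2: "(\<Sum>w\<in>verts G. c w * (\<Sum>e\<in>in_arcs G w. - a e)) = (\<Sum>e\<in>arcs G. - a e * c (head G e))" .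
  show ?thesis
    by (simp only: distrib_left sum.distrib 1 2) (simp add: sum_subtractf sum_negf)
qed

text \<open>\<open>h\<close> is the continuous representative of the derivative of \<open>v\<close>, with one-sided values at the ends.\<close>
lemma graph_integration_by_parts:
  assumes v: "v \<in> H1" and \<phi>: "\<phi> \<in> H1"
    and h: "\<And>e. e \<in> arcs G \<Longrightarrow> has_L2_deriv (len e) (h e) (k e)"
    and hD: "\<And>e. e \<in> arcs G \<Longrightarrow> AE x in edge_measure (len e). D v e x = h e x"
    and c: "\<forall>e\<in>arcs G. \<phi> e 0 = c (tail G e) \<and> \<phi> e (len e) = c (head G e)"
  shows "dirichlet v \<phi> = - (\<Sum>w\<in>verts G. c w * kirchhoff_sum G len v w)
    - gint (\<lambda>e x. k e x * \<phi> e x)"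
proof -
  have vd: "vector_derivative (v e) (at x within {0..len e}) = h e x" if "e \<in> arcs G" "x \<in> {0..len e}" for e x
    using has_L2_deriv_cong_AE[OF H1_edge[OF v that(1)] has_L2_deriv_L2[OF h[OF that(1)]] hD[OF that(1)]]
      has_L2_deriv_continuous[OF h[OF that(1)]] that(2) len_pos[OF that(1)]
    by (rule has_L2_deriv_vector_derivative)
  have "dirichlet v \<phi> = gint (\<lambda>e x. h e x * D \<phi> e x)"
    by (rule dirichlet_eq[OF hD v \<phi> has_L2_deriv_L2[OF h]])
  also have "\<dots> = (\<Sum>e\<in>arcs G. (h e (len e) * c (head G e) - h e 0 * c (tail G e))
      - (\<integral>x. k e x * \<phi> e x \<partial>edge_measure (len e)))"
    unfolding graph_integral_def
  proof (intro sum.cong refl)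
    fix e assume e: "e \<in> arcs G"
    show "(\<integral>x. h e x * D \<phi> e x \<partial>edge_measure (len e))
      = (h e (len e) * c (head G e) - h e 0 * c (tail G e)) - (\<integral>x. k e x * \<phi> e x \<partial>edge_measure (len e))"
      using integration_by_parts_L2_deriv[OF h[OF e] H1_edge[OF \<phi> e]] len_pos[OF e] c e by simp
  qed
  also have "\<dots> = (\<Sum>e\<in>arcs G. h e (len e) * c (head G e) - h e 0 * c (tail G e)) - gint (\<lambda>e x. k e x * \<phi> e x)"
    by (simp add: graph_integral_def sum_subtractf)
  also have "(\<Sum>e\<in>arcs G. h e (len e) * c (head G e) - h e 0 * c (tail G e))
      = - (\<Sum>w\<in>verts G. c w * ((\<Sum>e\<in>out_arcs G w. h e 0) + (\<Sum>e\<in>in_arcs G w. - h e (len e))))"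
    by (rule sum_over_vertices)
  also have "(\<Sum>w\<in>verts G. c w * ((\<Sum>e\<in>out_arcs G w. h e 0) + (\<Sum>e\<in>in_arcs G w. - h e (len e))))
      = (\<Sum>w\<in>verts G. c w * kirchhoff_sum G len v w)"
    unfolding kirchhoff_sum_def using vd len_pos
    by (intro sum.cong refl arg_cong2[where f="(*)"] arg_cong2[where f="(+)"]) (auto simp: less_imp_le)
  finally show ?thesis .
qed

text \<open>From strong to weak by integration by parts, the Kirchhoff condition killing the vertex
  terms. Conversely, test functions supported in one edge show that D v has weak derivative (W -
  \<mu>) v, and edgewise affine functions equal to 1 at a single vertex isolate the Kirchhoff sum
  there.\<close>

lemma eigenspace_iff_weak:
  assumes W: "W \<in> graph_Linfty G len"
  shows "v \<in> eigenspace G len W \<mu> \<longleftrightarrow> weak_eigenfunction W \<mu> v"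
proof
  assume "v \<in> eigenspace G len W \<mu>"
  then have v: "v \<in> H1" and H2: "\<And>e. e \<in> arcs G \<Longrightarrow> v e \<in> H2_interval (len e)"
    and kirch: "\<And>w. w \<in> verts G \<Longrightarrow> kirchhoff_sum G len v w = 0"
    and eq: "\<And>e. e \<in> arcs G \<Longrightarrow> AE x in edge_measure (len e). schroedinger_op len W v e x = \<mu> * v e x"
    by (auto simp: eigenspace_def kirchhoff_domain_def)
  have "\<exists>h. has_L2_deriv (len e) h (D (D v) e) \<and> (AE x in edge_measure (len e). D v e x = h x)" if e: "e \<in> arcs G" for e
  proof -
    have "D v e \<in> H1_interval (len e)" using H2[OF e] by (simp add: H2_interval_def graph_deriv_def)
    from weak_deriv_imp_primitive[OF len_pos[OF e] D_L2[OF v e] H1_weak_deriv[OF this]]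
    show ?thesis by (auto simp: graph_deriv_def)
  qed
  then obtain h where h: "\<And>e. e \<in> arcs G \<Longrightarrow> has_L2_deriv (len e) (h e) (D (D v) e)"
    "\<And>e. e \<in> arcs G \<Longrightarrow> AE x in edge_measure (len e). D v e x = h e x" by metis
  show "weak_eigenfunction W \<mu> v" unfolding weak_eigenfunction_def
  proof (intro conjI ballI v)
    fix \<phi> assume \<phi>: "\<phi> \<in> H1"
    obtain c where c: "\<forall>e\<in>arcs G. \<phi> e 0 = c (tail G e) \<and> \<phi> e (len e) = c (head G e)" by (rule H1_vertex[OF \<phi>])
    have DDL2: "D (D v) e \<in> L2_interval (len e)" if "e \<in> arcs G" for e using has_L2_derivD[OF h(1)[OF that]] .
    have i1: "gintegrable (\<lambda>e x. D (D v) e x * \<phi> e x)"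
      unfolding gintegrable_def by (intro ballI L2_mult_integrable DDL2 edge_continuous_L2 H1_edge_continuous[OF \<phi>])
    have i2: "gintegrable (\<lambda>e x. W e x * v e x * \<phi> e x)"
      by (rule weighted_integrable[OF W H1_edge_continuous[OF v] H1_edge_continuous[OF \<phi>]])
    have "energy W v \<phi> = gint (\<lambda>e x. W e x * v e x * \<phi> e x) - gint (\<lambda>e x. D (D v) e x * \<phi> e x)"
      using graph_integration_by_parts[OF v \<phi> h c] kirch by (simp add: energy_def weighted_inner_def)
    also have "\<dots> = gint (\<lambda>e x. W e x * v e x * \<phi> e x - D (D v) e x * \<phi> e x)"
      using i1 i2 by (simp add: gint_diff)
    also have "\<dots> = gint (\<lambda>e x. \<mu> * (1 * v e x * \<phi> e x))"
      unfolding graph_integral_def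
    proof (intro sum.cong refl integral_cong_AE)
      fix e assume e: "e \<in> arcs G"
      show "(\<lambda>x. W e x * v e x * \<phi> e x - D (D v) e x * \<phi> e x) \<in> borel_measurable (edge_measure (len e))"
        using i1 i2 e unfolding gintegrable_def by (intro borel_measurable_diff borel_measurable_integrable) auto
      show "(\<lambda>x. \<mu> * (1 * v e x * \<phi> e x)) \<in> borel_measurable (edge_measure (len e))"
        using weighted_integrable[OF const_Linfty[of 1] H1_edge_continuous[OF v] H1_edge_continuous[OF \<phi>]] e
        unfolding gintegrable_def by (intro borel_measurable_times borel_measurable_const borel_measurable_integrable) auto
      show "AE x in edge_measure (len e). W e x * v e x * \<phi> e x - D (D v) e x * \<phi> e x = \<mu> * (1 * v e x * \<phi> e x)"
        using eq[OF e] by eventually_elim (simp add: schroedinger_op_def algebra_simps flip: distrib_right)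
    qed
    also have "\<dots> = \<mu> * inner_L2 v \<phi>" unfolding weighted_inner_def by (rule gint_cmult)
    finally show "energy W v \<phi> = \<mu> * inner_L2 v \<phi>" .
  qed
next
  assume "weak_eigenfunction W \<mu> v"
  then have v: "v \<in> H1" and weak: "\<And>\<phi>. \<phi> \<in> H1 \<Longrightarrow> energy W v \<phi> = \<mu> * inner_L2 v \<phi>"
    by (auto simp: weak_eigenfunction_def)
  \<comment> \<open>The expected second derivative of v.\<close>
  define k where "k e x = (W e x - \<mu>) * v e x" for e x
  have kL2: "k e \<in> L2_interval (len e)" if e: "e \<in> arcs G" for e
  proof -
    have "(\<lambda>x. W e x * v e x - \<mu> * v e x) \<in> L2_interval (len e)"
      by (intro L2_diff L2_scale Linfty_mult_L2[OF W e] edge_continuous_L2 H1_edge_continuous v e)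
    then show ?thesis unfolding k_def by (simp add: left_diff_distrib)
  qed
  have ki: "gintegrable (\<lambda>e x. k e x * \<phi> e x)" if "\<phi> \<in> H1" for \<phi>
    unfolding gintegrable_def by (intro ballI L2_mult_integrable kL2 edge_continuous_L2 H1_edge_continuous[OF that])
  have weak_k: "dirichlet v \<phi> = - gint (\<lambda>e x. k e x * \<phi> e x)" if \<phi>: "\<phi> \<in> H1" for \<phi>
  proof -
    have "gint (\<lambda>e x. k e x * \<phi> e x) = gint (\<lambda>e x. W e x * v e x * \<phi> e x - \<mu> * (1 * v e x * \<phi> e x))"
      by (intro gint_cong) (simp add: k_def algebra_simps)
    also have "\<dots> = weighted_inner W v \<phi> - \<mu> * inner_L2 v \<phi>"
      unfolding weighted_inner_def gint_cmult[symmetric]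
      by (intro gint_diff gintegrable_cmult weighted_integrable W const_Linfty H1_edge_continuous v \<phi>)
    finally show ?thesis using weak[OF \<phi>] by (simp add: energy_def)
  qed
  have "is_weak_deriv (len e) (D v e) (k e)" if e: "e \<in> arcs G" for e
    unfolding is_weak_deriv_def
  proof
    fix \<psi> assume \<psi>: "\<psi> \<in> test_funs (len e)"
    \<comment> \<open>The test function extended by zero to the other edges; it vanishes at all
      vertices.\<close>
    define \<phi> where "\<phi> e' x = (if e' = e \<and> x \<in> {0..len e} then \<psi> x else 0)" for e' x
    have \<phi>d: "has_L2_deriv (len e') (\<phi> e') (if e' = e then deriv \<psi> else (\<lambda>x. 0))" if "e' \<in> arcs G" for e'
    proof (cases "e' = e")
      case True
      then show ?thesis using has_L2_deriv_cong[OF test_fun_has_L2_deriv[OF \<psi>]] by (auto simp: \<phi>_def)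
    next
      case False
      then show ?thesis by (auto simp: \<phi>_def[abs_def] has_L2_deriv_def intro: continuous_L2)
    qed
    have \<phi>: "\<phi> \<in> H1"
      using test_fun_ends[OF \<psi>] e by (intro H1_I[where c="\<lambda>w. 0", OF \<phi>d]) (auto simp: \<phi>_def)
    have "dirichlet \<phi> v = gint (\<lambda>e' x. (if e' = e then deriv \<psi> else (\<lambda>x. 0)) x * D v e' x)"
      by (rule dirichlet_eq[OF D_unique[OF _ \<phi>d] \<phi> v has_L2_derivD[OF \<phi>d]])
    also have "\<dots> = (\<Sum>e'\<in>arcs G. if e' = e then (\<integral>x. deriv \<psi> x * D v e x \<partial>edge_measure (len e)) else 0)"
      unfolding graph_integral_def by (intro sum.cong) auto
    also have "\<dots> = (\<integral>x. D v e x * deriv \<psi> x \<partial>edge_measure (len e))"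
      using e by (simp add: mult.commute)
    finally have 1: "dirichlet v \<phi> = (\<integral>x. D v e x * deriv \<psi> x \<partial>edge_measure (len e))"
      by (simp add: dirichlet_commute)
    have "gint (\<lambda>e x. k e x * \<phi> e x) = (\<Sum>e'\<in>arcs G. if e' = e then (\<integral>x. k e x * \<psi> x \<partial>edge_measure (len e)) else 0)"
      unfolding graph_integral_def by (intro sum.cong) (auto simp: \<phi>_def intro!: Bochner_Integration.integral_cong)
    also have "\<dots> = (\<integral>x. k e x * \<psi> x \<partial>edge_measure (len e))" using e by simp
    finally show "(\<integral>x. D v e x * deriv \<psi> x \<partial>edge_measure (len e)) = - (\<integral>x. k e x * \<psi> x \<partial>edge_measure (len e))"
      using 1 weak_k[OF \<phi>] by simp
  qed
  note wd = this
  have DvH1: "D v e \<in> H1_interval (len e)" if e: "e \<in> arcs G" for e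
    using wd[OF e] kL2[OF e] D_L2[OF v e] by (auto simp: H1_interval_def)
  have "\<exists>h. has_L2_deriv (len e) h (k e) \<and> (AE x in edge_measure (len e). D v e x = h x)" if e: "e \<in> arcs G" for e
    using weak_deriv_imp_primitive[OF len_pos[OF e] D_L2[OF v e] kL2[OF e] wd[OF e]] by metis
  then obtain h where h: "\<And>e. e \<in> arcs G \<Longrightarrow> has_L2_deriv (len e) (h e) (k e)"
    "\<And>e. e \<in> arcs G \<Longrightarrow> AE x in edge_measure (len e). D v e x = h e x" by metis
  have DD: "AE x in edge_measure (len e). D (D v) e x = k e x" if e: "e \<in> arcs G" for e
  proof -
    let ?m = "D (D v) e"
    have m: "?m \<in> L2_interval (len e)" "is_weak_deriv (len e) (D v e) ?m"
      using H1_weak_deriv[OF DvH1[OF e]] by (auto simp: graph_deriv_def)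
    \<comment> \<open>The derivative of D v chosen by \<open>graph_deriv\<close> has its own
      continuous primitive h'. Both h' and h represent D v, so they coincide everywhere and their
      derivatives agree almost everywhere.\<close>
    obtain h' where h': "has_L2_deriv (len e) h' ?m" "AE x in edge_measure (len e). D v e x = h' x"
      by (rule weak_deriv_imp_primitive[OF len_pos[OF e] D_L2[OF v e] m])
    have "AE x in edge_measure (len e). h e x = h' x" using h(2)[OF e] h'(2) by eventually_elim simp
    then have "h' x = h e x" if "x \<in> {0..len e}" for x
      using continuous_AE_eq[OF len_pos[OF e] has_L2_deriv_continuous[OF h(1)[OF e]] has_L2_deriv_continuous[OF h'(1)] _ that]
      by simp
    then have "has_L2_deriv (len e) (h e) ?m" by (intro has_L2_deriv_cong[OF h'(1)])
    then show ?thesis by (rule has_L2_deriv_unique[OF _ h(1)[OF e] len_pos[OF e]])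
  qed
  have kirch: "kirchhoff_sum G len v w = 0" if w: "w \<in> verts G" for w
  proof -
    define c where "c w' = (if w' = w then 1 else 0 :: real)" for w'
    \<comment> \<open>Affine interpolation of the vertex indicator c along every edge; on a loop at
      w it is the constant 1.\<close>
    define \<phi> where "\<phi> e x = (if e \<in> arcs G \<and> x \<in> {0..len e}
      then c (tail G e) + (c (head G e) - c (tail G e)) / len e * x else 0)" for e x
    have \<phi>d: "has_L2_deriv (len e) (\<phi> e) (\<lambda>x. (c (head G e) - c (tail G e)) / len e)" if e: "e \<in> arcs G" for e
    proof (rule has_L2_deriv_cong)
      show "has_L2_deriv (len e) (\<lambda>x. c (tail G e) + (c (head G e) - c (tail G e)) / len e * x)
          (\<lambda>x. (c (head G e) - c (tail G e)) / len e)"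
        using len_pos[OF e] by (intro has_L2_deriv_C1) (auto intro!: derivative_eq_intros continuous_intros)
    qed (use e in \<open>auto simp: \<phi>_def\<close>)
    have ends: "\<forall>e\<in>arcs G. \<phi> e 0 = c (tail G e) \<and> \<phi> e (len e) = c (head G e)"
    proof
      fix e assume "e \<in> arcs G"
      with len_pos[OF this] show "\<phi> e 0 = c (tail G e) \<and> \<phi> e (len e) = c (head G e)" by (simp add: \<phi>_def)
    qed
    have \<phi>: "\<phi> \<in> H1"
      using ends by (intro H1_I[where c=c, OF \<phi>d]) (auto simp: \<phi>_def)
    have "(\<Sum>w'\<in>verts G. c w' * kirchhoff_sum G len v w') = 0"
      using graph_integration_by_parts[OF v \<phi> h ends] weak_k[OF \<phi>] by simp
    moreover have "(\<Sum>w'\<in>verts G. c w' * kirchhoff_sum G len v w')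
        = (\<Sum>w'\<in>verts G. if w' = w then kirchhoff_sum G len v w else 0)"
      by (intro sum.cong) (auto simp: c_def)
    ultimately show ?thesis using w by simp
  qed
  show "v \<in> eigenspace G len W \<mu>"
    unfolding eigenspace_def kirchhoff_domain_def
  proof (intro CollectI conjI ballI)
    show "v \<in> H1" by fact
    fix e assume e: "e \<in> arcs G"
    show "v e \<in> H2_interval (len e)"
      using v e DvH1[OF e] by (auto simp: H2_interval_def graph_deriv_def graph_H1_def)
    show "AE x in edge_measure (len e). schroedinger_op len W v e x = \<mu> * v e x"
      using DD[OF e] by eventually_elim (simp add: schroedinger_op_def k_def algebra_simps)
  qed (rule kirch)
qed

end

section \<open>The spectrum of the Kirchhoff operator\<close>

text \<open>The forms are known to be linear only on H^1, not on all functions, so sums have to be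
  handled relative to a subspace.\<close>

lemma sum_of_linear_on:
  fixes B :: "'a::real_vector \<Rightarrow> real"
  assumes S: "subspace S" and lin: "\<And>u v s t. u \<in> S \<Longrightarrow> v \<in> S \<Longrightarrow> B (s *\<^sub>R u + t *\<^sub>R v) = s * B u + t * B v"
    and "finite A" and v: "\<And>i. i \<in> A \<Longrightarrow> v i \<in> S"
  shows "B (\<Sum>i\<in>A. a i *\<^sub>R v i) = (\<Sum>i\<in>A. a i * B (v i))"
  using \<open>finite A\<close> v
proof (induction A rule: finite_induct)
  case empty
  show ?case using lin[OF subspace_0[OF S] subspace_0[OF S], of 0 0] by simp
next
  case (insert i A)
  have "(\<Sum>i\<in>A. a i *\<^sub>R v i) \<in> S"
    using insert.prems by (intro subspace_sum[OF S] subspace_scale[OF S]) auto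
  then have "B (a i *\<^sub>R v i + 1 *\<^sub>R (\<Sum>i\<in>A. a i *\<^sub>R v i)) = a i * B (v i) + 1 * B (\<Sum>i\<in>A. a i *\<^sub>R v i)"
    using insert.prems by (intro lin) auto
  then show ?case using insert by simp
qed

lemma edim_eqI:
  assumes T: "finite T" "independent T" "T \<subseteq> X" "X \<subseteq> span T"
  shows "edim X = enat (card T)"
  unfolding edim_def
proof (rule antisym)
  show "Sup {enat (card B) |B. finite B \<and> independent B \<and> B \<subseteq> X} \<le> enat (card T)"
  proof (rule Sup_least)
    fix x assume "x \<in> {enat (card B) |B. finite B \<and> independent B \<and> B \<subseteq> X}"
    then obtain B where B: "x = enat (card B)" "independent B" "B \<subseteq> X" by blast
    have "card B \<le> card T" using independent_span_bound[OF T(1) B(2)] B(3) T(4) by blast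
    then show "x \<le> enat (card T)" using B(1) by simp
  qed
  show "enat (card T) \<le> Sup {enat (card B) |B. finite B \<and> independent B \<and> B \<subseteq> X}"
    using T by (intro Sup_upper) blast
qed

context compact_metric_graph
begin

section \<open>Definiteness, Garding's inequality and infinite dimension of H^1\<close>

lemma nemytskii_tendsto:
  assumes b: "b \<in> graph_Linfty G len" and F: "continuous_on UNIV F" and u: "edge_continuous u"
    and un: "\<And>n. edge_continuous (un n)" and unif: "\<And>\<delta>. \<delta> > 0 \<Longrightarrow> \<exists>N. \<forall>n\<ge>N. close \<delta> (un n) u"
  shows "(\<lambda>n. gint (\<lambda>e x. b e x * F (un n e x))) \<longlonglongrightarrow> gint (\<lambda>e x. b e x * F (u e x))"
proof (rule LIMSEQ_I)
  fix r :: real assume "r > 0"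
  then have "r / 2 > 0" by simp
  then obtain \<delta> where \<delta>: "\<delta> > 0" "\<And>v. edge_continuous v \<Longrightarrow> close \<delta> v u
    \<Longrightarrow> \<bar>gint (\<lambda>e x. b e x * F (v e x)) - gint (\<lambda>e x. b e x * F (u e x))\<bar> \<le> r / 2"
    by (rule nemytskii_continuous[OF b F u]) blast
  obtain N where N: "\<forall>n\<ge>N. close \<delta> (un n) u" using unif[OF \<delta>(1)] by blast
  show "\<exists>N. \<forall>n\<ge>N. norm (gint (\<lambda>e x. b e x * F (un n e x)) - gint (\<lambda>e x. b e x * F (u e x))) < r"
  proof (intro exI[of _ N] allI impI)
    fix n assume "n \<ge> N"
    then have "\<bar>gint (\<lambda>e x. b e x * F (un n e x)) - gint (\<lambda>e x. b e x * F (u e x))\<bar> \<le> r / 2"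
      using N by (intro \<delta>(2) un) auto
    then show "norm (gint (\<lambda>e x. b e x * F (un n e x)) - gint (\<lambda>e x. b e x * F (u e x))) < r"
      using \<open>r > 0\<close> by simp
  qed
qed

lemma weighted_inner_tendsto:
  assumes b: "b \<in> graph_Linfty G len" and u: "edge_continuous u" and un: "\<And>n. edge_continuous (un n)"
    and unif: "\<And>\<delta>. \<delta> > 0 \<Longrightarrow> \<exists>N. \<forall>n\<ge>N. close \<delta> (un n) u"
  shows "(\<lambda>n. weighted_inner b (un n) (un n)) \<longlonglongrightarrow> weighted_inner b u u"
    and "edge_continuous w \<Longrightarrow> (\<lambda>n. weighted_inner b (un n) w) \<longlonglongrightarrow> weighted_inner b u w"
proof -
  have "gint (\<lambda>e x. b e x * (v e x)\<^sup>2) = weighted_inner b v v" for v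
    by (simp add: weighted_inner_def power2_eq_square mult.assoc)
  then show "(\<lambda>n. weighted_inner b (un n) (un n)) \<longlonglongrightarrow> weighted_inner b u u"
    using nemytskii_tendsto[OF b _ u un unif, of "\<lambda>x. x\<^sup>2"] by (simp add: continuous_intros)
  assume w: "edge_continuous w"
  \<comment> \<open>The fixed factor w is moved into the weight, and F becomes the identity.\<close>
  have "gint (\<lambda>e x. (b e x * w e x) * v e x) = weighted_inner b v w" for v
    by (simp add: weighted_inner_def mult_ac)
  then show "(\<lambda>n. weighted_inner b (un n) w) \<longlonglongrightarrow> weighted_inner b u w"
    using nemytskii_tendsto[OF Linfty_mult[OF b edge_continuous_Linfty[OF w]] _ u un unif, of "\<lambda>x. x"]
    by (simp add: continuous_intros)
qed

text \<open>Definiteness uses the normalisation outside the graph: a function vanishing almost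
  everywhere on the edges vanishes there by continuity and elsewhere by convention.\<close>

lemma inner_L2_pos:
  assumes u: "u \<in> H1" and "u \<noteq> 0"
  shows "0 < inner_L2 u u"
proof (rule ccontr)
  assume "\<not> 0 < inner_L2 u u"
  then have z: "gint (\<lambda>e x. 1 * u e x * u e x) = 0"
    using inner_L2_nonneg[of u] by (simp add: weighted_inner_def)
  have "u e x = 0" for e x
  proof (cases "e \<in> arcs G \<and> x \<in> {0..len e}")
    case True
    have "AE x in edge_measure (len e). 1 * u e x * u e x = 0"
      using True by (intro gint_zero_AE[OF weighted_integrable[OF const_Linfty] _ z] H1_edge_continuous[OF u]) auto
    then have "AE x in edge_measure (len e). u e x = 0" by eventually_elim simp
    then show ?thesis
      using continuous_AE_eq[of "len e" "u e" "\<lambda>x. 0" x] has_L2_deriv_continuous[OF H1_edge[OF u]] len_pos True by auto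
  qed (simp add: H1_outside[OF u])
  then show False using \<open>u \<noteq> 0\<close> by (simp add: fun_eq_iff)
qed

text \<open>Garding's inequality with C an essential bound of |b|. It turns bounded energy and
  bounded L^2 norm into a bound in H^1.\<close>

lemma energy_lower_bound:
  assumes b: "b \<in> graph_Linfty G len"
  obtains C where "C > 0" "\<And>u. u \<in> H1 \<Longrightarrow> dirichlet u u - C * inner_L2 u u \<le> energy b u u"
proof -
  obtain C where C: "C > 0" "\<And>e. e \<in> arcs G \<Longrightarrow> AE x in edge_measure (len e). \<bar>b e x\<bar> \<le> C"
    by (rule Linfty_bound[OF b]) blast
  have "dirichlet u u - C * inner_L2 u u \<le> energy b u u" if u: "u \<in> H1" for u
  proof -
    have c: "edge_continuous u" by (rule H1_edge_continuous[OF u])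
    have "gint (\<lambda>e x. (- C) * (1 * u e x * u e x)) \<le> gint (\<lambda>e x. b e x * u e x * u e x)"
    proof (rule gint_mono)
      show "gintegrable (\<lambda>e x. (- C) * (1 * u e x * u e x))"
        by (intro gintegrable_cmult weighted_integrable const_Linfty c)
      show "gintegrable (\<lambda>e x. b e x * u e x * u e x)" by (intro weighted_integrable b c)
      fix e assume "e \<in> arcs G"
      from C(2)[OF this] show "AE x in edge_measure (len e). (- C) * (1 * u e x * u e x) \<le> b e x * u e x * u e x"
      proof eventually_elim
        case (elim x)
        then have "(- C) * (u e x * u e x) \<le> b e x * (u e x * u e x)" by (intro mult_right_mono) auto
        then show ?case by (simp add: mult.assoc)
      qed
    qed
    then show ?thesis unfolding energy_def weighted_inner_def gint_cmult by linarith
  qed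
  then show ?thesis using that C(1) by blast
qed

lemma inner_L2_sum:
  assumes "finite A" "\<And>i. i \<in> A \<Longrightarrow> v i \<in> H1" "w \<in> H1"
  shows "inner_L2 (\<Sum>i\<in>A. a i *\<^sub>R v i) w = (\<Sum>i\<in>A. a i * inner_L2 (v i) w)"
proof (rule sum_of_linear_on[OF subspace_H1 _ assms(1,2)])
  show "inner_L2 (s *\<^sub>R x + t *\<^sub>R y) w = s * inner_L2 x w + t * inner_L2 y w" if "x \<in> H1" "y \<in> H1" for x y s t
    by (intro weighted_inner_lincomb const_Linfty H1_edge_continuous that assms(3))
qed

lemma energy_sum:
  assumes "b \<in> graph_Linfty G len" "finite A" "\<And>i. i \<in> A \<Longrightarrow> v i \<in> H1" "w \<in> H1"
  shows "energy b (\<Sum>i\<in>A. a i *\<^sub>R v i) w = (\<Sum>i\<in>A. a i * energy b (v i) w)"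
proof (rule sum_of_linear_on[OF subspace_H1 _ assms(2,3)])
  show "energy b (s *\<^sub>R x + t *\<^sub>R y) w = s * energy b x w + t * energy b y w" if "x \<in> H1" "y \<in> H1" for x y s t
    by (intro energy_lincomb assms(1,4) that)
qed

lemma H1_sum: "(\<And>i. i \<in> A \<Longrightarrow> v i \<in> H1) \<Longrightarrow> (\<Sum>i\<in>A. a i *\<^sub>R v i) \<in> H1"
  by (intro subspace_sum[OF subspace_H1] H1_scale)

lemma orthogonal_independent:
  assumes "finite B" "B \<subseteq> H1" "0 \<notin> B" "\<And>u v. u \<in> B \<Longrightarrow> v \<in> B \<Longrightarrow> u \<noteq> v \<Longrightarrow> inner_L2 u v = 0"
  shows "independent B"
proof (rule independent_if_scalars_zero[OF \<open>finite B\<close>])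
  fix f w assume z: "(\<Sum>x\<in>B. f x *\<^sub>R x) = 0" and w: "w \<in> B"
  have "w \<in> H1" "w \<noteq> 0" using w assms by auto
  have "0 = inner_L2 (\<Sum>x\<in>B. f x *\<^sub>R x) w" by (simp add: z weighted_inner_def graph_integral_def)
  also have "\<dots> = (\<Sum>x\<in>B. f x * inner_L2 x w)"
    using assms \<open>w \<in> H1\<close> by (intro inner_L2_sum) auto
  also have "\<dots> = (\<Sum>x\<in>B. if x = w then f w * inner_L2 w w else 0)"
    using assms(4) w by (intro sum.cong) auto
  also have "\<dots> = f w * inner_L2 w w" using w assms(1) by simp
  finally show "f w = 0" using inner_L2_pos[OF \<open>w \<in> H1\<close> \<open>w \<noteq> 0\<close>] by simp
qed

text \<open>One edge is cut into n equal pieces, and each carries a bump, the product of two squared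
  ramps, which is continuously differentiable and vanishes off its piece. Disjoint supports give
  orthogonality, hence independence.\<close>

lemma H1_infinite_dimensional:
  assumes "arcs G \<noteq> {}"
  obtains B where "finite B" "B \<subseteq> H1" "independent B" "card B = n"
proof -
  obtain e0 where e0: "e0 \<in> arcs G" using assms by blast
  define l where "l = len e0"
  have l: "l > 0" using len_pos[OF e0] by (simp add: l_def)
  define a where "a j = l * real j / real n" for j
  define f where "f j e x = (if e = e0 \<and> x \<in> {0..l} then ramp_sq (x - a j) * ramp_sq (a (Suc j) - x) else 0)" for j e x
  have al: "0 \<le> a j" "a (Suc j) \<le> l" "a j < a (Suc j)" if "j < n" for j
  proof -
    have "real (Suc j) \<le> real n" using that by linarith
    then have "l * real (Suc j) \<le> l * real n" using l by (intro mult_left_mono) auto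
    then show "a (Suc j) \<le> l" using that by (simp add: a_def divide_le_eq)
    show "0 \<le> a j" using l by (simp add: a_def)
    show "a j < a (Suc j)" unfolding a_def using that l by (intro divide_strict_right_mono mult_strict_left_mono) auto
  qed
  have mono: "a (Suc i) \<le> a j" if "i < j" for i j
    using that l unfolding a_def by (intro divide_right_mono mult_left_mono) auto
  have fd: "\<exists>g. has_L2_deriv (len e) (f j e) g" if e: "e \<in> arcs G" for j e
  proof (cases "e = e0")
    case True
    have r1: "((\<lambda>x. ramp_sq (x - a j)) has_real_derivative 2 * max 0 (x - a j)) (at x)" for x
    proof -
      have "((\<lambda>x. x - a j) has_real_derivative 1) (at x)" by (auto intro!: derivative_eq_intros)
      from DERIV_chain2[where f=ramp_sq and g="\<lambda>x. x - a j", OF ramp_sq_deriv this] show ?thesis by simp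
    qed
    have r2: "((\<lambda>x. ramp_sq (a (Suc j) - x)) has_real_derivative - 2 * max 0 (a (Suc j) - x)) (at x)" for x
    proof -
      have "((\<lambda>x. a (Suc j) - x) has_real_derivative -1) (at x)" by (auto intro!: derivative_eq_intros)
      from DERIV_chain2[where f=ramp_sq and g="\<lambda>x. a (Suc j) - x", OF ramp_sq_deriv this] show ?thesis by simp
    qed
    have A: "has_L2_deriv l (\<lambda>x. ramp_sq (x - a j)) (\<lambda>x. 2 * max 0 (x - a j))"
      and B: "has_L2_deriv l (\<lambda>x. ramp_sq (a (Suc j) - x)) (\<lambda>x. - 2 * max 0 (a (Suc j) - x))"
      by (intro has_L2_deriv_C1 has_field_derivative_at_within[OF r1] has_field_derivative_at_within[OF r2] continuous_intros)+
    have "has_L2_deriv l (f j e0) (\<lambda>x. ramp_sq (x - a j) * (- 2 * max 0 (a (Suc j) - x))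
        + 2 * max 0 (x - a j) * ramp_sq (a (Suc j) - x))"
    proof (rule has_L2_deriv_cong)
      show "has_L2_deriv l (\<lambda>x. ramp_sq (x - a j) * ramp_sq (a (Suc j) - x))
        (\<lambda>x. ramp_sq (x - a j) * (- 2 * max 0 (a (Suc j) - x)) + 2 * max 0 (x - a j) * ramp_sq (a (Suc j) - x))"
        using A B by (rule has_L2_deriv_mult)
    qed (simp add: f_def)
    then show ?thesis using True by (auto simp: l_def)
  next
    case False
    have "has_L2_deriv (len e) (f j e) (\<lambda>x. 0)"
      using False by (auto simp: f_def[abs_def] has_L2_deriv_def intro: continuous_L2)
    then show ?thesis by blast
  qed
  define g where "g j e = (SOME h. has_L2_deriv (len e) (f j e) h)" for j e
  have g: "has_L2_deriv (len e) (f j e) (g j e)" if "e \<in> arcs G" for j e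
    unfolding g_def by (rule someI_ex[OF fd[OF that]])
  have fH: "f j \<in> H1" if "j < n" for j
    using al[OF that] e0 by (intro H1_I[where c="\<lambda>w. 0", OF g]) (auto simp: f_def ramp_sq_def l_def)
  have fpos: "f j e0 ((a j + a (Suc j)) / 2) > 0" if "j < n" for j
    using al[OF that] by (auto simp: f_def ramp_sq_def max_def field_simps)
  have orth: "f i e x * f j e x = 0" if "i \<noteq> j" for i j e x
  proof -
    have *: "f i e x * f j e x = 0" if "i < j" for i j
      using mono[OF that] by (auto simp: f_def ramp_sq_def max_def split: if_splits)
    show ?thesis using *[of i j] *[of j i] that by (cases "i < j") (auto simp: mult.commute)
  qed
  have inj: "inj_on f {..<n}"
  proof (rule inj_onI)
    fix i j assume "i \<in> {..<n}" "j \<in> {..<n}" and eq: "f i = f j"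
    show "i = j"
    proof (rule ccontr)
      assume "i \<noteq> j"
      from orth[OF this, of e0 "(a i + a (Suc i)) / 2"] eq fpos[of i] \<open>i \<in> {..<n}\<close> show False by simp
    qed
  qed
  have "independent (f ` {..<n})"
  proof (rule orthogonal_independent)
    show "0 \<notin> f ` {..<n}"
    proof
      assume "0 \<in> f ` {..<n}"
      then obtain j where "j < n" "f j = 0" by auto
      with fpos[of j] show False by simp
    qed
    fix u v assume "u \<in> f ` {..<n}" "v \<in> f ` {..<n}" "u \<noteq> v"
    then obtain i j where "u = f i" "v = f j" "i \<noteq> j" by auto
    then show "inner_L2 u v = 0" by (simp add: weighted_inner_def graph_integral_def orth)
  qed (use fH in auto)
  then show ?thesis using that[of "f ` {..<n}"] fH inj by (auto simp: card_image)
qed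

section \<open>Successive minimisation of the energy\<close>

text \<open>The lowest value c of the energy may be negative, so the two-sided continuity of the
  norm is needed; |c| + 1 keeps the modulus positive.\<close>

lemma scaled_inner_L2_lsc:
  assumes u: "edge_continuous u" and "\<epsilon> > 0"
  shows "\<exists>\<delta>>0. \<forall>w. edge_continuous w \<longrightarrow> close \<delta> w u \<longrightarrow> c * inner_L2 u u - \<epsilon> \<le> c * inner_L2 w w"
proof -
  have "\<epsilon> / (\<bar>c\<bar> + 1) > 0" using \<open>\<epsilon> > 0\<close> by simp
  then obtain \<delta> where \<delta>: "\<delta> > 0" "\<And>w. edge_continuous w \<Longrightarrow> close \<delta> w u \<Longrightarrow> \<bar>inner_L2 w w - inner_L2 u u\<bar> \<le> \<epsilon> / (\<bar>c\<bar> + 1)"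
    by (rule weighted_inner_continuous[OF const_Linfty u]) blast
  show ?thesis
  proof (intro exI[of _ \<delta>] conjI allI impI \<delta>(1))
    fix w assume "edge_continuous w" "close \<delta> w u"
    then have "\<bar>inner_L2 w w - inner_L2 u u\<bar> \<le> \<epsilon> / (\<bar>c\<bar> + 1)" by (rule \<delta>(2))
    then have "\<bar>c\<bar> * \<bar>inner_L2 w w - inner_L2 u u\<bar> \<le> (\<bar>c\<bar> + 1) * (\<epsilon> / (\<bar>c\<bar> + 1))" by (intro mult_mono) auto
    then have "\<bar>c * inner_L2 w w - c * inner_L2 u u\<bar> \<le> \<epsilon>" by (simp add: abs_mult[symmetric] right_diff_distrib)
    then show "c * inner_L2 u u - \<epsilon> \<le> c * inner_L2 w w" by linarith
  qed
qed

text \<open>Direct method for the Rayleigh quotient on the orthogonal complement of the given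
  functions. Averages of unit vectors are not unit vectors, so the limit lemma is applied on all of
  V with the lower bound c * inner_L2 w w in place of the constraint.\<close>

lemma constrained_minimizer:
  fixes v :: "nat \<Rightarrow> 'e graph_fun"
  assumes W: "W \<in> graph_Linfty G len" and v: "\<And>i. i < n \<Longrightarrow> v i \<in> H1"
    and V: "V = {u \<in> H1. \<forall>i<n. inner_L2 u (v i) = 0}" and nontriv: "z \<in> V" "z \<noteq> 0"
  shows "\<exists>u\<in>V. inner_L2 u u = 1 \<and> (\<forall>w\<in>V. energy W u u * inner_L2 w w \<le> energy W w w)"
proof -
  have lincomb: "s *\<^sub>R u + t *\<^sub>R w \<in> V" if "u \<in> V" "w \<in> V" for s t u w
    using that v unfolding V
    by (auto intro: H1_linear_combination simp: weighted_inner_lincomb const_Linfty H1_edge_continuous)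
  have VH: "V \<subseteq> H1" by (auto simp: V)
  obtain C where C: "C > 0" "\<And>u. u \<in> H1 \<Longrightarrow> dirichlet u u - C * inner_L2 u u \<le> energy W u u"
    by (rule energy_lower_bound[OF W]) blast
  define E where "E = (\<lambda>w. energy W w w) ` {w \<in> V. inner_L2 w w = 1}"
  have scale1: "inner_L2 (s *\<^sub>R w) (s *\<^sub>R w) = s\<^sup>2 * inner_L2 w w" "energy W (s *\<^sub>R w) (s *\<^sub>R w) = s\<^sup>2 * energy W w w"
    if "w \<in> H1" for s w
    using weighted_inner_square[OF const_Linfty H1_edge_continuous H1_edge_continuous, of w w 1 s 0]
      energy_square[OF W that that, of s 0] that by auto
  have normalized: "(1 / sqrt (inner_L2 w w)) *\<^sub>R w \<in> V"
      "inner_L2 ((1 / sqrt (inner_L2 w w)) *\<^sub>R w) ((1 / sqrt (inner_L2 w w)) *\<^sub>R w) = 1"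
      "energy W ((1 / sqrt (inner_L2 w w)) *\<^sub>R w) ((1 / sqrt (inner_L2 w w)) *\<^sub>R w) = energy W w w / inner_L2 w w"
    if w: "w \<in> V" "w \<noteq> 0" for w
  proof -
    have H: "w \<in> H1" using w VH by auto
    have pos: "inner_L2 w w > 0" by (rule inner_L2_pos[OF H w(2)])
    show "(1 / sqrt (inner_L2 w w)) *\<^sub>R w \<in> V" using lincomb[OF w(1) w(1), of _ 0] by simp
    show "inner_L2 ((1 / sqrt (inner_L2 w w)) *\<^sub>R w) ((1 / sqrt (inner_L2 w w)) *\<^sub>R w) = 1"
      "energy W ((1 / sqrt (inner_L2 w w)) *\<^sub>R w) ((1 / sqrt (inner_L2 w w)) *\<^sub>R w) = energy W w w / inner_L2 w w"
      using pos by (simp_all add: scale1[OF H] power_divide)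
  qed
  have "E \<noteq> {}" unfolding E_def using normalized[OF nontriv] by blast
  have bdd: "bdd_below E"
  proof (rule bdd_belowI)
    fix x assume "x \<in> E"
    then obtain w where w: "w \<in> V" "inner_L2 w w = 1" "x = energy W w w" by (auto simp: E_def)
    show "- C \<le> x" using C(2)[of w] w VH dirichlet_nonneg[of w] by auto
  qed
  define c where "c = Inf E"
  have lower: "c * inner_L2 w w \<le> energy W w w" if w: "w \<in> V" for w
  proof (cases "w = 0")
    case True
    have "inner_L2 0 0 = 0" "energy W 0 0 = 0"
      using scale1[OF H1_zero, of 0] by auto
    then show ?thesis using True by simp
  next
    case False
    have "energy W w w / inner_L2 w w \<in> E" unfolding E_def using normalized[OF w False] by (auto simp: image_iff)
    then have "c \<le> energy W w w / inner_L2 w w" unfolding c_def using bdd by (rule cInf_lower)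
    then show ?thesis using inner_L2_pos[of w] False w VH by (simp add: pos_le_divide_eq subset_iff)
  qed
  have "\<exists>w. w \<in> V \<and> inner_L2 w w = 1 \<and> energy W w w < c + 1 / Suc n" for n
  proof -
    have "Inf E < c + 1 / Suc n" by (simp add: c_def)
    then obtain x where "x \<in> E" "x < c + 1 / Suc n" using \<open>E \<noteq> {}\<close> bdd cInf_less_iff by metis
    then show ?thesis by (auto simp: E_def)
  qed
  then obtain un where un: "\<And>n. un n \<in> V" "\<And>n. inner_L2 (un n) (un n) = 1" "\<And>n. energy W (un n) (un n) < c + 1 / Suc n"
    by metis
  have unH: "un n \<in> H1" for n using un(1) VH by auto
  have "dirichlet (un n) (un n) + inner_L2 (un n) (un n) \<le> c + 1 + C + 1" for n
  proof -
    have "1 / real (Suc n) \<le> 1" by simp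
    moreover have "dirichlet (un n) (un n) - C \<le> energy W (un n) (un n)" using C(2)[OF unH, of n] un(2)[of n] by simp
    ultimately show ?thesis using un(2,3)[of n] by linarith
  qed
  from bounded_subsequence_converges[of un, OF unH this] obtain r u where r: "strict_mono (r :: nat \<Rightarrow> nat)"
    and u: "edge_continuous u" "\<And>e x. \<not> (e \<in> arcs G \<and> x \<in> {0..len e}) \<Longrightarrow> u e x = 0"
      "\<And>\<delta>. \<delta> > 0 \<Longrightarrow> \<exists>N. \<forall>n\<ge>N. close \<delta> (un (r n)) u" by blast
  have ec: "edge_continuous (un (r n))" for n by (rule H1_edge_continuous[OF unH])
  have "(\<lambda>n. inner_L2 (un (r n)) (un (r n))) \<longlonglongrightarrow> inner_L2 u u"
    by (rule weighted_inner_tendsto(1)[OF const_Linfty u(1) ec u(3)])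
  \<comment> \<open>Uniform convergence preserves the L^2 norm, so no mass is lost in the
    limit.\<close>
  then have nu: "inner_L2 u u = 1" unfolding un(2) using LIMSEQ_const_iff by metis
  have lsc: "\<exists>\<delta>>0. \<forall>w\<in>V. close \<delta> w u \<longrightarrow> c * inner_L2 u u - \<epsilon> \<le> c * inner_L2 w w" if "\<epsilon> > 0" for \<epsilon>
    using scaled_inner_L2_lsc[OF u(1) that, of c] VH H1_edge_continuous by blast
  have upper: "\<exists>N. \<forall>n\<ge>N. energy W (un (r n)) (un (r n)) \<le> c * inner_L2 u u + \<epsilon>" if \<epsilon>: "\<epsilon> > 0" for \<epsilon>
  proof -
    obtain N :: nat where N: "1 / real (Suc N) < \<epsilon>" using nat_approx_posE[OF \<epsilon>] by blast
    show "\<exists>N. \<forall>n\<ge>N. energy W (un (r n)) (un (r n)) \<le> c * inner_L2 u u + \<epsilon>"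
    proof (intro exI[of _ N] allI impI)
      fix n assume "n \<ge> N"
      then have "N \<le> r n" using seq_suble[OF r, of n] by linarith
      then have "1 / real (Suc (r n)) \<le> 1 / real (Suc N)" by (intro divide_left_mono) auto
      then show "energy W (un (r n)) (un (r n)) \<le> c * inner_L2 u u + \<epsilon>" using un(3)[of "r n"] N nu by simp
    qed
  qed
  note limit = minimizing_sequence_limit[OF W VH, where un="\<lambda>n. un (r n)" and \<Psi>="\<lambda>w. c * inner_L2 w w" and u=u,
    OF un(1) lincomb lower lsc upper u(3) u(2)]
  have uH: "u \<in> H1" by (rule limit(1))
  have le: "energy W u u \<le> c" using limit(2) nu by simp
  have "inner_L2 u (v i) = 0" if "i < n" for i
  proof -
    have "(\<lambda>k. inner_L2 (un (r k)) (v i)) \<longlonglongrightarrow> inner_L2 u (v i)"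
      using v[OF that] by (intro weighted_inner_tendsto(2)[OF const_Linfty u(1) ec u(3)] H1_edge_continuous)
    moreover have "inner_L2 (un (r k)) (v i) = 0" for k using un(1)[of "r k"] that by (auto simp: V)
    ultimately show ?thesis by (simp add: LIMSEQ_const_iff)
  qed
  then have "u \<in> V" using uH by (simp add: V)
  have "energy W u u * inner_L2 w w \<le> energy W w w" if "w \<in> V" for w
  proof -
    have "energy W u u * inner_L2 w w \<le> c * inner_L2 w w" using le inner_L2_nonneg by (rule mult_right_mono)
    then show ?thesis using lower[OF that] by linarith
  qed
  then show ?thesis using \<open>u \<in> V\<close> nu by blast
qed

text \<open>The form energy - c * inner_L2 is nonnegative on the span of u and w and vanishes at u,
  so the discriminant inequality forces its mixed term to be zero.\<close>

lemma minimizer_Euler_Lagrange: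
  assumes W: "W \<in> graph_Linfty G len" and u: "u \<in> H1" and w: "w \<in> H1"
    and min: "\<And>s t. c * inner_L2 (s *\<^sub>R u + t *\<^sub>R w) (s *\<^sub>R u + t *\<^sub>R w)
      \<le> energy W (s *\<^sub>R u + t *\<^sub>R w) (s *\<^sub>R u + t *\<^sub>R w)"
    and eq: "energy W u u = c * inner_L2 u u"
  shows "energy W u w = c * inner_L2 u w"
proof -
  have "0 \<le> s\<^sup>2 * (energy W w w - c * inner_L2 w w) + 2 * s * t * (energy W u w - c * inner_L2 u w) + t\<^sup>2 * 0" for s t
    using min[of t s] energy_square[OF W u w, of t s]
      weighted_inner_square[OF const_Linfty H1_edge_continuous[OF u] H1_edge_continuous[OF w], of 1 t s] eq
    by (simp add: algebra_simps)
  from discriminant_of_nonneg_form[OF this] show ?thesis by simp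
qed

text \<open>Each v n minimises the Rayleigh quotient among functions orthogonal to all earlier ones;
  infinite dimension guarantees a nonzero competitor at every stage.\<close>

lemma spectral_sequence:
  assumes W: "W \<in> graph_Linfty G len" and ne: "arcs G \<noteq> {}"
  obtains v :: "nat \<Rightarrow> 'e graph_fun" where "\<And>n. v n \<in> H1" "\<And>i j. inner_L2 (v i) (v j) = (if i = j then 1 else 0)"
    "\<And>n w. w \<in> H1 \<Longrightarrow> (\<forall>i<n. inner_L2 w (v i) = 0) \<Longrightarrow> energy W (v n) (v n) * inner_L2 w w \<le> energy W w w"
proof -
  let ?P = "\<lambda>v n r. r \<in> H1 \<and> inner_L2 r r = 1 \<and> (\<forall>i<n. inner_L2 r (v i) = 0)
    \<and> (\<forall>w\<in>H1. (\<forall>i<n. inner_L2 w (v i) = 0) \<longrightarrow> energy W r r * inner_L2 w w \<le> energy W w w)"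
  have "\<exists>v. \<forall>n::nat. ?P v n (v n)"
  proof (rule dependent_wellorder_choice)
    show "?P f n r = ?P g n r" if "\<And>i. i < n \<Longrightarrow> f i = g i" for r f g and n :: nat using that by auto
    fix n :: nat and v assume IH: "\<And>i. i < n \<Longrightarrow> ?P v i (v i)"
    have vH: "v i \<in> H1" if "i < n" for i using IH[OF that] by blast
    have on: "inner_L2 (v i) (v j) = (if i = j then 1 else 0)" if "i < n" "j < n" for i j
      using IH[OF that(1)] IH[OF that(2)] by (cases i j rule: linorder_cases) (auto simp: weighted_inner_commute)
    obtain B where B: "finite B" "B \<subseteq> H1" "independent B" "card B = Suc n"
      by (rule H1_infinite_dimensional[OF ne]) blast
    \<comment> \<open>Suc n independent functions do not fit into the span of n; a Gram-Schmidt step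
      then makes a leftover function orthogonal to the earlier v i.\<close>
    have "\<not> B \<subseteq> span (v ` {..<n})"
    proof
      assume "B \<subseteq> span (v ` {..<n})"
      then have "card B \<le> card (v ` {..<n})" using independent_span_bound[OF _ B(3)] by blast
      also have "\<dots> \<le> n" using card_image_le[of "{..<n}" v] by simp
      finally show False using B(4) by simp
    qed
    then obtain b where b: "b \<in> H1" "b \<notin> span (v ` {..<n})" using B(2) by blast
    define u0 where "u0 = b - (\<Sum>i<n. inner_L2 b (v i) *\<^sub>R v i)"
    have sH: "(\<Sum>i<n. inner_L2 b (v i) *\<^sub>R v i) \<in> H1" by (rule H1_sum) (use vH in auto)
    have "(\<Sum>i<n. inner_L2 b (v i) *\<^sub>R v i) \<in> span (v ` {..<n})"
      by (intro span_sum span_scale span_base) auto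
    then have "u0 \<noteq> 0" using b(2) by (auto simp: u0_def)
    moreover have "inner_L2 u0 (v j) = 0" if j: "j < n" for j
    proof -
      have "inner_L2 u0 (v j) = inner_L2 b (v j) - inner_L2 (\<Sum>i<n. inner_L2 b (v i) *\<^sub>R v i) (v j)"
        using weighted_inner_lincomb[OF const_Linfty H1_edge_continuous[OF b(1)] H1_edge_continuous[OF sH]
            H1_edge_continuous[OF vH[OF j]], of 1 1 "-1"] by (simp add: u0_def)
      also have "inner_L2 (\<Sum>i<n. inner_L2 b (v i) *\<^sub>R v i) (v j) = (\<Sum>i<n. inner_L2 b (v i) * inner_L2 (v i) (v j))"
        using vH j by (intro inner_L2_sum) auto
      also have "\<dots> = (\<Sum>i<n. if i = j then inner_L2 b (v j) else 0)" using on j by (intro sum.cong) auto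
      finally show ?thesis using j by simp
    qed
    moreover have "u0 \<in> H1" unfolding u0_def by (intro H1_diff b(1) sH)
    ultimately show "\<exists>r. ?P v n r"
      using constrained_minimizer[where z=u0 and n=n and v=v, OF W vH refl] by auto
  qed
  then obtain v where v: "\<And>n::nat. ?P v n (v n)" by blast
  show ?thesis
  proof (rule that[of v])
    show "v n \<in> H1" for n using v[of n] by blast
    show "inner_L2 (v i) (v j) = (if i = j then 1 else 0)" for i j
      using v[of i] v[of j] by (cases i j rule: linorder_cases) (auto simp: weighted_inner_commute)
    show "energy W (v n) (v n) * inner_L2 w w \<le> energy W w w"
      if "w \<in> H1" "\<forall>i<n. inner_L2 w (v i) = 0" for n w using v[of n] that by blast
  qed
qed

end

text \<open>At the first index n of disagreement, say s n < s' n, monotonicity lets s' take the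
  value s n only at indices below n, where it agrees with s. It takes it strictly less often,
  although both counts are the same multiplicity. This gives meaning to \<open>THE\<close> in
  \<open>eigenvalue\<close>.\<close>

lemma eigenvalue_listing_unique:
  assumes "eigenvalue_listing G len W s" "eigenvalue_listing G len W s'"
  shows "s = s'"
proof (rule ccontr)
  assume "s \<noteq> s'"
  then have ex: "\<exists>n. s n \<noteq> s' n" by auto
  define n where "n = (LEAST n. s n \<noteq> s' n)"
  have ne: "s n \<noteq> s' n" unfolding n_def using ex by (rule LeastI_ex)
  have eq: "s k = s' k" if "k < n" for k using not_less_Least[of k "\<lambda>n. s n \<noteq> s' n"] that by (auto simp: n_def)
  have False if L: "eigenvalue_listing G len W s" "eigenvalue_listing G len W s'"
    and eq: "\<And>k. k < n \<Longrightarrow> s k = s' k" and less: "s n < s' n" for s s'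
  proof -
    have fin: "finite {k. s k = s n}" and card: "card {k. s k = s n} = card {k. s' k = s n}" and mono: "mono s'"
      using L unfolding eigenvalue_listing_def by (metis enat.inject)+
    have "{k. s' k = s n} \<subseteq> {k. s k = s n} - {n}"
    proof
      fix k assume k: "k \<in> {k. s' k = s n}"
      have "k < n"
      proof (rule ccontr)
        assume "\<not> k < n"
        then have "s' n \<le> s' k" using mono by (simp add: monoD)
        then show False using k less by simp
      qed
      then show "k \<in> {k. s k = s n} - {n}" using k eq by auto
    qed
    then have "card {k. s' k = s n} \<le> card ({k. s k = s n} - {n})" using fin by (intro card_mono) auto
    also have "\<dots> < card {k. s k = s n}" using fin by (intro card_Diff1_less) auto
    finally show False using card by simp
  qed
  from this[OF assms eq] this[OF assms(2,1) eq[symmetric]] ne show False by (cases "s n" "s' n" rule: linorder_cases) auto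
qed

context compact_metric_graph
begin

text \<open>The successive minima are the listing: each minimiser is an eigenfunction, the minima
  are unbounded by compactness, and an eigenfunction orthogonal to all v k vanishes by the minimum
  property at a level above its eigenvalue. Indices start at 0, so \<mu> n is the eigenvalue
  numbered n + 1.\<close>

theorem spectral_theorem:
  assumes W: "W \<in> graph_Linfty G len" and ne: "arcs G \<noteq> {}"
  obtains v \<mu> where "\<And>i j. inner_L2 (v i) (v j) = (if i = j then 1 else 0)"
    "\<And>n. weak_eigenfunction W (\<mu> n) (v n)" "mono \<mu>"
    "\<And>w. w \<in> H1 \<Longrightarrow> \<mu> 0 * inner_L2 w w \<le> energy W w w"
    "\<And>n. eigenvalue G len W (Suc n) = \<mu> n"
proof -
  obtain v :: "nat \<Rightarrow> 'e graph_fun" where vH: "\<And>n. v n \<in> H1" and on: "\<And>i j. inner_L2 (v i) (v j) = (if i = j then 1 else 0)"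
    and vmin: "\<And>n w. w \<in> H1 \<Longrightarrow> (\<forall>i<n. inner_L2 w (v i) = 0) \<Longrightarrow> energy W (v n) (v n) * inner_L2 w w \<le> energy W w w"
    by (rule spectral_sequence[OF W ne]) blast
  define \<mu> where "\<mu> n = energy W (v n) (v n)" for n
  have diff_inner: "inner_L2 (u - w) x = inner_L2 u x - inner_L2 w x" if "u \<in> H1" "w \<in> H1" "x \<in> H1" for u w x
    using weighted_inner_lincomb[OF const_Linfty H1_edge_continuous[OF that(1)] H1_edge_continuous[OF that(2)]
      H1_edge_continuous[OF that(3)], of 1 1 "-1"] by simp
  have diff_energy: "energy W (u - w) x = energy W u x - energy W w x" if "u \<in> H1" "w \<in> H1" "x \<in> H1" for u w x
    using energy_lincomb[OF W that, of 1 "-1"] by simp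
  have proj: "(\<Sum>i\<in>A. inner_L2 u (v i) *\<^sub>R v i) \<in> H1" for A u by (rule H1_sum) (rule vH)
  have proj_inner: "inner_L2 (u - (\<Sum>i\<in>A. inner_L2 u (v i) *\<^sub>R v i)) (v j) = (if j \<in> A then 0 else inner_L2 u (v j))"
    if "finite A" "u \<in> H1" for A u j
  proof -
    have "inner_L2 (\<Sum>i\<in>A. inner_L2 u (v i) *\<^sub>R v i) (v j) = (\<Sum>i\<in>A. inner_L2 u (v i) * inner_L2 (v i) (v j))"
      by (intro inner_L2_sum that vH)
    also have "\<dots> = (\<Sum>i\<in>A. if i = j then inner_L2 u (v j) else 0)" using on by (intro sum.cong) auto
    also have "\<dots> = (if j \<in> A then inner_L2 u (v j) else 0)" using that(1) by simp
    finally show ?thesis using diff_inner[OF that(2) proj[of u A] vH[of j]] by simp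
  qed
  have weak: "weak_eigenfunction W (\<mu> n) (v n)" for n
  proof (induction n rule: less_induct)
    case (less n)
    \<comment> \<open>At first only for w orthogonal to the earlier eigenfunctions, since only there
      v n is known to minimise.\<close>
    have EL: "energy W (v n) w = \<mu> n * inner_L2 (v n) w" if w: "w \<in> H1" "\<forall>i<n. inner_L2 w (v i) = 0" for w
    proof (rule minimizer_Euler_Lagrange[OF W vH w(1)])
      show "energy W (v n) (v n) = \<mu> n * inner_L2 (v n) (v n)" by (simp add: on \<mu>_def)
      show "\<mu> n * inner_L2 (s *\<^sub>R v n + t *\<^sub>R w) (s *\<^sub>R v n + t *\<^sub>R w)
          \<le> energy W (s *\<^sub>R v n + t *\<^sub>R w) (s *\<^sub>R v n + t *\<^sub>R w)" for s t
        unfolding \<mu>_def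
      proof (rule vmin)
        show "s *\<^sub>R v n + t *\<^sub>R w \<in> H1" by (intro H1_linear_combination vH w)
        show "\<forall>i<n. inner_L2 (s *\<^sub>R v n + t *\<^sub>R w) (v i) = 0"
          using w(2) on by (simp add: weighted_inner_lincomb const_Linfty H1_edge_continuous vH w(1))
      qed
    qed
    show ?case unfolding weak_eigenfunction_def
    proof (intro conjI ballI vH)
      fix \<phi> assume \<phi>: "\<phi> \<in> H1"
      \<comment> \<open>Both forms vanish between v n and this projection, by the induction
        hypothesis and symmetry; so the equation extends from \<phi> - ?p to \<phi>.\<close>
      let ?p = "\<Sum>i<n. inner_L2 \<phi> (v i) *\<^sub>R v i"
      have "energy W ?p (v n) = (\<Sum>i<n. inner_L2 \<phi> (v i) * energy W (v i) (v n))"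
        by (intro energy_sum W vH) auto
      also have "\<dots> = 0"
        using less.IH vH on by (intro sum.neutral) (auto simp: weak_eigenfunction_def)
      finally have e0: "energy W ?p (v n) = 0" .
      have i0: "inner_L2 ?p (v n) = 0"
        using proj_inner[of "{..<n}" \<phi> n] diff_inner[OF \<phi> proj[of \<phi> "{..<n}"] vH[of n]] \<phi> by simp
      have "energy W (v n) (\<phi> - ?p) = \<mu> n * inner_L2 (v n) (\<phi> - ?p)"
        by (rule EL) (use proj_inner[of "{..<n}" \<phi>] \<phi> proj in \<open>auto intro!: H1_diff\<close>)
      then show "energy W (v n) \<phi> = \<mu> n * inner_L2 (v n) \<phi>"
        using diff_energy[OF \<phi> proj[of \<phi> "{..<n}"] vH[of n]] diff_inner[OF \<phi> proj[of \<phi> "{..<n}"] vH[of n]] e0 i0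
        by (simp add: energy_commute[of W "v n"] weighted_inner_commute[of _ "v n"])
    qed
  qed
  have mono: "mono \<mu>"
  proof (rule mono_iff_le_Suc[THEN iffD2], rule allI)
    fix n
    show "\<mu> n \<le> \<mu> (Suc n)" using vmin[OF vH, of n "Suc n"] on by (simp add: \<mu>_def)
  qed
  have unbounded: "\<exists>n. \<mu> n > x" for x
  proof (rule ccontr)
    assume "\<not> ?thesis"
    then have le: "\<mu> n \<le> x" for n by (auto simp: not_less)
    obtain C where C: "C > 0" "\<And>u. u \<in> H1 \<Longrightarrow> dirichlet u u - C * inner_L2 u u \<le> energy W u u"
      by (rule energy_lower_bound[OF W]) blast
    have "dirichlet (v n) (v n) + inner_L2 (v n) (v n) \<le> x + C + 1" for n
      using C(2)[OF vH[of n]] le[of n] on by (simp add: \<mu>_def)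
    from bounded_subsequence_converges[of v, OF vH this] obtain r g where r: "strict_mono (r :: nat \<Rightarrow> nat)"
      and "edge_continuous g" "\<And>e x. \<not> (e \<in> arcs G \<and> x \<in> {0..len e}) \<Longrightarrow> g e x = 0"
      and g: "\<And>\<delta>. \<delta> > 0 \<Longrightarrow> \<exists>N. \<forall>n\<ge>N. close \<delta> (v (r n)) g" by blast
    obtain K where K: "K \<ge> 0" "\<And>w \<delta>. edge_continuous w \<Longrightarrow> close \<delta> w 0 \<Longrightarrow> \<delta> \<ge> 0 \<Longrightarrow> \<bar>inner_L2 w w\<bar> \<le> K * \<delta>\<^sup>2"
      by (rule weighted_inner_small[OF const_Linfty]) blast
    \<comment> \<open>Two distinct orthonormal functions have squared distance 2. Uniform distance
      at most 2 * \<delta> would make it at most K / (K + 1) \<le> 1.\<close>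
    define \<delta> where "\<delta> = 1 / (2 * sqrt (K + 1))"
    have \<delta>: "\<delta> > 0" "(2 * \<delta>)\<^sup>2 = 1 / (K + 1)" using K(1) by (auto simp: \<delta>_def power_divide)
    obtain N where N: "\<forall>n\<ge>N. close \<delta> (v (r n)) g" using g[OF \<delta>(1)] by blast
    let ?w = "v (r N) - v (r (Suc N))"
    have neq: "r N \<noteq> r (Suc N)" using r by (metis n_not_Suc_n strict_mono_eq)
    have "inner_L2 ?w ?w = 2"
    proof -
      have "inner_L2 ?w ?w = inner_L2 (v (r N)) ?w - inner_L2 (v (r (Suc N))) ?w"
        by (intro diff_inner vH H1_diff)
      also have "\<dots> = 2"
        using diff_inner[OF vH[of "r N"] vH[of "r (Suc N)"] vH] neq on
        by (simp add: weighted_inner_commute[of _ _ ?w])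
      finally show ?thesis .
    qed
    moreover have "close (2 * \<delta>) ?w 0" unfolding close_def
    proof (intro ballI)
      fix e x assume "e \<in> arcs G" "x \<in> {0..len e}"
      then have "\<bar>v (r N) e x - g e x\<bar> \<le> \<delta>" "\<bar>v (r (Suc N)) e x - g e x\<bar> \<le> \<delta>" using N by (auto simp: close_def)
      then show "\<bar>?w e x - 0 e x\<bar> \<le> 2 * \<delta>" by (simp add: abs_le_iff)
    qed
    then have "\<bar>inner_L2 ?w ?w\<bar> \<le> K * (2 * \<delta>)\<^sup>2"
      using \<delta>(1) by (intro K(2) H1_edge_continuous H1_diff vH) auto
    moreover have "K * (2 * \<delta>)\<^sup>2 \<le> 1" using \<delta>(2) K(1) by simp
    ultimately show False by simp
  qed
  have listing: "eigenvalue_listing G len W \<mu>"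
    unfolding eigenvalue_listing_def
  proof (intro conjI allI mono)
    fix m
    obtain N where N: "\<mu> N > m" using unbounded by blast
    have sub: "{k. \<mu> k = m} \<subseteq> {..<N}"
    proof
      fix k assume "k \<in> {k. \<mu> k = m}"
      then have "\<mu> k < \<mu> N" using N by simp
      then show "k \<in> {..<N}" using monoD[OF mono, of N k] by (auto simp: not_less[symmetric])
    qed
    then show fin: "finite {k. \<mu> k = m}" using finite_subset by blast
    let ?T = "v ` {k. \<mu> k = m}"
    have inj: "inj v"
    proof (rule injI)
      fix i j assume "v i = v j"
      then show "i = j" using on[of i j] on[of j j] by (auto split: if_splits)
    qed
    have "edim (eigenspace G len W m) = enat (card ?T)"
    proof (rule edim_eqI)
      show "finite ?T" using fin by simp
      show "independent ?T"
      proof (rule orthogonal_independent)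
        show "0 \<notin> ?T"
        proof
          assume "0 \<in> ?T"
          then obtain k where "v k = 0" by auto
          then show False using on[of k k] by (simp add: weighted_inner_def graph_integral_def)
        qed
      qed (use fin vH on in auto)
      show "?T \<subseteq> eigenspace G len W m" using weak by (auto simp: eigenspace_iff_weak[OF W])
      show "eigenspace G len W m \<subseteq> span ?T"
      proof
        fix u assume "u \<in> eigenspace G len W m"
        then have u: "u \<in> H1" and we: "\<And>\<phi>. \<phi> \<in> H1 \<Longrightarrow> energy W u \<phi> = m * inner_L2 u \<phi>"
          by (auto simp: eigenspace_iff_weak[OF W] weak_eigenfunction_def)
        let ?p = "\<Sum>k\<in>{k. \<mu> k = m}. inner_L2 u (v k) *\<^sub>R v k"
        define w where "w = u - ?p"
        have w: "w \<in> H1" unfolding w_def by (intro H1_diff u proj)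
        have ww: "energy W w \<phi> = m * inner_L2 w \<phi>" if \<phi>: "\<phi> \<in> H1" for \<phi>
        proof -
          have "energy W ?p \<phi> = (\<Sum>k\<in>{k. \<mu> k = m}. inner_L2 u (v k) * energy W (v k) \<phi>)"
            by (intro energy_sum W fin vH \<phi>)
          also have "\<dots> = (\<Sum>k\<in>{k. \<mu> k = m}. m * (inner_L2 u (v k) * inner_L2 (v k) \<phi>))"
            using weak \<phi> by (intro sum.cong refl) (auto simp: weak_eigenfunction_def)
          also have "\<dots> = m * inner_L2 ?p \<phi>"
            using inner_L2_sum[OF fin vH \<phi>] by (simp add: sum_distrib_left)
          finally show ?thesis
            using we[OF \<phi>] diff_energy[OF u proj \<phi>] diff_inner[OF u proj \<phi>]
            by (simp add: w_def right_diff_distrib)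
        qed
        \<comment> \<open>For \<mu> j = m the projection has been removed; for \<mu> j \<noteq> m
          orthogonality follows from symmetry of the energy.\<close>
        have orth: "inner_L2 w (v j) = 0" for j
        proof (cases "\<mu> j = m")
          case True
          then show ?thesis using proj_inner[OF fin u, of j] by (simp add: w_def)
        next
          case False
          have "m * inner_L2 w (v j) = \<mu> j * inner_L2 w (v j)"
            using ww[OF vH, of j] weak[of j] w
            by (auto simp: weak_eigenfunction_def energy_commute[of W w] weighted_inner_commute[of _ w])
          then show ?thesis using False by simp
        qed
        \<comment> \<open>w competes in the minimisation at stage N, where the minimum \<mu> N
          exceeds m.\<close>
        have "\<mu> N * inner_L2 w w \<le> m * inner_L2 w w"
          using vmin[OF w, of N] orth ww[OF w] by (simp add: \<mu>_def)
        then have "inner_L2 w w \<le> 0"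
          using N by (metis inner_L2_nonneg mult_le_cancel_right not_le)
        then have "w = 0" using inner_L2_pos[OF w] by fastforce
        then have "u = ?p" by (simp add: w_def)
        also have "?p \<in> span ?T" by (intro span_sum span_scale span_base) auto
        finally show "u \<in> span ?T" .
      qed
    qed
    also have "card ?T = card {k. \<mu> k = m}" using inj by (intro card_image) (auto intro: inj_on_subset)
    finally show "enat (card {k. \<mu> k = m}) = edim (eigenspace G len W m)" by simp
  qed
  then have "(THE s. eigenvalue_listing G len W s) = \<mu>"
    using eigenvalue_listing_unique by (intro the_equality) auto
  then have ev: "eigenvalue G len W (Suc n) = \<mu> n" for n by (simp add: eigenvalue_def)
  have bottom: "\<mu> 0 * inner_L2 w w \<le> energy W w w" if "w \<in> H1" for w
    using vmin[OF that, of 0] by (simp add: \<mu>_def)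
  show ?thesis by (rule that[of v \<mu>]) (use on weak mono bottom ev in auto)
qed

end

section \<open>Taylor expansion of powers\<close>

lemma continuous_abs_powr: "q > 0 \<Longrightarrow> continuous_on S (\<lambda>x::real. \<bar>x\<bar> powr q)"
  by (intro continuous_on_powr' continuous_intros) auto

text \<open>Away from 0 this is the power rule; at 0 the difference quotient is |h|^q itself, which
  tends to 0.\<close>

lemma abs_powr_mult_deriv:
  fixes q x :: real
  assumes "q > 0"
  shows "((\<lambda>x. \<bar>x\<bar> powr q * x) has_real_derivative (q + 1) * \<bar>x\<bar> powr q) (at x)"
proof (cases x "0::real" rule: linorder_cases)
  case less
  have "((\<lambda>x. (- x) powr q * x) has_real_derivative (q + 1) * \<bar>x\<bar> powr q) (at x)"
    using less powr_diff[of "- x" q 1] by (auto intro!: derivative_eq_intros simp: field_simps)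
  then show ?thesis
    by (rule has_field_derivative_transform_within_open[of _ _ _ "{..<0}"]) (use less in auto)
next
  case greater
  have "((\<lambda>x. x powr q * x) has_real_derivative (q + 1) * \<bar>x\<bar> powr q) (at x)"
    using greater powr_diff[of x q 1] by (auto intro!: derivative_eq_intros simp: field_simps)
  then show ?thesis
    by (rule has_field_derivative_transform_within_open[of _ _ _ "{0<..}"]) (use greater in auto)
next
  case equal
  have "isCont (\<lambda>x::real. \<bar>x\<bar> powr q) 0"
    using continuous_abs_powr[OF assms, of UNIV] by (simp add: continuous_on_eq_continuous_at)
  then have "((\<lambda>h::real. \<bar>h\<bar> powr q) \<longlongrightarrow> 0) (at 0)" using assms by (simp add: isCont_def)
  then have "((\<lambda>h. (\<bar>0 + h\<bar> powr q * (0 + h) - \<bar>0\<bar> powr q * 0) / h) \<longlongrightarrow> 0) (at (0::real))"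
    by (rule Lim_transform_eventually) (auto simp: eventually_at_filter)
  then show ?thesis using equal assms by (simp add: DERIV_def)
qed

lemma abs_powr_deriv:
  fixes p x :: real
  assumes "p > 2"
  shows "((\<lambda>x. \<bar>x\<bar> powr p) has_real_derivative p * (\<bar>x\<bar> powr (p - 2) * x)) (at x)"
proof (cases x "0::real" rule: linorder_cases)
  case less
  have "((\<lambda>x. (- x) powr p) has_real_derivative p * (\<bar>x\<bar> powr (p - 2) * x)) (at x)"
    using less powr_diff[of "- x" "p - 1" 1] by (auto intro!: derivative_eq_intros simp: field_simps)
  then show ?thesis
    by (rule has_field_derivative_transform_within_open[of _ _ _ "{..<0}"]) (use less in auto)
next
  case greater
  have "((\<lambda>x. x powr p) has_real_derivative p * (\<bar>x\<bar> powr (p - 2) * x)) (at x)"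
    using greater powr_diff[of x "p - 1" 1] by (auto intro!: derivative_eq_intros simp: field_simps)
  then show ?thesis
    by (rule has_field_derivative_transform_within_open[of _ _ _ "{0<..}"]) (use greater in auto)
next
  case equal
  have "isCont (\<lambda>x::real. \<bar>x\<bar> powr (p - 2) * x) 0"
    using continuous_on_mult[OF continuous_abs_powr continuous_on_id, of "p - 2" UNIV] assms
    by (simp add: continuous_on_eq_continuous_at)
  then have lim: "((\<lambda>h::real. \<bar>h\<bar> powr (p - 2) * h) \<longlongrightarrow> 0) (at 0)" by (simp add: isCont_def)
  have eq: "\<bar>h\<bar> powr (p - 2) * h = \<bar>h\<bar> powr p / h" if "h \<noteq> 0" for h :: real
  proof -
    have "\<bar>h\<bar> powr p = \<bar>h\<bar> powr (p - 2) * h\<^sup>2"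
      using that powr_add[of "\<bar>h\<bar>" "p - 2" 2] by (simp add: powr_numeral)
    then show ?thesis using that by (simp add: power2_eq_square)
  qed
  have "((\<lambda>h. (\<bar>0 + h\<bar> powr p - \<bar>0\<bar> powr p) / h) \<longlongrightarrow> 0) (at (0::real))"
    by (rule Lim_transform_eventually[OF lim]) (simp add: eventually_at_filter eq)
  then show ?thesis using equal assms by (simp add: DERIV_def)
qed

text \<open>The remainder is \<epsilon> h^2 and not cubic, because for p < 3 the second derivative
  is merely Hoelder continuous at 0. Uniform continuity of the second derivative F2 and two
  applications of the mean value inequality, to G1 and then to G0, suffice, and \<delta> is uniform
  in a.\<close>

lemma abs_powr_Taylor:
  fixes p M \<epsilon> :: real
  assumes "p > 2" "\<epsilon> > 0"
  obtains \<delta> where "\<delta> > 0" "\<And>a h. \<bar>a\<bar> \<le> M \<Longrightarrow> \<bar>h\<bar> \<le> \<delta>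
    \<Longrightarrow> \<bar>\<bar>a + h\<bar> powr p - \<bar>a\<bar> powr p - p * (\<bar>a\<bar> powr (p - 2) * a) * h
      - p * (p - 1) / 2 * \<bar>a\<bar> powr (p - 2) * h\<^sup>2\<bar> \<le> \<epsilon> * h\<^sup>2"
proof -
  define F2 where "F2 x = p * (p - 1) * \<bar>x\<bar> powr (p - 2)" for x :: real
  define F1 where "F1 x = p * (\<bar>x\<bar> powr (p - 2) * x)" for x :: real
  have D1: "((\<lambda>x. \<bar>x\<bar> powr p) has_real_derivative F1 x) (at x)" for x
    unfolding F1_def using assms(1) by (rule abs_powr_deriv)
  have D2: "(F1 has_real_derivative F2 x) (at x)" for x
    unfolding F1_def[abs_def] F2_def
    using DERIV_cmult[OF abs_powr_mult_deriv[of "p - 2" x], of p] assms(1) by (simp add: mult.assoc)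
  have "continuous_on {- \<bar>M\<bar> - 1..\<bar>M\<bar> + 1} F2"
    unfolding F2_def using assms(1) by (intro continuous_intros continuous_abs_powr) auto
  then have "uniformly_continuous_on {- \<bar>M\<bar> - 1..\<bar>M\<bar> + 1} F2" by (rule compact_uniformly_continuous) simp
  then obtain d where d: "d > 0" "\<And>x y. x \<in> {- \<bar>M\<bar> - 1..\<bar>M\<bar> + 1} \<Longrightarrow> y \<in> {- \<bar>M\<bar> - 1..\<bar>M\<bar> + 1}
      \<Longrightarrow> dist y x < d \<Longrightarrow> dist (F2 y) (F2 x) < \<epsilon>"
    using \<open>\<epsilon> > 0\<close> unfolding uniformly_continuous_on_def by metis
  \<comment> \<open>At most 1, to remain in the compact interval; d / 2, to have the strict
    inequality in the modulus of continuity.\<close>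
  define \<delta> where "\<delta> = min 1 (d / 2)"
  have "\<delta> > 0" using d(1) by (simp add: \<delta>_def)
  moreover have "\<bar>\<bar>a + h\<bar> powr p - \<bar>a\<bar> powr p - F1 a * h - F2 a / 2 * h\<^sup>2\<bar> \<le> \<epsilon> * h\<^sup>2"
    if a: "\<bar>a\<bar> \<le> M" and h: "\<bar>h\<bar> \<le> \<delta>" for a h
  proof -
    let ?S = "{- \<bar>h\<bar>..\<bar>h\<bar>}"
    have h1: "\<bar>h\<bar> \<le> 1" "\<bar>h\<bar> \<le> d / 2" using h by (auto simp: \<delta>_def)
    define G1 where "G1 s = F1 (a + s) - F1 a - F2 a * s" for s
    define G0 where "G0 s = \<bar>a + s\<bar> powr p - \<bar>a\<bar> powr p - F1 a * s - F2 a / 2 * s\<^sup>2" for s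
    have shift: "((\<lambda>s. a + s) has_real_derivative 1) (at s)" for s by (auto intro!: derivative_eq_intros)
    have d1: "(G1 has_real_derivative F2 (a + s) - F2 a) (at s within ?S)" for s
    proof -
      have "((\<lambda>s. F1 (a + s) - F1 a - F2 a * s) has_real_derivative F2 (a + s) * 1 - 0 - F2 a * 1) (at s)"
        by (intro DERIV_diff DERIV_const DERIV_cmult DERIV_ident DERIV_chain2[where f=F1 and g="\<lambda>s. a + s", OF D2 shift])
      then show ?thesis unfolding G1_def[abs_def] by (rule_tac has_field_derivative_at_within) simp
    qed
    have d0: "(G0 has_real_derivative G1 s) (at s within ?S)" for s
    proof -
      have sq: "((\<lambda>s::real. s\<^sup>2) has_real_derivative 2 * s) (at s)" by (auto intro!: derivative_eq_intros)
      have "((\<lambda>s. \<bar>a + s\<bar> powr p - \<bar>a\<bar> powr p - F1 a * s - F2 a / 2 * s\<^sup>2)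
          has_real_derivative F1 (a + s) * 1 - 0 - F1 a * 1 - F2 a / 2 * (2 * s)) (at s)"
        by (intro DERIV_diff DERIV_const DERIV_cmult DERIV_ident sq
          DERIV_chain2[where f="\<lambda>x. \<bar>x\<bar> powr p" and g="\<lambda>s. a + s", OF D1 shift])
      then show ?thesis unfolding G0_def[abs_def] G1_def by (rule_tac has_field_derivative_at_within) simp
    qed
    have b1: "\<bar>G1 s\<bar> \<le> \<epsilon> * \<bar>h\<bar>" if s: "s \<in> ?S" for s
    proof -
      have "norm (G1 s - G1 0) \<le> \<epsilon> * norm (s - 0)"
      proof (rule field_differentiable_bound[OF _ d1])
        fix t assume t: "t \<in> ?S"
        have "dist (F2 (a + t)) (F2 a) < \<epsilon>"
          using t a h1 d(1) by (intro d(2)) (auto simp: dist_real_def)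
        then show "norm (F2 (a + t) - F2 a) \<le> \<epsilon>" by (simp add: dist_real_def)
      qed (use s in auto)
      also have "\<dots> \<le> \<epsilon> * \<bar>h\<bar>" using s \<open>\<epsilon> > 0\<close> by (intro mult_left_mono) auto
      finally show ?thesis by (simp add: G1_def)
    qed
    have "norm (G0 h - G0 0) \<le> (\<epsilon> * \<bar>h\<bar>) * norm (h - 0)"
      by (rule field_differentiable_bound[OF _ d0]) (use b1 in auto)
    then have "\<bar>G0 h\<bar> \<le> \<epsilon> * (\<bar>h\<bar> * \<bar>h\<bar>)" by (simp add: G0_def mult.assoc)
    then show ?thesis by (simp add: G0_def power2_eq_square)
  qed
  ultimately show ?thesis using that[of \<delta>] by (simp add: F1_def F2_def)
qed

text \<open>First and second order conditions at a minimum of \<open>(c + 2 t b + t\<^sup>2 Q) - c n(t)\<^bsup>2/p\<^esup>\<close> at \<open>t = 0\<close>.\<close>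
lemma variation_conditions:
  fixes p c A V b Q :: real and n :: "real \<Rightarrow> real"
  assumes p: "p > 2" and c: "c > 0" and n0: "\<And>t. 0 \<le> n t"
    and expand: "\<And>\<epsilon>. \<epsilon> > 0 \<Longrightarrow> \<exists>\<delta>>0. \<forall>t. \<bar>t\<bar> \<le> \<delta> \<longrightarrow> \<bar>n t - 1 - p * A * t - p * (p - 1) / 2 * V * t\<^sup>2\<bar> \<le> \<epsilon> * t\<^sup>2"
    and le: "\<And>t. c * n t powr (2 / p) \<le> c + 2 * t * b + t\<^sup>2 * Q"
  shows "b = c * A" and "A = 0 \<Longrightarrow> c * (p - 1) * V \<le> Q"
proof -
  \<comment> \<open>The inequality solved for n: n t \<le> y t powr (p / 2), with equality at t =
    0.\<close>
  define y where "y t = 1 + (2 * t * b + t\<^sup>2 * Q) / c" for t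
  have n_le: "n t \<le> y t powr (p / 2)" for t
  proof -
    have "n t powr (2 / p) \<le> y t" using le[of t] c by (simp add: y_def field_simps)
    then have "(n t powr (2 / p)) powr (p / 2) \<le> y t powr (p / 2)" using p by (intro powr_mono2) auto
    then show ?thesis using p n0[of t] by (simp add: powr_powr)
  qed
  have n_at_0: "n 0 = 1"
  proof -
    obtain \<delta> where "\<delta> > 0" "\<forall>t. \<bar>t\<bar> \<le> \<delta> \<longrightarrow> \<bar>n t - 1 - p * A * t - p * (p - 1) / 2 * V * t\<^sup>2\<bar> \<le> 1 * t\<^sup>2"
      using expand[of 1] by auto
    then have "\<bar>n 0 - 1 - p * A * 0 - p * (p - 1) / 2 * V * 0\<^sup>2\<bar> \<le> 1 * 0\<^sup>2" by (metis abs_zero less_imp_le)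
    then show ?thesis by simp
  qed
  have yd: "((\<lambda>t. y t powr (p / 2)) has_real_derivative p * b / c) (at 0)"
    unfolding y_def using c by (auto intro!: derivative_eq_intros)
  have nd: "(n has_real_derivative p * A) (at 0)"
    unfolding DERIV_def
  proof (rule LIM_I)
    fix r :: real assume "r > 0"
    obtain \<delta> where \<delta>: "\<delta> > 0" "\<And>t. \<bar>t\<bar> \<le> \<delta> \<Longrightarrow> \<bar>n t - 1 - p * A * t - p * (p - 1) / 2 * V * t\<^sup>2\<bar> \<le> 1 * t\<^sup>2"
      using expand[of 1] by auto
    define K where "K = p * (p - 1) / 2 * \<bar>V\<bar> + 1"
    have K: "K \<ge> 1" using p by (simp add: K_def)
    show "\<exists>s>0. \<forall>h. h \<noteq> 0 \<and> norm (h - 0) < s \<longrightarrow> norm ((n (0 + h) - n 0) / h - p * A) < r"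
    proof (intro exI[of _ "min \<delta> (r / K)"] conjI allI impI)
      show "0 < min \<delta> (r / K)" using \<delta>(1) \<open>r > 0\<close> K by simp
      fix h :: real assume h: "h \<noteq> 0 \<and> norm (h - 0) < min \<delta> (r / K)"
      have "\<bar>n h - 1 - p * A * h\<bar> \<le> \<bar>n h - 1 - p * A * h - p * (p - 1) / 2 * V * h\<^sup>2\<bar> + \<bar>p * (p - 1) / 2 * V * h\<^sup>2\<bar>"
        by linarith
      also have "\<dots> \<le> 1 * h\<^sup>2 + p * (p - 1) / 2 * \<bar>V\<bar> * h\<^sup>2"
        using \<delta>(2)[of h] h p by (intro add_mono) (auto simp: abs_mult)
      also have "\<dots> = K * h\<^sup>2" by (simp add: K_def algebra_simps)
      finally have "\<bar>n h - 1 - p * A * h\<bar> / \<bar>h\<bar> \<le> K * \<bar>h\<bar>"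
        using h by (simp add: divide_le_eq power2_eq_square abs_mult[symmetric] mult.assoc)
      also have "\<dots> < r" using h K by (simp add: pos_less_divide_eq mult.commute)
      also have "\<bar>n h - 1 - p * A * h\<bar> / \<bar>h\<bar> = \<bar>(n h - 1) / h - p * A\<bar>"
        using h by (simp add: abs_divide[symmetric] diff_divide_distrib)
      finally show "norm ((n (0 + h) - n 0) / h - p * A) < r" by (simp add: n_at_0)
    qed
  qed
  \<comment> \<open>First order: the difference of the two sides has a minimum at 0.\<close>
  have "p * b / c - p * A = 0"
  proof (rule DERIV_local_min)
    show "((\<lambda>t. y t powr (p / 2) - n t) has_real_derivative p * b / c - p * A) (at 0)"
      using yd nd by (rule DERIV_diff)
    show "(0::real) < 1" by simp
    show "\<forall>t. \<bar>0 - t\<bar> < 1 \<longrightarrow> y 0 powr (p / 2) - n 0 \<le> y t powr (p / 2) - n t"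
      using n_le by (simp add: n_at_0 y_def)
  qed
  then show b: "b = c * A" using p c by (simp add: field_simps)
  assume "A = 0"
  with b have "b = 0" by simp
  \<comment> \<open>Second order: for A = b = 0 the upper bound depends on t only through s = t^2,
    so a first derivative in s, from the right, is enough.\<close>
  have hd: "((\<lambda>s. (1 + s * Q / c) powr (p / 2)) has_real_derivative p * Q / (2 * c)) (at 0)"
    using c by (auto intro!: derivative_eq_intros)
  have lim: "((\<lambda>s. ((1 + s * Q / c) powr (p / 2) - 1) / s) \<longlongrightarrow> p * Q / (2 * c)) (at_right 0)"
    using hd unfolding DERIV_def by (auto intro: tendsto_within_subset)
  have "p * (p - 1) / 2 * V \<le> p * Q / (2 * c) + \<epsilon>" if \<epsilon>: "\<epsilon> > 0" for \<epsilon>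
  proof -
    obtain \<delta> where \<delta>: "\<delta> > 0" "\<And>t. \<bar>t\<bar> \<le> \<delta> \<Longrightarrow> \<bar>n t - 1 - p * A * t - p * (p - 1) / 2 * V * t\<^sup>2\<bar> \<le> \<epsilon> * t\<^sup>2"
      using expand[OF \<epsilon>] by auto
    have "\<forall>\<^sub>F s in at_right 0. s \<in> {0<..<\<delta>\<^sup>2}" using \<delta>(1) by (intro eventually_at_right_real) simp
    then have "\<forall>\<^sub>F s in at_right 0. p * (p - 1) / 2 * V - \<epsilon> \<le> ((1 + s * Q / c) powr (p / 2) - 1) / s"
    proof (rule eventually_mono)
      fix s assume s: "s \<in> {0<..<\<delta>\<^sup>2}"
      define t where "t = sqrt s"
      have t: "t\<^sup>2 = s" "\<bar>t\<bar> \<le> \<delta>" using s \<delta>(1) real_sqrt_le_mono[of s "\<delta>\<^sup>2"] by (auto simp: t_def)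
      have "p * (p - 1) / 2 * V * s - \<epsilon> * s \<le> n t - 1"
        using \<delta>(2)[OF t(2)] \<open>A = 0\<close> t(1) by (simp add: abs_le_iff)
      also have "\<dots> \<le> (1 + s * Q / c) powr (p / 2) - 1"
        using n_le[of t] t(1) \<open>b = 0\<close> by (simp add: y_def)
      finally show "p * (p - 1) / 2 * V - \<epsilon> \<le> ((1 + s * Q / c) powr (p / 2) - 1) / s"
        using s by (simp add: pos_le_divide_eq left_diff_distrib)
    qed
    then have "p * (p - 1) / 2 * V - \<epsilon> \<le> p * Q / (2 * c)"
      by (intro tendsto_lowerbound[OF lim]) auto
    then show ?thesis by linarith
  qed
  then have "p * (p - 1) / 2 * V \<le> p * Q / (2 * c)" by (rule field_le_epsilon)
  then have "p / (2 * c) * (c * (p - 1) * V) \<le> p / (2 * c) * Q" using c by (simp add: mult_ac)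
  moreover have "0 < p / (2 * c)" using p c by simp
  ultimately show "c * (p - 1) * V \<le> Q" by (simp only: mult_le_cancel_left_pos)
qed

context compact_metric_graph
begin

section \<open>The positive ground state\<close>

text \<open>|v| has the same weighted norms as v and no larger Dirichlet integral. As the modulus is
  not differentiable, it is approximated by sqrt (v^2 + \<eta>^2), whose derivative in v is at most
  1 in modulus. These approximations form a minimising sequence with uniform limit |v|, which is
  thus a minimiser in H^1.\<close>

lemma ground_state_abs:
  assumes W: "W \<in> graph_Linfty G len" and v: "v \<in> H1"
    and bottom: "\<And>w. w \<in> H1 \<Longrightarrow> c * inner_L2 w w \<le> energy W w w"
    and eq: "energy W v v = c * inner_L2 v v"
  shows "compose abs v \<in> H1" "weak_eigenfunction W c (compose abs v)"
proof -
  define \<eta> where "\<eta> n = 1 / real (Suc n)" for n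
  have \<eta>: "\<eta> n > 0" for n by (simp add: \<eta>_def)
  define w where "w n = compose (\<lambda>y. sqrt (y\<^sup>2 + (\<eta> n)\<^sup>2)) v" for n
  let ?w = "compose abs v"
  have pos: "y\<^sup>2 + (\<eta> n)\<^sup>2 > 0" for y n using \<eta>[of n] by (simp add: add_nonneg_pos)
  have der: "((\<lambda>y. sqrt (y\<^sup>2 + (\<eta> n)\<^sup>2)) has_real_derivative y / sqrt (y\<^sup>2 + (\<eta> n)\<^sup>2)) (at y)" for y n
    using pos[of y n] by (auto intro!: derivative_eq_intros simp: field_simps)
  have cont: "continuous_on S (\<lambda>y. y / sqrt (y\<^sup>2 + (\<eta> n)\<^sup>2))" for S n
    by (intro continuous_intros) (use \<eta>[of n] in auto)
  have wH: "w n \<in> H1" for n unfolding w_def by (rule compose_H1[OF v der cont])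
  have wD: "AE x in edge_measure (len e). D (w n) e x = v e x / sqrt ((v e x)\<^sup>2 + (\<eta> n)\<^sup>2) * D v e x"
    if "e \<in> arcs G" for n e
    unfolding w_def by (rule compose_H1(2)[OF v der cont that])
  have dle: "dirichlet (w n) (w n) \<le> dirichlet v v" for n
    unfolding dirichlet_def
  proof (rule gint_mono[OF dirichlet_integrable[OF wH wH] dirichlet_integrable[OF v v]])
    fix e assume "e \<in> arcs G"
    from wD[OF this, of n] show "AE x in edge_measure (len e). D (w n) e x * D (w n) e x \<le> D v e x * D v e x"
    proof eventually_elim
      case (elim x)
      have "(v e x / sqrt ((v e x)\<^sup>2 + (\<eta> n)\<^sup>2))\<^sup>2 \<le> 1"
        using pos[of "v e x" n] by (simp add: power_divide divide_le_eq)
      then have "(v e x / sqrt ((v e x)\<^sup>2 + (\<eta> n)\<^sup>2))\<^sup>2 * (D v e x)\<^sup>2 \<le> 1 * (D v e x)\<^sup>2"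
        by (intro mult_right_mono) auto
      then show ?case unfolding elim by (simp add: power_mult_distrib[symmetric] flip: power2_eq_square)
    qed
  qed
  have ec: "edge_continuous ?w"
    unfolding edge_continuous_def
  proof
    fix e assume e: "e \<in> arcs G"
    have "continuous_on {0..len e} (\<lambda>x. \<bar>v e x\<bar>)"
      using H1_edge_continuous[OF v] e by (auto simp: edge_continuous_def intro!: continuous_intros)
    then show "continuous_on {0..len e} (?w e)"
      by (rule continuous_on_eq) (use e in \<open>simp add: compose_def\<close>)
  qed
  have unif: "\<exists>N. \<forall>n\<ge>N. close \<delta> (w n) ?w" if \<delta>: "\<delta> > 0" for \<delta>
  proof -
    obtain N :: nat where N: "1 / real (Suc N) < \<delta>" using nat_approx_posE[OF \<delta>] by blast
    show ?thesis
    proof (intro exI[of _ N] allI impI)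
      fix n assume "n \<ge> N"
      then have "\<eta> n \<le> 1 / real (Suc N)" unfolding \<eta>_def by (intro divide_left_mono) auto
      then have le: "\<eta> n \<le> \<delta>" using N by simp
      have "\<bar>sqrt (y\<^sup>2 + (\<eta> n)\<^sup>2) - \<bar>y\<bar>\<bar> \<le> \<delta>" for y
      proof -
        have "sqrt (y\<^sup>2) \<le> sqrt (y\<^sup>2 + (\<eta> n)\<^sup>2)" by (rule real_sqrt_le_mono) simp
        moreover have "sqrt (y\<^sup>2 + (\<eta> n)\<^sup>2) \<le> \<bar>y\<bar> + \<eta> n"
          using \<eta>[of n] sqrt_add_le_add_sqrt[of "y\<^sup>2" "(\<eta> n)\<^sup>2"] by simp
        ultimately show ?thesis using le by simp
      qed
      then show "close \<delta> (w n) ?w" by (simp add: close_def w_def compose_def)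
    qed
  qed
  have sq: "weighted_inner b ?w ?w = weighted_inner b v v" for b
    unfolding weighted_inner_def by (intro gint_cong) (simp add: compose_def mult.assoc)
  have lsc: "\<exists>\<delta>>0. \<forall>x\<in>H1. close \<delta> x ?w \<longrightarrow> c * inner_L2 ?w ?w - \<epsilon> \<le> c * inner_L2 x x" if "\<epsilon> > 0" for \<epsilon>
    using scaled_inner_L2_lsc[OF ec that, of c] H1_edge_continuous by blast
  have upper: "\<exists>N. \<forall>n\<ge>N. energy W (w n) (w n) \<le> c * inner_L2 ?w ?w + \<epsilon>" if \<epsilon>: "\<epsilon> > 0" for \<epsilon>
  proof -
    obtain \<delta> where \<delta>: "\<delta> > 0"
      "\<And>x. edge_continuous x \<Longrightarrow> close \<delta> x ?w \<Longrightarrow> \<bar>weighted_inner W x x - weighted_inner W ?w ?w\<bar> \<le> \<epsilon>"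
      by (rule weighted_inner_continuous[OF W ec \<epsilon>]) blast
    obtain N where N: "\<forall>n\<ge>N. close \<delta> (w n) ?w" using unif[OF \<delta>(1)] by blast
    show ?thesis
    proof (intro exI[of _ N] allI impI)
      fix n assume "n \<ge> N"
      then have "close \<delta> (w n) ?w" using N by blast
      from \<delta>(2)[OF H1_edge_continuous[OF wH] this]
      show "energy W (w n) (w n) \<le> c * inner_L2 ?w ?w + \<epsilon>"
        using dle[of n] eq unfolding sq energy_def by linarith
    qed
  qed
  have out: "?w e x = 0" if "\<not> (e \<in> arcs G \<and> x \<in> {0..len e})" for e x using that by (auto simp: compose_def)
  note lim = minimizing_sequence_limit[OF W order_refl wH H1_linear_combination bottom lsc upper unif out]
  show wH1: "?w \<in> H1" by (rule lim(1))
  have eqw: "energy W ?w ?w = c * inner_L2 ?w ?w" using lim(2) bottom[OF wH1] by simp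
  show "weak_eigenfunction W c ?w"
    unfolding weak_eigenfunction_def
    using minimizer_Euler_Lagrange[OF W wH1 _ bottom[OF H1_linear_combination[OF wH1]] eqw] wH1 by blast
qed

text \<open>Testing with \<open>1/(w + \<epsilon>)\<close> bounds the oscillation of \<open>ln (w + \<epsilon>)\<close> independently of \<open>\<epsilon>\<close>, so \<open>w\<close> cannot
  vanish anywhere.\<close>
lemma nonneg_eigenfunction_positive:
  assumes W: "W \<in> graph_Linfty G len" and w: "weak_eigenfunction W c w" and "w \<noteq> 0"
    and nonneg: "\<And>e x. e \<in> arcs G \<Longrightarrow> x \<in> {0..len e} \<Longrightarrow> 0 \<le> w e x"
    and e0: "e0 \<in> arcs G" "x0 \<in> {0..len e0}"
  shows "0 < w e0 x0"
proof (rule ccontr)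
  assume "\<not> 0 < w e0 x0"
  then have w0: "w e0 x0 = 0" using nonneg[OF e0] by simp
  have wH: "w \<in> H1" and weak: "\<And>\<phi>. \<phi> \<in> H1 \<Longrightarrow> energy W w \<phi> = c * inner_L2 w \<phi>"
    using w by (auto simp: weak_eigenfunction_def)
  have wc: "edge_continuous w" by (rule H1_edge_continuous[OF wH])
  obtain e1 x1 where ne: "w e1 x1 \<noteq> 0" using \<open>w \<noteq> 0\<close> by (auto simp: fun_eq_iff)
  then have e1: "e1 \<in> arcs G" "x1 \<in> {0..len e1}" using H1_outside[OF wH] by blast+
  have w1: "w e1 x1 > 0" using nonneg[OF e1] ne by simp
  obtain K where K: "\<forall>u\<in>H1. \<bar>u e1 x1 - u e0 x0\<bar> \<le> K * sqrt (dirichlet u u)"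
    using oscillation[OF e1 e0] by blast
  obtain C where C: "C > 0" "\<And>e. e \<in> arcs G \<Longrightarrow> AE x in edge_measure (len e). \<bar>W e x\<bar> \<le> C"
    by (rule Linfty_bound[OF W]) blast
  \<comment> \<open>Bounds the integral of |W - c| * w / (w + \<epsilon>), independently of
    \<epsilon>.\<close>
  define K0 where "K0 = (C + \<bar>c\<bar>) * total_length"
  have log_bound: "ln ((w e1 x1 + \<epsilon>) / \<epsilon>) \<le> \<bar>K\<bar> * sqrt K0" if \<epsilon>: "\<epsilon> > 0" for \<epsilon>
  proof -
    define z where "z = compose (\<lambda>y. ln (y + \<epsilon>)) w"
    define \<psi> where "\<psi> = compose (\<lambda>y. 1 / (y + \<epsilon>)) w"
    have p: "w e x + \<epsilon> > 0" if "e \<in> arcs G" "x \<in> {0..len e}" for e x using nonneg[OF that] \<epsilon> by simp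
    have zd: "((\<lambda>y. ln (y + \<epsilon>)) has_real_derivative 1 / (w e x + \<epsilon>)) (at (w e x))"
      and \<psi>d: "((\<lambda>y. 1 / (y + \<epsilon>)) has_real_derivative - 1 / (w e x + \<epsilon>)\<^sup>2) (at (w e x))"
      if "e \<in> arcs G" "x \<in> {0..len e}" for e x
      using p[OF that] by (auto intro!: derivative_eq_intros simp: power2_eq_square)
    have zc: "continuous_on (w e ` {0..len e}) (\<lambda>y. 1 / (y + \<epsilon>))"
      and \<psi>c: "continuous_on (w e ` {0..len e}) (\<lambda>y. - 1 / (y + \<epsilon>)\<^sup>2)" if "e \<in> arcs G" for e
      using p[OF that] by (auto intro!: continuous_intros simp: less_imp_neq[symmetric])
    have zH: "z \<in> H1" unfolding z_def by (rule compose_H1(1)[OF wH zd zc])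
    have \<psi>H: "\<psi> \<in> H1" unfolding \<psi>_def by (rule compose_H1(1)[OF wH \<psi>d \<psi>c])
    have zD: "AE x in edge_measure (len e). D z e x = 1 / (w e x + \<epsilon>) * D w e x" if "e \<in> arcs G" for e
      unfolding z_def by (rule compose_H1(2)[OF wH zd zc that])
    have \<psi>D: "AE x in edge_measure (len e). D \<psi> e x = - 1 / (w e x + \<epsilon>)\<^sup>2 * D w e x" if "e \<in> arcs G" for e
      unfolding \<psi>_def by (rule compose_H1(2)[OF wH \<psi>d \<psi>c that])
    \<comment> \<open>With z = ln (w + \<epsilon>) and \<psi> = 1 / (w + \<epsilon>): z'^2 = (w')^2
      / (w + \<epsilon>)^2 = - w' \<psi>'.\<close>
    have "dirichlet z z = gint (\<lambda>e x. (- 1) * (D w e x * D \<psi> e x))"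
      unfolding dirichlet_def graph_integral_def
    proof (intro sum.cong refl integral_cong_AE)
      fix e assume e: "e \<in> arcs G"
      have [measurable]: "D z e \<in> borel_measurable (edge_measure (len e))"
        "D w e \<in> borel_measurable (edge_measure (len e))" "D \<psi> e \<in> borel_measurable (edge_measure (len e))"
        using zH wH \<psi>H e by (auto intro!: L2_measurable D_L2)
      show "(\<lambda>x. D z e x * D z e x) \<in> borel_measurable (edge_measure (len e))"
        "(\<lambda>x. (- 1) * (D w e x * D \<psi> e x)) \<in> borel_measurable (edge_measure (len e))" by measurable
      show "AE x in edge_measure (len e). D z e x * D z e x = (- 1) * (D w e x * D \<psi> e x)"
        using zD[OF e] \<psi>D[OF e] by eventually_elim (simp add: power2_eq_square)
    qed
    also have "\<dots> = - dirichlet w \<psi>" unfolding dirichlet_def gint_cmult by simp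
    also have "\<dots> = weighted_inner W w \<psi> - c * inner_L2 w \<psi>"
      using weak[OF \<psi>H] by (simp add: energy_def)
    also have "\<dots> \<le> C * total_length + \<bar>c\<bar> * total_length"
    proof -
      have le1: "\<bar>w e x * \<psi> e x\<bar> \<le> 1" if "e \<in> arcs G" "x \<in> {0..len e}" for e x
        using p[OF that] nonneg[OF that] that \<epsilon> by (simp add: \<psi>_def compose_def divide_le_eq)
      have "\<bar>weighted_inner W w \<psi>\<bar> \<le> C * total_length"
        unfolding weighted_inner_def
      proof (rule gint_bound[OF weighted_integrable[OF W wc H1_edge_continuous[OF \<psi>H]]])
        fix e assume e: "e \<in> arcs G"
        show "AE x in edge_measure (len e). \<bar>W e x * w e x * \<psi> e x\<bar> \<le> C"
          using C(2)[OF e] AE_space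
        proof eventually_elim
          case (elim x)
          then have "\<bar>W e x\<bar> * \<bar>w e x * \<psi> e x\<bar> \<le> C * 1" using le1[OF e] C(1) by (intro mult_mono) auto
          then show ?case by (simp add: abs_mult mult.assoc)
        qed
      qed
      moreover have "\<bar>inner_L2 w \<psi>\<bar> \<le> 1 * total_length"
        unfolding weighted_inner_def
      proof (rule gint_bound[OF weighted_integrable[OF const_Linfty wc H1_edge_continuous[OF \<psi>H]]])
        fix e assume e: "e \<in> arcs G"
        show "AE x in edge_measure (len e). \<bar>1 * w e x * \<psi> e x\<bar> \<le> 1"
          using le1[OF e] by (intro AE_I2) auto
      qed
      then have "\<bar>c * inner_L2 w \<psi>\<bar> \<le> \<bar>c\<bar> * total_length" by (simp add: abs_mult mult_left_mono)
      ultimately show ?thesis by linarith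
    qed
    finally have "dirichlet z z \<le> K0" by (simp add: K0_def distrib_right)
    then have "K * sqrt (dirichlet z z) \<le> \<bar>K\<bar> * sqrt K0"
      by (intro mult_mono real_sqrt_le_mono) (auto simp: dirichlet_nonneg)
    \<comment> \<open>Here the supposed zero of w enters: z e0 x0 = ln \<epsilon>.\<close>
    moreover have "z e1 x1 - z e0 x0 = ln ((w e1 x1 + \<epsilon>) / \<epsilon>)"
      using e0 e1 w0 w1 \<epsilon> by (simp add: z_def compose_def ln_div)
    ultimately show ?thesis using K zH by fastforce
  qed
  define B where "B = \<bar>K\<bar> * sqrt K0"
  \<comment> \<open>So small that ln (w e1 x1 / \<epsilon>) = B + 1, beyond the uniform bound
    B.\<close>
  define \<epsilon> where "\<epsilon> = w e1 x1 / exp (B + 1)"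
  have \<epsilon>: "\<epsilon> > 0" using w1 by (simp add: \<epsilon>_def)
  have "exp (B + 1) = w e1 x1 / \<epsilon>" using w1 by (simp add: \<epsilon>_def)
  also have "\<dots> \<le> (w e1 x1 + \<epsilon>) / \<epsilon>" using \<epsilon> by (simp add: divide_right_mono)
  finally have "B + 1 \<le> ln ((w e1 x1 + \<epsilon>) / \<epsilon>)"
    using \<epsilon> w1 by (simp add: ln_ge_iff)
  then show False using log_bound[OF \<epsilon>] by (simp add: B_def)
qed

end

lemma independent_pair:
  assumes "independent B" "x \<in> B" "y \<in> B" "x \<noteq> y" "a *\<^sub>R x + b *\<^sub>R y = 0"
  shows "a = 0" "b = 0"
proof -
  have z: "(\<Sum>v\<in>{x, y}. (if v = x then a else b) *\<^sub>R v) = 0" using assms(4,5) by simp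
  show "a = 0" using independentD[OF assms(1) _ _ z, of x] assms by auto
  show "b = 0" using independentD[OF assms(1) _ _ z, of y] assms by auto
qed

text \<open>For x, y in X the combination L y * x - L x * y lies in the kernel of L, hence is zero;
  two distinct independent vectors cannot satisfy this.\<close>

lemma edim_le_one_of_linear_form:
  fixes L :: "'a::real_vector \<Rightarrow> real"
  assumes X: "subspace X" and lin: "\<And>x y s t. x \<in> X \<Longrightarrow> y \<in> X \<Longrightarrow> L (s *\<^sub>R x + t *\<^sub>R y) = s * L x + t * L y"
    and ker: "\<And>x. x \<in> X \<Longrightarrow> L x = 0 \<Longrightarrow> x = 0"
  shows "edim X \<le> 1"
  unfolding edim_def
proof (rule Sup_least)
  fix d assume "d \<in> {enat (card B) |B. finite B \<and> independent B \<and> B \<subseteq> X}"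
  then obtain B where B: "d = enat (card B)" "finite B" "independent B" "B \<subseteq> X" by blast
  have "x = y" if xy: "x \<in> B" "y \<in> B" for x y
  proof (rule ccontr)
    assume "x \<noteq> y"
    have "L (L y *\<^sub>R x + (- L x) *\<^sub>R y) = 0" using lin[of x y "L y" "- L x"] xy B(4) by auto
    moreover have "L y *\<^sub>R x + (- L x) *\<^sub>R y \<in> X"
      using xy B(4) by (intro subspace_add[OF X] subspace_scale[OF X]) auto
    ultimately have "L y *\<^sub>R x + (- L x) *\<^sub>R y = 0" by (intro ker)
    then have "L y = 0" by (rule independent_pair(1)[OF B(3) xy \<open>x \<noteq> y\<close>])
    then have "y = 0" using ker xy B(4) by blast
    then show False using B(3) xy dependent_zero by blast
  qed
  then have "card B \<le> 1" using B(2) by (simp add: card_le_Suc0_iff_eq)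
  then show "d \<le> 1" using B(1) by (simp add: one_enat_def)
qed

section \<open>Morse index and admissible parameters\<close>

text \<open>\<open>nonempty\<close> will come from the non-vanishing of \<rho>: without edges \<rho>
  would be zero almost everywhere vacuously. \<open>\<rho>_nonneg\<close> will come from the
  edgewise alternative.\<close>

locale nonlinear_problem = compact_metric_graph G len
  for G :: "('v, 'e) pre_digraph" and len :: "'e \<Rightarrow> real" +
  fixes p :: real and W \<rho> :: "'e graph_fun"
  assumes p: "p > 2" and W: "W \<in> graph_Linfty G len" and \<rho>: "\<rho> \<in> graph_Linfty G len"
    and nonempty: "arcs G \<noteq> {}"
    and \<rho>_nonneg: "e \<in> arcs G \<Longrightarrow> AE x in edge_measure (len e). 0 \<le> \<rho> e x"
begin

definition shifted :: "real \<Rightarrow> 'e graph_fun" where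
  "shifted lam = (\<lambda>e x. W e x + lam)"

text \<open>With Q = \<open>energy (shifted lam)\<close> and V the form weighted by this function,
  the equation reads Q(u, \<phi>) = V(u, \<phi>) and the second variation is Q - (p - 1) V.\<close>

definition power_weight :: "'e graph_fun \<Rightarrow> 'e graph_fun" where
  "power_weight u = (\<lambda>e x. \<rho> e x * \<bar>u e x\<bar> powr (p - 2))"

definition power_integral :: "'e graph_fun \<Rightarrow> real" where
  "power_integral u = gint (\<lambda>e x. \<rho> e x * \<bar>u e x\<bar> powr p)"

lemma shifted_Linfty: "shifted lam \<in> graph_Linfty G len"
  unfolding shifted_def by (rule Linfty_add[OF W const_Linfty])

lemma power_weight_Linfty: "edge_continuous u \<Longrightarrow> power_weight u \<in> graph_Linfty G len"
  unfolding power_weight_def using p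
  by (intro Linfty_mult \<rho> compose_Linfty[of u "\<lambda>x. \<bar>x\<bar> powr (p - 2)"] continuous_abs_powr) auto

lemma energy_shifted:
  assumes "u \<in> H1" "v \<in> H1"
  shows "energy (shifted lam) u v = energy W u v + lam * inner_L2 u v"
proof -
  have "weighted_inner (shifted lam) u v = gint (\<lambda>e x. W e x * u e x * v e x + lam * (1 * u e x * v e x))"
    unfolding weighted_inner_def shifted_def by (intro gint_cong) (simp add: algebra_simps)
  also have "\<dots> = weighted_inner W u v + lam * inner_L2 u v"
    unfolding weighted_inner_def gint_cmult[symmetric]
    by (intro gint_add gintegrable_cmult weighted_integrable W const_Linfty H1_edge_continuous assms)
  finally show ?thesis by (simp add: energy_def)
qed

lemma solves_E_iff:
  "solves_E G len p W \<rho> lam u \<longleftrightarrow> u \<in> H1 \<and> (\<forall>\<phi>\<in>H1. energy (shifted lam) u \<phi> = weighted_inner (power_weight u) u \<phi>)"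
proof -
  have "gint (\<lambda>e x. D u e x * D \<phi> e x + (W e x + lam) * u e x * \<phi> e x) = energy (shifted lam) u \<phi>"
    if "u \<in> H1" "\<phi> \<in> H1" for \<phi>
    using gint_add[OF dirichlet_integrable[OF that]
        weighted_integrable[OF shifted_Linfty[of lam] H1_edge_continuous[OF that(1)] H1_edge_continuous[OF that(2)]]]
    by (simp add: energy_def dirichlet_def weighted_inner_def shifted_def)
  then show ?thesis unfolding solves_E_def weighted_inner_def power_weight_def by auto
qed

lemma second_variation_eq:
  assumes u: "u \<in> H1" and \<phi>: "\<phi> \<in> H1"
  shows "second_variation G len p W \<rho> lam u \<phi>
    = energy (shifted lam) \<phi> \<phi> - (p - 1) * weighted_inner (power_weight u) \<phi> \<phi>"
proof -
  have c: "edge_continuous \<phi>" by (rule H1_edge_continuous[OF \<phi>])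
  have i1: "gintegrable (\<lambda>e x. D \<phi> e x * D \<phi> e x)" by (rule dirichlet_integrable[OF \<phi> \<phi>])
  have i2: "gintegrable (\<lambda>e x. shifted lam e x * \<phi> e x * \<phi> e x)" by (rule weighted_integrable[OF shifted_Linfty c c])
  have i3: "gintegrable (\<lambda>e x. (p - 1) * (power_weight u e x * \<phi> e x * \<phi> e x))"
    by (rule gintegrable_cmult[OF weighted_integrable[OF power_weight_Linfty[OF H1_edge_continuous[OF u]] c c]])
  have "second_variation G len p W \<rho> lam u \<phi> = gint (\<lambda>e x. (D \<phi> e x * D \<phi> e x + shifted lam e x * \<phi> e x * \<phi> e x)
      - (p - 1) * (power_weight u e x * \<phi> e x * \<phi> e x))"
    unfolding second_variation_def shifted_def power_weight_def
    by (intro gint_cong) (simp add: power2_eq_square mult.assoc)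
  also have "\<dots> = energy (shifted lam) \<phi> \<phi> - (p - 1) * weighted_inner (power_weight u) \<phi> \<phi>"
    using gint_diff[OF gintegrable_add[OF i1 i2] i3] gint_add[OF i1 i2]
    by (simp add: energy_def dirichlet_def weighted_inner_def gint_cmult)
  finally show ?thesis .
qed

lemma power_weight_nonneg: "0 \<le> weighted_inner (power_weight u) \<phi> \<phi>"
  unfolding weighted_inner_def
proof (rule gint_nonneg)
  fix e assume "e \<in> arcs G"
  from \<rho>_nonneg[OF this] show "AE x in edge_measure (len e). 0 \<le> power_weight u e x * \<phi> e x * \<phi> e x"
  proof eventually_elim
    case (elim x)
    then have "0 \<le> power_weight u e x * (\<phi> e x)\<^sup>2" by (simp add: power_weight_def)
    then show ?case by (simp add: power2_eq_square mult.assoc)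
  qed
qed

section \<open>Lower bounds on the Morse index\<close>

lemma morse_index_ge:
  assumes X: "subspace X" "X \<subseteq> H1" and neg: "\<And>\<phi>. \<phi> \<in> X \<Longrightarrow> \<phi> \<noteq> 0 \<Longrightarrow> second_variation G len p W \<rho> lam u \<phi> < 0"
    and B: "finite B" "independent B" "B \<subseteq> X"
  shows "enat (card B) \<le> morse_index G len p W \<rho> lam u"
proof -
  have "enat (card B) \<le> edim X" unfolding edim_def using B by (intro Sup_upper) blast
  also have "\<dots> \<le> morse_index G len p W \<rho> lam u"
    unfolding morse_index_def using X neg by (intro Sup_upper) blast
  finally show ?thesis .
qed

lemma admissible_lower_bound:
  assumes lam: "lam \<in> admissible_lambdas G len p W \<rho> m"
  shows "- eigenvalue G len W (Suc m) \<le> lam"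
proof (rule ccontr)
  assume less: "\<not> ?thesis"
  obtain v \<mu> where on: "\<And>i j. inner_L2 (v i) (v j) = (if i = j then 1 else 0)"
    and weak: "\<And>n. weak_eigenfunction W (\<mu> n) (v n)" and mono: "mono \<mu>"
    and ev: "\<And>n. eigenvalue G len W (Suc n) = \<mu> n"
    by (rule spectral_theorem[OF W nonempty]) blast
  have vH: "v n \<in> H1" for n using weak[of n] by (simp add: weak_eigenfunction_def)
  obtain u where u: "u \<in> H1" "morse_index G len p W \<rho> lam u \<le> enat m"
    using lam by (auto simp: admissible_lambdas_def)
  \<comment> \<open>m + 1 functions with indices 0 to m, one more than the admissible Morse index;
    \<mu> m is the eigenvalue numbered m + 1.\<close>
  let ?T = "v ` {..m}"
  have inj: "inj_on v {..m}"
  proof (rule inj_onI)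
    fix i j assume "v i = v j"
    then show "i = j" using on[of i j] on[of j j] by (auto split: if_splits)
  qed
  have v0: "v k \<noteq> 0" for k
  proof
    assume "v k = 0"
    then show False using on[of k k] by (simp add: weighted_inner_def graph_integral_def)
  qed
  have "enat (card ?T) \<le> morse_index G len p W \<rho> lam u"
  proof (rule morse_index_ge)
    show "subspace (span ?T)" by (rule subspace_span)
    show sub: "span ?T \<subseteq> H1" using vH by (intro span_minimal subspace_H1) auto
    show "independent ?T" using vH v0 on by (intro orthogonal_independent) auto
    show "finite ?T" "?T \<subseteq> span ?T" by (auto intro: span_base)
    fix \<phi> assume \<phi>: "\<phi> \<in> span ?T" and ne: "\<phi> \<noteq> 0"
    have \<phi>H: "\<phi> \<in> H1" using \<phi> sub by blast
    obtain b where "\<phi> = (\<Sum>x\<in>?T. b x *\<^sub>R x)" using \<phi> by (auto simp: span_finite)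
    also have "\<dots> = (\<Sum>i\<le>m. b (v i) *\<^sub>R v i)" using inj by (simp add: sum.reindex)
    finally have rep: "\<phi> = (\<Sum>i\<le>m. b (v i) *\<^sub>R v i)" .
    have coeff: "inner_L2 (v j) \<phi> = b (v j)" if j: "j \<le> m" for j
    proof -
      have "inner_L2 \<phi> (v j) = (\<Sum>i\<le>m. b (v i) * inner_L2 (v i) (v j))"
        unfolding rep by (intro inner_L2_sum vH) auto
      also have "\<dots> = (\<Sum>i\<le>m. if i = j then b (v j) else 0)" using on by (intro sum.cong) auto
      also have "\<dots> = b (v j)" using j by simp
      finally show ?thesis by (simp add: weighted_inner_commute)
    qed
    have "inner_L2 \<phi> \<phi> = (\<Sum>i\<le>m. b (v i) * inner_L2 (v i) \<phi>)"
      using inner_L2_sum[OF _ vH \<phi>H, of "{..m}" "\<lambda>i. b (v i)"] rep by simp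
    also have "\<dots> = (\<Sum>i\<le>m. (b (v i))\<^sup>2)" using coeff by (intro sum.cong) (auto simp: power2_eq_square)
    finally have norm: "inner_L2 \<phi> \<phi> = (\<Sum>i\<le>m. (b (v i))\<^sup>2)" .
    have "energy W \<phi> \<phi> = (\<Sum>i\<le>m. b (v i) * energy W (v i) \<phi>)"
      using energy_sum[OF W _ vH \<phi>H, of "{..m}" "\<lambda>i. b (v i)"] rep by simp
    also have "\<dots> = (\<Sum>i\<le>m. \<mu> i * (b (v i))\<^sup>2)"
      using coeff weak \<phi>H by (intro sum.cong) (auto simp: power2_eq_square weak_eigenfunction_def)
    also have "\<dots> \<le> (\<Sum>i\<le>m. \<mu> m * (b (v i))\<^sup>2)"
      \<comment> \<open>On the span, all eigenvalues involved are at most \<mu> m.\<close>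
      using mono by (intro sum_mono mult_right_mono) (auto simp: monoD)
    also have "\<dots> = \<mu> m * inner_L2 \<phi> \<phi>" by (simp add: norm sum_distrib_left)
    finally have "energy (shifted lam) \<phi> \<phi> \<le> (\<mu> m + lam) * inner_L2 \<phi> \<phi>"
      by (simp add: energy_shifted[OF \<phi>H \<phi>H] distrib_right)
    also have "\<dots> < 0" using less inner_L2_pos[OF \<phi>H ne] by (intro mult_neg_pos) (auto simp: ev)
    finally have "energy (shifted lam) \<phi> \<phi> < 0" .
    moreover have "0 \<le> (p - 1) * weighted_inner (power_weight u) \<phi> \<phi>"
      using p power_weight_nonneg by (intro mult_nonneg_nonneg) auto
    ultimately show "second_variation G len p W \<rho> lam u \<phi> < 0"
      by (simp add: second_variation_eq[OF u(1) \<phi>H])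
  qed
  also have "card ?T = Suc m" using card_image[OF inj] by simp
  finally show False using u(2) by (metis enat_ord_simps(1) not_less_eq_eq order_refl order_trans)
qed

end

locale positive_nonlinear_problem = nonlinear_problem +
  assumes \<rho>_pos: "e \<in> arcs G \<Longrightarrow> AE x in edge_measure (len e). 0 < \<rho> e x"
begin

text \<open>If the integral vanished, then \<rho> |u|^(p-2) \<phi>^2 = 0 almost everywhere, and u
  would vanish since \<phi> \<noteq> 0 wherever u \<noteq> 0. Applied to u itself and to the
  positive ground state.\<close>

lemma power_weight_pos:
  assumes u: "u \<in> H1" "u \<noteq> 0" and \<phi>: "edge_continuous \<phi>"
    and supp: "\<And>e x. e \<in> arcs G \<Longrightarrow> x \<in> {0..len e} \<Longrightarrow> u e x \<noteq> 0 \<Longrightarrow> \<phi> e x \<noteq> 0"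
  shows "0 < weighted_inner (power_weight u) \<phi> \<phi>"
proof (rule ccontr)
  assume "\<not> ?thesis"
  then have z: "gint (\<lambda>e x. power_weight u e x * \<phi> e x * \<phi> e x) = 0"
    using power_weight_nonneg[of u \<phi>] by (simp add: weighted_inner_def)
  have int: "gintegrable (\<lambda>e x. power_weight u e x * \<phi> e x * \<phi> e x)"
    by (rule weighted_integrable[OF power_weight_Linfty[OF H1_edge_continuous[OF u(1)]] \<phi> \<phi>])
  have "u e x = 0" for e x
  proof (cases "e \<in> arcs G \<and> x \<in> {0..len e}")
    case True
    then have e: "e \<in> arcs G" by simp
    have nn: "AE x in edge_measure (len e). 0 \<le> power_weight u e x * \<phi> e x * \<phi> e x" if "e \<in> arcs G" for e
      using \<rho>_nonneg[OF that]
    proof eventually_elim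
      case (elim x)
      then have "0 \<le> power_weight u e x * (\<phi> e x)\<^sup>2" by (simp add: power_weight_def)
      then show ?case by (simp add: power2_eq_square mult.assoc)
    qed
    have "AE x in edge_measure (len e). power_weight u e x * \<phi> e x * \<phi> e x = 0"
      by (rule gint_zero_AE[OF int _ z e]) (rule nn)
    then have "AE x in edge_measure (len e). u e x = 0"
      using \<rho>_pos[OF e] AE_space
      by eventually_elim (use supp[OF e] in \<open>auto simp: power_weight_def\<close>)
    then show ?thesis
      using continuous_AE_eq[of "len e" "u e" "\<lambda>x. 0" x] has_L2_deriv_continuous[OF H1_edge[OF u(1)]] len_pos True by auto
  qed (simp add: H1_outside[OF u(1)])
  then show False using u(2) by (simp add: fun_eq_iff)
qed

text \<open>The equation of u matches the s^2 and s t terms of Q(w, w) and V(w, w), so their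
  difference has only t^2 terms. The remaining -(p - 2) V and the strictly negative ground state
  term leave no null direction, even if lam equals -\<lambda>_1.\<close>

lemma admissible_strict:
  assumes lam: "lam \<in> admissible_lambdas G len p W \<rho> 1"
  shows "- eigenvalue G len W 1 < lam"
proof (rule ccontr)
  assume le: "\<not> ?thesis"
  obtain v \<mu> where on: "\<And>i j. inner_L2 (v i) (v j) = (if i = j then 1 else 0)"
    and weak: "\<And>n. weak_eigenfunction W (\<mu> n) (v n)"
    and bottom: "\<And>w. w \<in> H1 \<Longrightarrow> \<mu> 0 * inner_L2 w w \<le> energy W w w"
    and ev: "\<And>n. eigenvalue G len W (Suc n) = \<mu> n"
    by (rule spectral_theorem[OF W nonempty]) blast
  have le': "\<mu> 0 + lam \<le> 0" using le ev[of 0] by simp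
  have v0: "v 0 \<in> H1" using weak[of 0] by (simp add: weak_eigenfunction_def)
  have "energy W (v 0) (v 0) = \<mu> 0 * inner_L2 (v 0) (v 0)" using weak[of 0] v0 by (simp add: weak_eigenfunction_def)
  note gs = ground_state_abs[OF W v0 bottom this]
  define \<phi> where "\<phi> = compose abs (v 0)"
  have \<phi>H: "\<phi> \<in> H1" and \<phi>w: "weak_eigenfunction W (\<mu> 0) \<phi>" using gs by (auto simp: \<phi>_def)
  have "\<phi> \<noteq> 0"
  proof
    assume "\<phi> = 0"
    have "v 0 e x = 0" for e x
    proof (cases "e \<in> arcs G \<and> x \<in> {0..len e}")
      case True
      have "\<phi> e x = 0" using \<open>\<phi> = 0\<close> by simp
      then show ?thesis using True by (simp add: \<phi>_def compose_def)
    qed (simp add: H1_outside[OF v0])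
    then have "inner_L2 (v 0) (v 0) = 0" by (simp add: weighted_inner_def graph_integral_def)
    then show False using on[of 0 0] by simp
  qed
  then have \<phi>pos: "0 < \<phi> e x" if "e \<in> arcs G" "x \<in> {0..len e}" for e x
    using that by (intro nonneg_eigenfunction_positive[OF W \<phi>w]) (auto simp: \<phi>_def compose_def)
  obtain u where u: "u \<in> H1" "u \<noteq> 0" "solves_E G len p W \<rho> lam u" "morse_index G len p W \<rho> lam u \<le> enat 1"
    using lam by (auto simp: admissible_lambdas_def)
  let ?V = "weighted_inner (power_weight u)" and ?Q = "energy (shifted lam)"
  have sol: "?Q u \<psi> = ?V u \<psi>" if "\<psi> \<in> H1" for \<psi> using u(3) that by (auto simp: solves_E_iff)
  have \<phi>Q: "?Q \<phi> \<psi> = (\<mu> 0 + lam) * inner_L2 \<phi> \<psi>" if "\<psi> \<in> H1" for \<psi>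
    using \<phi>w that by (simp add: weak_eigenfunction_def energy_shifted[OF \<phi>H that] distrib_right)
  have uc: "edge_continuous u" and \<phi>c: "edge_continuous \<phi>" using u(1) \<phi>H by (auto intro: H1_edge_continuous)
  have Vu: "0 < ?V u u" by (rule power_weight_pos[OF u(1,2) uc])
  have V\<phi>: "0 < ?V \<phi> \<phi>" by (rule power_weight_pos[OF u(1,2) \<phi>c]) (use \<phi>pos in force)
  \<comment> \<open>On multiples of \<phi> the form Q is at most 0, whereas a nonzero solution has
    Q(u, u) = V(u, u) > 0.\<close>
  have indep: "u \<notin> span {\<phi>}"
  proof
    assume "u \<in> span {\<phi>}"
    then obtain k where k: "u = k *\<^sub>R \<phi>" by (auto simp: span_singleton)
    have "?Q u u = k\<^sup>2 * ?Q \<phi> \<phi>" using energy_square[OF shifted_Linfty \<phi>H \<phi>H, of lam k 0] by (simp add: k)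
    also have "\<dots> \<le> 0" using \<phi>Q[OF \<phi>H] le' inner_L2_nonneg[of \<phi>]
      by (simp add: mult_nonneg_nonpos mult_nonpos_nonneg)
    finally show False using sol[OF u(1)] Vu by simp
  qed
  have "u \<noteq> \<phi>" using indep by (auto intro: span_base)
  have "enat (card {u, \<phi>}) \<le> morse_index G len p W \<rho> lam u"
  proof (rule morse_index_ge)
    show "subspace (span {u, \<phi>})" by (rule subspace_span)
    show sub: "span {u, \<phi>} \<subseteq> H1" using u(1) \<phi>H by (intro span_minimal subspace_H1) auto
    show "independent {u, \<phi>}"
      using indep \<open>\<phi> \<noteq> 0\<close> \<open>u \<noteq> \<phi>\<close> by (simp add: independent_insert)
    show "finite {u, \<phi>}" "{u, \<phi>} \<subseteq> span {u, \<phi>}" by (auto intro: span_base)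
    fix w assume w: "w \<in> span {u, \<phi>}" and "w \<noteq> 0"
    obtain s where "w - s *\<^sub>R u \<in> span {\<phi>}" using w by (auto simp: span_insert)
    then obtain t where "w - s *\<^sub>R u = t *\<^sub>R \<phi>" by (auto simp: span_singleton)
    then have w_eq: "w = s *\<^sub>R u + t *\<^sub>R \<phi>" by (simp add: algebra_simps)
    have wH: "w \<in> H1" using w sub by blast
    have Q: "?Q w w = s\<^sup>2 * ?V u u + 2 * s * t * ?V u \<phi> + t\<^sup>2 * ((\<mu> 0 + lam) * inner_L2 \<phi> \<phi>)"
      unfolding w_eq energy_square[OF shifted_Linfty u(1) \<phi>H] sol[OF u(1)] sol[OF \<phi>H] \<phi>Q[OF \<phi>H] ..
    have V: "?V w w = s\<^sup>2 * ?V u u + 2 * s * t * ?V u \<phi> + t\<^sup>2 * ?V \<phi> \<phi>"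
      unfolding w_eq by (rule weighted_inner_square[OF power_weight_Linfty[OF uc] uc \<phi>c])
    \<comment> \<open>Split as (Q - V) - (p - 2) V; only t^2 terms survive in Q - V.\<close>
    have "second_variation G len p W \<rho> lam u w
        = - ((p - 2) * ?V w w) - t\<^sup>2 * ?V \<phi> \<phi> + t\<^sup>2 * ((\<mu> 0 + lam) * inner_L2 \<phi> \<phi>)"
      unfolding second_variation_eq[OF u(1) wH] using Q V by (simp add: algebra_simps)
    moreover have "t\<^sup>2 * ((\<mu> 0 + lam) * inner_L2 \<phi> \<phi>) \<le> 0"
      using le' inner_L2_nonneg[of \<phi>] by (simp add: mult_nonneg_nonpos mult_nonpos_nonneg)
    moreover have "0 < (p - 2) * ?V w w + t\<^sup>2 * ?V \<phi> \<phi>"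
    proof (cases "t = 0")
      case True
      then have "s \<noteq> 0" using w_eq \<open>w \<noteq> 0\<close> by auto
      then have "0 < (p - 2) * (s\<^sup>2 * ?V u u)" using p Vu by simp
      then show ?thesis using True V by simp
    next
      case False
      then have "0 < t\<^sup>2 * ?V \<phi> \<phi>" using V\<phi> by simp
      moreover have "0 \<le> (p - 2) * ?V w w" using p power_weight_nonneg by simp
      ultimately show ?thesis by linarith
    qed
    ultimately show "second_variation G len p W \<rho> lam u w < 0" by linarith
  qed
  also have "card {u, \<phi>} = 2" using \<open>u \<noteq> \<phi>\<close> by simp
  finally have "enat 2 \<le> enat 1" using u(4) by (rule order_trans)
  then show False by simp
qed

section \<open>Existence of solutions of Morse index at most one\<close>

lemma power_integral_pos:
  assumes "u \<in> H1" "u \<noteq> 0"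
  shows "0 < power_integral u"
proof -
  have c: "edge_continuous u" using assms(1) by (rule H1_edge_continuous)
  have "power_integral u = weighted_inner (power_weight u) u u"
    unfolding power_integral_def weighted_inner_def
  proof (rule gint_cong)
    fix e x
    show "\<rho> e x * \<bar>u e x\<bar> powr p = power_weight u e x * u e x * u e x"
    proof (cases "u e x = 0")
      case False
      then have "\<bar>u e x\<bar> powr p = \<bar>u e x\<bar> powr (p - 2) * (u e x)\<^sup>2"
        using powr_add[of "\<bar>u e x\<bar>" "p - 2" 2] by (simp add: powr_numeral)
      then show ?thesis by (simp add: power_weight_def power2_eq_square)
    qed (use p in simp)
  qed
  then show ?thesis using power_weight_pos[OF assms c] by simp
qed

lemma power_integral_scale: "power_integral (s *\<^sub>R u) = \<bar>s\<bar> powr p * power_integral u"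
  unfolding power_integral_def gint_cmult[symmetric]
  by (intro gint_cong) (simp add: scaleR_fun_def abs_mult powr_mult mult_ac)

text \<open>Integrates the pointwise Taylor expansion; the coefficients are p V(u, \<phi>) and p (p
  - 1) / 2 * V(\<phi>, \<phi>). The combination is written with 1 *R u to match the bilinear
  expansion of the energy.\<close>

lemma power_integral_expansion:
  assumes u: "edge_continuous u" and \<phi>: "edge_continuous \<phi>" and "\<epsilon> > 0"
  shows "\<exists>\<delta>>0. \<forall>t. \<bar>t\<bar> \<le> \<delta> \<longrightarrow> \<bar>power_integral (1 *\<^sub>R u + t *\<^sub>R \<phi>) - power_integral u
    - p * weighted_inner (power_weight u) u \<phi> * t
    - p * (p - 1) / 2 * weighted_inner (power_weight u) \<phi> \<phi> * t\<^sup>2\<bar> \<le> \<epsilon> * t\<^sup>2"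
proof -
  obtain M where M: "M > 0" "\<And>e x. e \<in> arcs G \<Longrightarrow> x \<in> {0..len e} \<Longrightarrow> \<bar>u e x\<bar> \<le> M"
    by (rule edge_continuous_bound[OF u]) blast
  obtain K where K: "K > 0" "\<And>e x. e \<in> arcs G \<Longrightarrow> x \<in> {0..len e} \<Longrightarrow> \<bar>\<phi> e x\<bar> \<le> K"
    by (rule edge_continuous_bound[OF \<phi>]) blast
  obtain C where C: "C > 0" "\<And>e. e \<in> arcs G \<Longrightarrow> AE x in edge_measure (len e). \<bar>\<rho> e x\<bar> \<le> C"
    by (rule Linfty_bound[OF \<rho>]) blast
  \<comment> \<open>C bounds \<rho> and K bounds \<phi>, so integrating \<eta> * (t * \<phi>)^2
    against \<rho> costs at most C * K^2 * total_length * t^2.\<close>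
  define \<eta> where "\<eta> = \<epsilon> / (C * K\<^sup>2 * (total_length + 1))"
  have \<eta>: "\<eta> > 0" using \<open>\<epsilon> > 0\<close> C(1) K(1) total_length_nonneg by (simp add: \<eta>_def)
  obtain \<delta> where \<delta>: "\<delta> > 0" "\<And>a h. \<bar>a\<bar> \<le> M \<Longrightarrow> \<bar>h\<bar> \<le> \<delta>
    \<Longrightarrow> \<bar>\<bar>a + h\<bar> powr p - \<bar>a\<bar> powr p - p * (\<bar>a\<bar> powr (p - 2) * a) * h
      - p * (p - 1) / 2 * \<bar>a\<bar> powr (p - 2) * h\<^sup>2\<bar> \<le> \<eta> * h\<^sup>2"
    by (rule abs_powr_Taylor[OF p \<eta>]) blast
  have int: "gintegrable (\<lambda>e x. \<rho> e x * \<bar>w e x\<bar> powr p)" if "edge_continuous w" for w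
    using p by (intro Linfty_integrable Linfty_mult \<rho> compose_Linfty[OF that, of "\<lambda>x. \<bar>x\<bar> powr p"] continuous_abs_powr) auto
  have Vu: "power_weight u \<in> graph_Linfty G len" by (rule power_weight_Linfty[OF u])
  show ?thesis
  proof (intro exI[of _ "\<delta> / K"] conjI allI impI)
    show "\<delta> / K > 0" using \<delta>(1) K(1) by simp
    fix t :: real assume t: "\<bar>t\<bar> \<le> \<delta> / K"
    let ?w = "1 *\<^sub>R u + t *\<^sub>R \<phi>"
    let ?R = "\<lambda>e x. \<rho> e x * \<bar>?w e x\<bar> powr p - \<rho> e x * \<bar>u e x\<bar> powr p
      - (p * t) * (power_weight u e x * u e x * \<phi> e x)
      - (p * (p - 1) / 2 * t\<^sup>2) * (power_weight u e x * \<phi> e x * \<phi> e x)"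
    have wc: "edge_continuous ?w" by (intro edge_continuous_intros u \<phi>)
    note i1 = int[OF wc] and i2 = int[OF u]
      and i3 = gintegrable_cmult[OF weighted_integrable[OF Vu u \<phi>], of "p * t"]
      and i4 = gintegrable_cmult[OF weighted_integrable[OF Vu \<phi> \<phi>], of "p * (p - 1) / 2 * t\<^sup>2"]
    note i12 = gintegrable_diff[OF i1 i2] and i123 = gintegrable_diff[OF gintegrable_diff[OF i1 i2] i3]
    have "gint ?R = power_integral ?w - power_integral u - (p * t) * weighted_inner (power_weight u) u \<phi>
        - (p * (p - 1) / 2 * t\<^sup>2) * weighted_inner (power_weight u) \<phi> \<phi>"
      unfolding gint_diff[OF i123 i4] gint_diff[OF i12 i3] gint_diff[OF i1 i2] gint_cmult
      by (simp add: power_integral_def weighted_inner_def)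
    moreover have "\<bar>gint ?R\<bar> \<le> (C * (\<eta> * (t\<^sup>2 * K\<^sup>2))) * total_length"
    proof (rule gint_bound[OF gintegrable_diff[OF i123 i4]])
      fix e assume e: "e \<in> arcs G"
      show "AE x in edge_measure (len e). \<bar>?R e x\<bar> \<le> C * (\<eta> * (t\<^sup>2 * K\<^sup>2))"
        using C(2)[OF e] AE_space
      proof eventually_elim
        case (elim x)
        then have x: "x \<in> {0..len e}" by simp
        let ?a = "u e x" and ?h = "t * \<phi> e x"
        have "\<bar>?h\<bar> \<le> (\<delta> / K) * K" unfolding abs_mult using t K(2)[OF e x] K(1) \<delta>(1) by (intro mult_mono) auto
        then have h: "\<bar>?h\<bar> \<le> \<delta>" using K(1) by simp
        have "?h\<^sup>2 \<le> t\<^sup>2 * K\<^sup>2"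
          using K(2)[OF e x] K(1) by (simp add: power_mult_distrib mult_left_mono abs_le_square_iff[symmetric])
        then have hb: "\<eta> * ?h\<^sup>2 \<le> \<eta> * (t\<^sup>2 * K\<^sup>2)" using \<eta> by (intro mult_left_mono) auto
        let ?T = "\<bar>?a + ?h\<bar> powr p - \<bar>?a\<bar> powr p - p * (\<bar>?a\<bar> powr (p - 2) * ?a) * ?h
          - p * (p - 1) / 2 * \<bar>?a\<bar> powr (p - 2) * ?h\<^sup>2"
        have T: "\<bar>?T\<bar> \<le> \<eta> * (t\<^sup>2 * K\<^sup>2)" using \<delta>(2)[OF M(2)[OF e x] h] hb by linarith
        have "?R e x = \<rho> e x * ?T"
          by (simp add: power_weight_def scaleR_fun_def plus_fun_def power2_eq_square algebra_simps)
        then have "\<bar>?R e x\<bar> = \<bar>\<rho> e x\<bar> * \<bar>?T\<bar>" by (simp only: abs_mult)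
        also have "\<dots> \<le> C * (\<eta> * (t\<^sup>2 * K\<^sup>2))" using T elim C(1) by (intro mult_mono) auto
        finally show ?case .
      qed
    qed
    moreover have "(C * (\<eta> * (t\<^sup>2 * K\<^sup>2))) * total_length \<le> \<epsilon> * t\<^sup>2"
    proof -
      have "(C * (\<eta> * (t\<^sup>2 * K\<^sup>2))) * total_length \<le> (C * (\<eta> * (t\<^sup>2 * K\<^sup>2))) * (total_length + 1)"
        using C(1) \<eta> by (intro mult_left_mono) auto
      also have "\<dots> = (\<eta> * (C * K\<^sup>2 * (total_length + 1))) * t\<^sup>2" by (simp only: mult_ac)
      also have "\<eta> * (C * K\<^sup>2 * (total_length + 1)) = \<epsilon>"
        using C(1) K(1) total_length_nonneg by (simp add: \<eta>_def)
      finally show ?thesis .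
    qed
    ultimately show "\<bar>power_integral ?w - power_integral u - p * weighted_inner (power_weight u) u \<phi> * t
      - p * (p - 1) / 2 * weighted_inner (power_weight u) \<phi> \<phi> * t\<^sup>2\<bar> \<le> \<epsilon> * t\<^sup>2"
      by (simp add: mult_ac)
  qed
qed

text \<open>The set \<open>power_integral\<close> = 1 is not convex, so the constraint is replaced
  by c * power_integral w powr (2 / p), homogeneous of degree 2 like the energy and a lower bound
  for it on all of H^1. Coercivity with \<kappa> > 0 bounds the minimising sequence and makes the
  minimum positive.\<close>

lemma constrained_nonlinear_minimizer:
  assumes pos: "\<And>w. w \<in> H1 \<Longrightarrow> \<kappa> * inner_L2 w w \<le> energy (shifted lam) w w" and "\<kappa> > 0"
  obtains u where "u \<in> H1" "power_integral u = 1" "0 < energy (shifted lam) u u"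
    "\<forall>w\<in>H1. energy (shifted lam) u u * power_integral w powr (2 / p) \<le> energy (shifted lam) w w"
proof -
  let ?Q = "\<lambda>w. energy (shifted lam) w w"
  obtain C where C: "C > 0" "\<And>u. u \<in> H1 \<Longrightarrow> dirichlet u u - C * inner_L2 u u \<le> ?Q u"
    by (rule energy_lower_bound[OF shifted_Linfty]) blast
  have Q0: "0 \<le> ?Q w" if "w \<in> H1" for w
    using pos[OF that] \<open>\<kappa> > 0\<close> inner_L2_nonneg[of w] by (smt (verit) mult_nonneg_nonneg)
  have Qscale: "?Q (s *\<^sub>R w) = s\<^sup>2 * ?Q w" if "w \<in> H1" for s w
    using energy_square[OF shifted_Linfty that that, of lam s 0] by simp
  define E where "E = ?Q ` {w \<in> H1. power_integral w = 1}"
  define c where "c = Inf E"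
  have bdd: "bdd_below E" using Q0 by (intro bdd_belowI[of _ 0]) (auto simp: E_def)
  have normalized: "?Q w / power_integral w powr (2 / p) \<in> E" if w: "w \<in> H1" "w \<noteq> 0" for w
  proof -
    \<comment> \<open>\<open>power_integral\<close> is homogeneous of degree p, so this factor
      normalises it to 1.\<close>
    define s where "s = power_integral w powr (- 1 / p)"
    have N: "power_integral w > 0" by (rule power_integral_pos[OF w])
    then have s: "s > 0" by (simp add: s_def)
    have "power_integral (s *\<^sub>R w) = 1"
    proof -
      have "s powr p = power_integral w powr (-1)" unfolding s_def powr_powr using p by simp
      also have "\<dots> = inverse (power_integral w)" using N by (simp only: powr_minus powr_one)
      finally show ?thesis using N s by (simp add: power_integral_scale)
    qed
    moreover have "?Q (s *\<^sub>R w) = ?Q w / power_integral w powr (2 / p)"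
    proof -
      have "s\<^sup>2 = power_integral w powr (- (2 / p))"
        using N by (simp add: s_def powr_powr flip: powr_numeral)
      then show ?thesis by (simp add: Qscale[OF w(1)] powr_minus divide_inverse mult.commute)
    qed
    ultimately show ?thesis unfolding E_def using H1_scale[OF w(1), of s] by (force simp: image_iff)
  qed
  have lower: "c * power_integral w powr (2 / p) \<le> ?Q w" if w: "w \<in> H1" for w
  proof (cases "w = 0")
    case True
    have "power_integral 0 = 0" using p by (simp add: power_integral_def graph_integral_def)
    moreover have "?Q 0 = 0" using Qscale[OF H1_zero, of 0] by simp
    ultimately show ?thesis using True by simp
  next
    case False
    have "c \<le> ?Q w / power_integral w powr (2 / p)"
      unfolding c_def by (rule cInf_lower[OF normalized[OF w False] bdd])
    then show ?thesis using power_integral_pos[OF w False] by (simp add: pos_le_divide_eq)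
  qed
  \<comment> \<open>Only a nonzero member of H^1 is wanted, to make the constraint set
    nonempty.\<close>
  obtain B where B: "finite B" "B \<subseteq> H1" "independent B" "card B = 1"
    by (rule H1_infinite_dimensional[OF nonempty]) blast
  then obtain w0 where "B = {w0}" by (auto simp: card_1_singleton_iff)
  then have "w0 \<in> H1" "w0 \<noteq> 0" using B(2,3) by auto
  then have "E \<noteq> {}" using normalized by blast
  have "\<exists>w. w \<in> H1 \<and> power_integral w = 1 \<and> ?Q w < c + 1 / Suc n" for n
  proof -
    have "Inf E < c + 1 / Suc n" by (simp add: c_def)
    then obtain x where "x \<in> E" "x < c + 1 / Suc n" using \<open>E \<noteq> {}\<close> bdd cInf_less_iff by metis
    then show ?thesis by (auto simp: E_def)
  qed
  then obtain un where un: "\<And>n. un n \<in> H1" "\<And>n. power_integral (un n) = 1" "\<And>n. ?Q (un n) < c + 1 / Suc n"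
    by metis
  have bound: "dirichlet (un n) (un n) + inner_L2 (un n) (un n) \<le> (c + 1) + (C + 1) * ((c + 1) / \<kappa>)" for n
  proof -
    have Qn: "?Q (un n) \<le> c + 1"
    proof -
      have "1 / real (Suc n) \<le> 1" by simp
      then show ?thesis using un(3)[of n] by linarith
    qed
    have "\<kappa> * inner_L2 (un n) (un n) \<le> c + 1" using pos[OF un(1)[of n]] Qn by linarith
    then have i: "inner_L2 (un n) (un n) \<le> (c + 1) / \<kappa>" using \<open>\<kappa> > 0\<close> by (simp add: pos_le_divide_eq mult.commute)
    then have "(C + 1) * inner_L2 (un n) (un n) \<le> (C + 1) * ((c + 1) / \<kappa>)" using C(1) by (intro mult_left_mono) auto
    then show ?thesis using C(2)[OF un(1)[of n]] Qn by (simp add: distrib_right)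
  qed
  from bounded_subsequence_converges[of un, OF un(1) bound] obtain r u where r: "strict_mono (r :: nat \<Rightarrow> nat)"
    and u: "edge_continuous u" "\<And>e x. \<not> (e \<in> arcs G \<and> x \<in> {0..len e}) \<Longrightarrow> u e x = 0"
      "\<And>\<delta>. \<delta> > 0 \<Longrightarrow> \<exists>N. \<forall>n\<ge>N. close \<delta> (un (r n)) u" by blast
  have ec: "edge_continuous (un (r n))" for n by (rule H1_edge_continuous[OF un(1)])
  have cont: "continuous_on UNIV (\<lambda>x::real. \<bar>x\<bar> powr p)" using p by (intro continuous_abs_powr) simp
  have "(\<lambda>n. power_integral (un (r n))) \<longlonglongrightarrow> power_integral u"
    unfolding power_integral_def by (rule nemytskii_tendsto[OF \<rho> cont u(1) ec u(3)])
  then have Nu: "power_integral u = 1" unfolding un(2) by (simp add: LIMSEQ_const_iff)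
  have lsc: "\<exists>\<delta>>0. \<forall>w\<in>H1. close \<delta> w u \<longrightarrow> c * power_integral u powr (2 / p) - \<epsilon> \<le> c * power_integral w powr (2 / p)"
    if \<epsilon>: "\<epsilon> > 0" for \<epsilon>
  proof -
    \<comment> \<open>u is already known to satisfy the constraint, so continuity of the power at 1
      is enough.\<close>
    have "isCont (\<lambda>y. c * y powr (2 / p)) (1::real)" by (intro continuous_intros) auto
    then obtain d where d: "d > 0" "\<And>y. dist y 1 < d \<Longrightarrow> dist (c * y powr (2 / p)) (c * 1 powr (2 / p)) < \<epsilon>"
      using \<epsilon> unfolding continuous_at_eps_delta by metis
    obtain \<delta> where \<delta>: "\<delta> > 0" "\<And>w. edge_continuous w \<Longrightarrow> close \<delta> w u
      \<Longrightarrow> \<bar>gint (\<lambda>e x. \<rho> e x * \<bar>w e x\<bar> powr p) - gint (\<lambda>e x. \<rho> e x * \<bar>u e x\<bar> powr p)\<bar> \<le> d / 2"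
      by (rule nemytskii_continuous[OF \<rho> cont u(1), of "d / 2"]) (use d(1) in auto)
    show ?thesis
    proof (intro exI[of _ \<delta>] conjI ballI impI \<delta>(1))
      fix w assume "w \<in> H1" "close \<delta> w u"
      then have "\<bar>power_integral w - power_integral u\<bar> \<le> d / 2"
        unfolding power_integral_def by (intro \<delta>(2) H1_edge_continuous)
      then have "dist (power_integral w) 1 < d" using d(1) by (simp add: Nu dist_real_def)
      from d(2)[OF this] show "c * power_integral u powr (2 / p) - \<epsilon> \<le> c * power_integral w powr (2 / p)"
        by (simp add: Nu dist_real_def abs_less_iff)
    qed
  qed
  have upper: "\<exists>N. \<forall>n\<ge>N. ?Q (un (r n)) \<le> c * power_integral u powr (2 / p) + \<epsilon>" if \<epsilon>: "\<epsilon> > 0" for \<epsilon>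
  proof -
    obtain N :: nat where N: "1 / real (Suc N) < \<epsilon>" using nat_approx_posE[OF \<epsilon>] by blast
    show ?thesis
    proof (intro exI[of _ N] allI impI)
      fix n assume "n \<ge> N"
      then have "N \<le> r n" using seq_suble[OF r, of n] by linarith
      then have "1 / real (Suc (r n)) \<le> 1 / real (Suc N)" by (intro divide_left_mono) auto
      then show "?Q (un (r n)) \<le> c * power_integral u powr (2 / p) + \<epsilon>" using un(3)[of "r n"] N Nu by simp
    qed
  qed
  note limit = minimizing_sequence_limit[OF shifted_Linfty order_refl, where un="\<lambda>n. un (r n)"
      and \<Psi>="\<lambda>w. c * power_integral w powr (2 / p)" and u=u, OF un(1) H1_linear_combination lower lsc upper u(3) u(2)]
  have uH: "u \<in> H1" by (rule limit(1))
  have Qu: "?Q u = c" using limit(2) lower[OF uH] Nu by simp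
  have "u \<noteq> 0"
  proof
    assume "u = 0"
    then have "power_integral u = 0" using p by (simp add: power_integral_def graph_integral_def)
    then show False using Nu by simp
  qed
  then have "0 < \<kappa> * inner_L2 u u" using inner_L2_pos[OF uH] \<open>\<kappa> > 0\<close> by simp
  then have "?Q u > 0" using pos[OF uH] by linarith
  then show ?thesis using that[OF uH Nu] lower unfolding Qu by blast
qed

text \<open>The first order condition carries the Lagrange multiplier c, which rescaling removes as
  p > 2. The second order condition is nonnegativity of the second variation on the kernel of \<phi>
  -> V(\<phi>, u), which bounds the Morse index by 1.\<close>

lemma admissible_above:
  assumes lam: "- eigenvalue G len W 1 < lam"
  shows "lam \<in> admissible_lambdas G len p W \<rho> 1"
proof -
  obtain v \<mu> where bottom: "\<And>w. w \<in> H1 \<Longrightarrow> \<mu> 0 * inner_L2 w w \<le> energy W w w"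
    and ev: "\<And>n. eigenvalue G len W (Suc n) = \<mu> n"
    by (rule spectral_theorem[OF W nonempty]) blast
  let ?Q = "energy (shifted lam)"
  have lb: "(\<mu> 0 + lam) * inner_L2 w w \<le> ?Q w w" if "w \<in> H1" for w
    using bottom[OF that] by (simp add: energy_shifted[OF that that] distrib_right)
  have pos: "\<mu> 0 + lam > 0" using lam ev[of 0] by simp
  obtain u where u: "u \<in> H1" "power_integral u = 1" and Qpos: "0 < ?Q u u"
    and Qmin: "\<forall>w\<in>H1. ?Q u u * power_integral w powr (2 / p) \<le> ?Q w w"
    by (rule constrained_nonlinear_minimizer[OF lb pos]) blast
  define c where "c = ?Q u u"
  have c: "c > 0" "?Q u u = c" and min: "\<And>w. w \<in> H1 \<Longrightarrow> c * power_integral w powr (2 / p) \<le> ?Q w w"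
    using Qpos Qmin by (simp_all add: c_def)
  let ?V = "weighted_inner (power_weight u)"
  have uc: "edge_continuous u" by (rule H1_edge_continuous[OF u(1)])
  have cond: "?Q u \<phi> = c * ?V u \<phi>" "?V u \<phi> = 0 \<Longrightarrow> c * (p - 1) * ?V \<phi> \<phi> \<le> ?Q \<phi> \<phi>" if \<phi>: "\<phi> \<in> H1" for \<phi>
  proof -
    let ?n = "\<lambda>t. power_integral (1 *\<^sub>R u + t *\<^sub>R \<phi>)"
    have nn: "0 \<le> ?n t" for t
      unfolding power_integral_def
    proof (rule gint_nonneg)
      fix e assume "e \<in> arcs G"
      from \<rho>_nonneg[OF this] show "AE x in edge_measure (len e). 0 \<le> \<rho> e x * \<bar>(1 *\<^sub>R u + t *\<^sub>R \<phi>) e x\<bar> powr p"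
        by eventually_elim simp
    qed
    have ex: "\<exists>\<delta>>0. \<forall>t. \<bar>t\<bar> \<le> \<delta> \<longrightarrow> \<bar>?n t - 1 - p * ?V u \<phi> * t - p * (p - 1) / 2 * ?V \<phi> \<phi> * t\<^sup>2\<bar> \<le> \<epsilon> * t\<^sup>2"
      if "\<epsilon> > 0" for \<epsilon>
      using power_integral_expansion[OF uc H1_edge_continuous[OF \<phi>] that] unfolding u(2) .
    have le: "c * ?n t powr (2 / p) \<le> c + 2 * t * ?Q u \<phi> + t\<^sup>2 * ?Q \<phi> \<phi>" for t
      using min[OF H1_linear_combination[OF u(1) \<phi>, of 1 t]]
        energy_square[OF shifted_Linfty u(1) \<phi>, of lam 1 t] c(2) by simp
    show "?Q u \<phi> = c * ?V u \<phi>" "?V u \<phi> = 0 \<Longrightarrow> c * (p - 1) * ?V \<phi> \<phi> \<le> ?Q \<phi> \<phi>"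
      using variation_conditions[OF p c(1) nn ex le] by blast+
  qed
  \<comment> \<open>Scaling u by k multiplies its power weight by k^(p-2) = c, which absorbs the
    multiplier.\<close>
  define k where "k = c powr (1 / (p - 2))"
  have k: "k > 0" using c(1) by (simp add: k_def)
  have kc: "k powr (p - 2) = c" using c(1) p by (simp add: k_def powr_powr)
  define U where "U = k *\<^sub>R u"
  have UH: "U \<in> H1" unfolding U_def by (rule H1_scale[OF u(1)])
  have VU: "weighted_inner (power_weight U) w \<phi> = c * ?V w \<phi>" for w \<phi>
    unfolding weighted_inner_def gint_cmult[symmetric]
    by (intro gint_cong) (use k in \<open>simp add: power_weight_def U_def scaleR_fun_def abs_mult powr_mult kc mult_ac\<close>)
  have "U \<noteq> 0"
  proof
    assume "U = 0"
    then have "u = 0" using k by (simp add: U_def)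
    then have "power_integral u = 0" using p by (simp add: power_integral_def graph_integral_def)
    then show False using u(2) by simp
  qed
  have "solves_E G len p W \<rho> lam U"
    unfolding solves_E_iff
  proof (intro conjI ballI UH)
    fix \<phi> assume \<phi>: "\<phi> \<in> H1"
    have "?Q U \<phi> = k * ?Q u \<phi>"
      using energy_lincomb[OF shifted_Linfty u(1) u(1) \<phi>, of lam k 0] by (simp add: U_def)
    moreover have "?V U \<phi> = k * ?V u \<phi>"
      using weighted_inner_lincomb[OF power_weight_Linfty[OF uc] uc uc H1_edge_continuous[OF \<phi>], of k 0] by (simp add: U_def)
    ultimately show "?Q U \<phi> = weighted_inner (power_weight U) U \<phi>" using cond(1)[OF \<phi>] by (simp add: VU)
  qed
  moreover have "morse_index G len p W \<rho> lam U \<le> enat 1"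
    unfolding morse_index_def
  proof (rule Sup_least)
    fix d assume "d \<in> {edim X |X. subspace X \<and> X \<subseteq> H1 \<and> (\<forall>\<phi>\<in>X - {0}. second_variation G len p W \<rho> lam U \<phi> < 0)}"
    then obtain X where X: "d = edim X" "subspace X" "X \<subseteq> H1"
      "\<forall>\<phi>\<in>X - {0}. second_variation G len p W \<rho> lam U \<phi> < 0" by auto
    have "edim X \<le> 1"
    proof (rule edim_le_one_of_linear_form[OF X(2), of "\<lambda>\<phi>. ?V \<phi> u"])
      show "?V (s *\<^sub>R x + t *\<^sub>R y) u = s * ?V x u + t * ?V y u" if "x \<in> X" "y \<in> X" for x y s t
        using that X(3) by (intro weighted_inner_lincomb power_weight_Linfty uc H1_edge_continuous) auto
      fix \<phi> assume \<phi>: "\<phi> \<in> X" "?V \<phi> u = 0"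
      show "\<phi> = 0"
      proof (rule ccontr)
        assume "\<phi> \<noteq> 0"
        have \<phi>H: "\<phi> \<in> H1" using \<phi>(1) X(3) by blast
        \<comment> \<open>The left side is (p - 1) times the form weighted by the power weight of U,
          so the second variation at U is nonnegative in the direction \<phi>.\<close>
        have "c * (p - 1) * ?V \<phi> \<phi> \<le> ?Q \<phi> \<phi>" using cond(2)[OF \<phi>H] \<phi>(2) by (simp add: weighted_inner_commute[of _ u \<phi>])
        then show False using bspec[OF X(4), of \<phi>] \<phi>(1) \<open>\<phi> \<noteq> 0\<close>
          by (simp add: second_variation_eq[OF UH \<phi>H] VU mult_ac)
      qed
    qed
    then show "d \<le> enat 1" by (simp add: X(1) one_enat_def)
  qed
  ultimately show ?thesis unfolding admissible_lambdas_def using UH \<open>U \<noteq> 0\<close> by blast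
qed

lemma admissible_eq: "admissible_lambdas G len p W \<rho> 1 = {- eigenvalue G len W 1<..}"
  using admissible_strict admissible_above by auto

end

theorem proposition4p6:
  fixes G :: "('v, 'e) pre_digraph" and len :: "'e \<Rightarrow> real"
    and p :: real and m :: nat and W \<rho> :: "'e graph_fun"
  assumes "compact_metric_graph G len"
    and "p > 2" and "m \<ge> 1"
    and "W \<in> graph_Linfty G len"
    and "\<rho> \<in> graph_Linfty G len" and "\<not> graph_AE_zero G len \<rho>"
    and "\<exists>a>0. \<forall>e\<in>arcs G. (AE x in edge_measure (len e). \<rho> e x \<ge> a)
                        \<or> (AE x in edge_measure (len e). \<rho> e x = 0)"
  shows "Lambda_inf G len p W \<rho> m \<ge> ereal (- eigenvalue G len W (m + 1))
    \<and> (m = 1 \<and> graph_essinf G len \<rho> > 0 \<longrightarrow>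
         Lambda_inf G len p W \<rho> 1 = ereal (- eigenvalue G len W 1)
         \<and> (\<forall>lam\<in>admissible_lambdas G len p W \<rho> 1. ereal lam \<noteq> Lambda_inf G len p W \<rho> 1))"
proof -
  interpret compact_metric_graph G len by fact
  interpret nonlinear_problem G len p W \<rho>
  proof
    show "p > 2" "W \<in> graph_Linfty G len" "\<rho> \<in> graph_Linfty G len" by fact+
    show "arcs G \<noteq> {}" using assms(6) by (auto simp: graph_AE_zero_def)
    fix e assume e: "e \<in> arcs G"
    obtain a where a: "a > 0" "(AE x in edge_measure (len e). \<rho> e x \<ge> a) \<or> (AE x in edge_measure (len e). \<rho> e x = 0)"
      using assms(7) e by blast
    then show "AE x in edge_measure (len e). 0 \<le> \<rho> e x" by (auto elim!: eventually_mono)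
  qed
  have "ereal (- eigenvalue G len W (m + 1)) \<le> Lambda_inf G len p W \<rho> m"
    unfolding Lambda_inf_def using admissible_lower_bound by (intro Inf_greatest) auto
  moreover have "Lambda_inf G len p W \<rho> 1 = ereal (- eigenvalue G len W 1)
      \<and> (\<forall>lam\<in>admissible_lambdas G len p W \<rho> 1. ereal lam \<noteq> Lambda_inf G len p W \<rho> 1)"
    if ess: "graph_essinf G len \<rho> > 0"
  proof -
    obtain c where c: "0 < c" "\<forall>e\<in>arcs G. AE x in edge_measure (len e). c \<le> ereal (\<rho> e x)"
      using ess unfolding graph_essinf_def less_Sup_iff by blast
    interpret positive_nonlinear_problem G len p W \<rho>
    proof
      fix e assume "e \<in> arcs G"
      then have "AE x in edge_measure (len e). c \<le> ereal (\<rho> e x)" using c(2) by blast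
      then show "AE x in edge_measure (len e). 0 < \<rho> e x"
      proof eventually_elim
        case (elim x)
        with c(1) have "0 < ereal (\<rho> e x)" by (rule less_le_trans)
        then show ?case by simp
      qed
    qed
    let ?a = "- eigenvalue G len W 1"
    \<comment> \<open>The admissible set is an open half-line: its infimum is the excluded endpoint,
      which settles both the value and the non-attainment.\<close>
    have "Inf (ereal ` {?a<..}) = ereal ?a"
    proof (rule antisym)
      show "ereal ?a \<le> Inf (ereal ` {?a<..})" by (intro Inf_greatest) auto
      show "Inf (ereal ` {?a<..}) \<le> ereal ?a"
      proof (rule ereal_le_epsilon2)
        fix \<epsilon> :: real assume "0 < \<epsilon>"
        then have "ereal (?a + \<epsilon>) \<in> ereal ` {?a<..}" by auto
        then show "Inf (ereal ` {?a<..}) \<le> ereal ?a + ereal \<epsilon>" by (simp add: Inf_lower)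
      qed
    qed
    then show ?thesis unfolding Lambda_inf_def admissible_eq by auto
  qed
  ultimately show ?thesis by blast
qed

end
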